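(* Let $q$ be a prime power, let $N,D$ be integers with $D\ge3$, $N\ge2D$, let $C$ be a Delsarte clique of the Grassmann graph $J_q(N,D)$ and $x\in C$. Let $\tau=-q^{(-N-1)/2}$, let $\ell^\pm_i$ ($0\le i\le D-1$) be the non-symmetric dual $q$-Hahn polynomials, and let $\mathcal L=\sum_{i=-D}^{D-1}\mathbb C\zeta^i\subseteq\mathbb C[\zeta,\zeta^{-1}]$ (so that $\{\ell_i^\pm\}_{i=0}^{D-1}$ is a basis of $\mathcal L$) carry the Hermitian form $$\langle f,g\rangle_{\mathcal L}=\sum_{i=-D}^{D-1}f(\lambda_i)\overline{g(\lambda_i)}\,\omega_i+\sum_{i=1}^{D-1}\Big(f(\lambda_i)\overline{g(\lambda_{-i})}+f(\lambda_{-i})\overline{g(\lambda_i)}\Big)\omega^\vee_i ,$$ where $\lambda_i=\tau q^i$ for $0\le i\le D-1$, $\lambda_i=\tau^{-1}q^i$ for $-D\le i\le-1$, $\omega_i=\lVert\mathbf y_i\rVert^2$ and $\omega^\vee_i=\langle\mathbf y_i,\mathbf y_{-i}\rangle$. Then for $0\le i,j\le D-1$ and $\sigma,\nu\in\{+,-\}$, $$\langle\ell^\sigma_i,\ell^\nu_j\rangle_{\mathcal L}=\delta_{i,j}\delta_{\sigma,\nu}|C^\sigma_i|=\begin{cases}\delta_{i,j}\delta_{\sigma,\nu}\,q^{i(i+1)}\displaystyle\prod_{h=1}^i\frac{(q^{D-h}-1)(q^{N-D+1-h}-1)}{(q^h-1)^2},&\sigma=-,\\[1em]\delta_{i,j}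\delta_{\sigma,\nu}\,\dfrac{q^{(i+1)^2}(q^{N-D}-1)}{q-1}\displaystyle\prod_{h=1}^i\frac{(q^{D-h}-1)(q^{N-D-h}-1)}{(q^h-1)(q^{h+1}-1)},&\sigma=+.\end{cases}$$
   Context: Graph notation. $[n]:=\frac{q^n-1}{q-1}$. $\Gamma=J_q(N,D)$ has as vertex set $X$ all $D$-dimensional subspaces of an $N$-dimensional vector space over $\mathbb F_q$, adjacency meaning intersection of dimension $D-1$; $\partial$ is path-length distance. The adjacency matrix $A$ has eigenvalues $\theta_i=q^{i+1}[D-i][N-D-i]-[i]$, $0\le i\le D$; $E_i$ is the orthogonal projection of $\mathbb C^X$ onto the $\theta_i$-eigenspace. A Delsarte clique is a clique of size $[N-D+1]$ (attaining the Hoffman bound). For $0\le i\le D-1$: $C_i=\{y\in X:\min_{z\in C}\partial(y,z)=i\}$, $C^-_i=\{y\in C_i:\partial(x,y)=i\}$, $C^+_i=\{y\in C_i:\partial(x,y)=i+1\}$. $\hat Y\in\mathbb C^X$ is the characteristic vector of $Y\subseteq X$, $\hat x$ that of $\{x\}$. $\langle u,v\rangle=u^t\bar v$ on $\mathbb C^X$, $\lVert u\rVert^2=\langle u,u\rangle$. Vectors $\mathbf y_i\in\mathbb C^X$. Let $u_0^\perp=(q^{D-1}-1)\hat C^+_0+(q^{-1}-1)\hat C^-_1$. For $1\le i\le D-1$, $$\mathbf y_i=\frac{(q^{D-i}-1)(q^{N-i+1}-1)}{(q^D-1)(q^{N-2i+1}-1)}E_i\hat x+\frac{q^{D+1-i}(q-1)}{(q^D-1)(q^{N-2i+1}-1)}E_iu_0^\perp,$$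 $$\mathbf y_{-i}=\frac{q^{D-i}(q^i-1)(q^{N-D-i+1}-1)}{(q^D-1)(q^{N-2i+1}-1)}E_i\hat x-\frac{q^{D-i+1}(q-1)}{(q^D-1)(q^{N-2i+1}-1)}E_iu_0^\perp,$$ and $\mathbf y_0=E_0\hat x$, $\mathbf y_{-D}=E_D\hat x$. Polynomials. $(\alpha;q)_n=\prod_{j=0}^{n-1}(1-\alpha q^j)$ and ${}_3\phi_2\!\left(\begin{smallmatrix}\alpha_1,\alpha_2,\alpha_3\\ \beta_1,\beta_2\end{smallmatrix}\middle|q;z\right)=\sum_{n\ge0}\frac{(\alpha_1;q)_n(\alpha_2;q)_n(\alpha_3;q)_n}{(\beta_1;q)_n(\beta_2;q)_n}\frac{z^n}{(q;q)_n}$ (below the sums terminate at $n=i$). Define $$h_i(\zeta)=\frac{(q^{D-N};q)_i(q^{-D};q)_i}{\tau^i}\,{}_3\phi_2\!\left(\begin{matrix}q^{-i},\tau\zeta^{-1},\tau\zeta\\ q^{D-N},q^{-D}\end{matrix}\middle|q;q\right)\quad(0\le i\le D),$$ $$h^\perp_i(\zeta)=\frac{(q^{D-N+1};q)_i(q^{2-D};q)_i}{(\tau q)^i}\,{}_3\phi_2\!\left(\begin{matrix}q^{-i},\tau q\zeta^{-1},\tau q\zeta\\ q^{D-N+1},q^{2-D}\end{matrix}\middle|q;q\right)\quad(0\le i\le D-2),$$ $$h^\perp_{D-1}(\zeta)=\prod_{j=1}^{D-1}(\zeta+\zeta^{-1}-\tau q^j-\tau^{-1}q^{-j}),\qquad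 p^\perp(\zeta)=\zeta^{-1}(\zeta-\tau)(\zeta-\tau^{-1}q^{-D}).$$ For $0\le i\le D-1$, $$\ell^-_i=\frac{q^D-q^i}{\tau^i(q^D-1)(q;q)_i^2}\Big(h_i-\frac{1-q^i}{q^D-q^i}p^\perp h^\perp_{i-1}\Big),\qquad \ell^+_i=\frac{q^{i+1}-1}{\tau^{i+1}(q^D-1)(q;q)_{i+1}^2}\big(h_{i+1}-p^\perp h^\perp_i\big),$$ where for $i=0$ the term containing $h^\perp_{-1}$ is $0$. *)

theory Defs
  imports "HOL-Analysis.Analysis" "HOL-Library.Poly_Mapping"
begin

section \<open>The space of complex functions on a finite set\<close>

text \<open>A vector of \<open>\<complex>\<^sup>X\<close> is a function that vanishes outside \<open>X\<close>.\<close>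

definition cvecs :: "'x set \<Rightarrow> ('x \<Rightarrow> complex) set" where
  "cvecs X = {u. \<forall>y. y \<notin> X \<longrightarrow> u y = 0}"

definition cinner :: "'x set \<Rightarrow> ('x \<Rightarrow> complex) \<Rightarrow> ('x \<Rightarrow> complex) \<Rightarrow> complex" where
  "cinner X u v = (\<Sum>y\<in>X. u y * cnj (v y))"

definition charvec :: "'x set \<Rightarrow> 'x \<Rightarrow> complex" where
  "charvec Y = (\<lambda>y. if y \<in> Y then 1 else 0)"

definition adj_matrix :: "('x \<times> 'x) set \<Rightarrow> 'x \<Rightarrow> 'x \<Rightarrow> complex" where
  "adj_matrix R y z = (if (y, z) \<in> R then 1 else 0)"

definition eigenspace :: "'x set \<Rightarrow> ('x \<Rightarrow> 'x \<Rightarrow> complex) \<Rightarrow> complex \<Rightarrow> ('x \<Rightarrow> complex) set" where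
  "eigenspace X A \<theta> = {u \<in> cvecs X. \<forall>y\<in>X. (\<Sum>z\<in>X. A y z * u z) = \<theta> * u y}"

definition orth_proj :: "'x set \<Rightarrow> ('x \<Rightarrow> complex) set \<Rightarrow> ('x \<Rightarrow> complex) \<Rightarrow> ('x \<Rightarrow> complex)" where
  "orth_proj X W u = (THE w. w \<in> W \<and> (\<forall>v\<in>W. cinner X (\<lambda>y. u y - w y) v = 0))"

definition path_dist :: "('x \<times> 'x) set \<Rightarrow> 'x \<Rightarrow> 'x \<Rightarrow> nat" where
  "path_dist R y z = (LEAST n. (y, z) \<in> R ^^ n)"


section \<open>Grassmann graphs and Delsarte cliques\<close>

text \<open>The ambient vector space is the type \<open>'v\<close> with scalar multiplication \<open>sc\<close> over the
  finite field \<open>'k\<close>; the parameters \<open>q\<close> and \<open>N\<close> below are meant to be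
  \<open>CARD('k)\<close> and \<open>vector_space.dim sc UNIV\<close>.\<close>

definition qnum :: "nat \<Rightarrow> nat \<Rightarrow> real" where
  "qnum q n = (real q ^ n - 1) / (real q - 1)"

definition grass_verts :: "('k::field \<Rightarrow> 'v::ab_group_add \<Rightarrow> 'v) \<Rightarrow> nat \<Rightarrow> 'v set set" where
  "grass_verts sc D = {W. module.subspace sc W \<and> vector_space.dim sc W = D}"

definition grass_edges :: "('k::field \<Rightarrow> 'v::ab_group_add \<Rightarrow> 'v) \<Rightarrow> nat \<Rightarrow> ('v set \<times> 'v set) set" where
  "grass_edges sc D = {(y, z). y \<in> grass_verts sc D \<and> z \<in> grass_verts sc D \<and>
     vector_space.dim sc (y \<inter> z) = D - 1}"

definition grass_dist :: "('k::field \<Rightarrow> 'v::ab_group_add \<Rightarrow> 'v) \<Rightarrow> nat \<Rightarrow> 'v set \<Rightarrow> 'v set \<Rightarrow> nat" where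
  "grass_dist sc D = path_dist (grass_edges sc D)"

definition grass_eig :: "nat \<Rightarrow> nat \<Rightarrow> nat \<Rightarrow> nat \<Rightarrow> real" where
  "grass_eig q N D i = real q ^ (i + 1) * qnum q (D - i) * qnum q (N - D - i) - qnum q i"

definition grass_E :: "('k::field \<Rightarrow> 'v::ab_group_add \<Rightarrow> 'v) \<Rightarrow> nat \<Rightarrow> nat \<Rightarrow> nat \<Rightarrow> nat
    \<Rightarrow> ('v set \<Rightarrow> complex) \<Rightarrow> ('v set \<Rightarrow> complex)" where
  "grass_E sc q N D i = orth_proj (grass_verts sc D)
     (eigenspace (grass_verts sc D) (adj_matrix (grass_edges sc D))
        (complex_of_real (grass_eig q N D i)))"

definition delsarte_clique :: "('k::field \<Rightarrow> 'v::ab_group_add \<Rightarrow> 'v) \<Rightarrow> nat \<Rightarrow> nat \<Rightarrow> nat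
    \<Rightarrow> 'v set set \<Rightarrow> bool" where
  "delsarte_clique sc q N D C \<longleftrightarrow> C \<subseteq> grass_verts sc D \<and>
     (\<forall>y\<in>C. \<forall>z\<in>C. y \<noteq> z \<longrightarrow> (y, z) \<in> grass_edges sc D) \<and>
     real (card C) = qnum q (N - D + 1)"

definition Cset :: "('k::field \<Rightarrow> 'v::ab_group_add \<Rightarrow> 'v) \<Rightarrow> nat \<Rightarrow> 'v set set \<Rightarrow> nat
    \<Rightarrow> 'v set set" where
  "Cset sc D C i = {y \<in> grass_verts sc D. Min ((\<lambda>z. grass_dist sc D y z) ` C) = i}"

datatype pm = Minus | Plus

fun Cpm :: "('k::field \<Rightarrow> 'v::ab_group_add \<Rightarrow> 'v) \<Rightarrow> nat \<Rightarrow> 'v set set \<Rightarrow> 'v set \<Rightarrow> pm \<Rightarrow> nat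
    \<Rightarrow> 'v set set" where
  "Cpm sc D C x Minus i = {y \<in> Cset sc D C i. grass_dist sc D x y = i}"
| "Cpm sc D C x Plus i = {y \<in> Cset sc D C i. grass_dist sc D x y = i + 1}"

definition u0perp :: "('k::field \<Rightarrow> 'v::ab_group_add \<Rightarrow> 'v) \<Rightarrow> nat \<Rightarrow> nat \<Rightarrow> 'v set set \<Rightarrow> 'v set
    \<Rightarrow> ('v set \<Rightarrow> complex)" where
  "u0perp sc q D C x = (\<lambda>y. (of_nat q ^ (D - 1) - 1) * charvec (Cpm sc D C x Plus 0) y
     + (inverse (of_nat q) - 1) * charvec (Cpm sc D C x Minus 1) y)"

definition yvec_pos :: "('k::field \<Rightarrow> 'v::ab_group_add \<Rightarrow> 'v) \<Rightarrow> nat \<Rightarrow> nat \<Rightarrow> nat \<Rightarrow> 'v set set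
    \<Rightarrow> 'v set \<Rightarrow> nat \<Rightarrow> ('v set \<Rightarrow> complex)" where
  "yvec_pos sc q N D C x i = (let Q = (of_nat q :: complex) in
     (\<lambda>y. (Q ^ (D - i) - 1) * (Q ^ (N - i + 1) - 1) / ((Q ^ D - 1) * (Q ^ (N - 2 * i + 1) - 1))
            * grass_E sc q N D i (charvec {x}) y
        + Q ^ (D + 1 - i) * (Q - 1) / ((Q ^ D - 1) * (Q ^ (N - 2 * i + 1) - 1))
            * grass_E sc q N D i (u0perp sc q D C x) y))"

definition yvec_neg :: "('k::field \<Rightarrow> 'v::ab_group_add \<Rightarrow> 'v) \<Rightarrow> nat \<Rightarrow> nat \<Rightarrow> nat \<Rightarrow> 'v set set
    \<Rightarrow> 'v set \<Rightarrow> nat \<Rightarrow> ('v set \<Rightarrow> complex)" where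
  "yvec_neg sc q N D C x i = (let Q = (of_nat q :: complex) in
     (\<lambda>y. Q ^ (D - i) * (Q ^ i - 1) * (Q ^ (N - D - i + 1) - 1)
              / ((Q ^ D - 1) * (Q ^ (N - 2 * i + 1) - 1))
            * grass_E sc q N D i (charvec {x}) y
        - Q ^ (D - i + 1) * (Q - 1) / ((Q ^ D - 1) * (Q ^ (N - 2 * i + 1) - 1))
            * grass_E sc q N D i (u0perp sc q D C x) y))"

definition yvec :: "('k::field \<Rightarrow> 'v::ab_group_add \<Rightarrow> 'v) \<Rightarrow> nat \<Rightarrow> nat \<Rightarrow> nat \<Rightarrow> 'v set set
    \<Rightarrow> 'v set \<Rightarrow> int \<Rightarrow> ('v set \<Rightarrow> complex)" where
  "yvec sc q N D C x i =
     (if i = 0 then grass_E sc q N D 0 (charvec {x})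
      else if i = - int D then grass_E sc q N D D (charvec {x})
      else if i > 0 then yvec_pos sc q N D C x (nat i)
      else yvec_neg sc q N D C x (nat (- i)))"


section \<open>Laurent polynomials\<close>

text \<open>Finitely supported functions \<open>int \<Rightarrow>\<^sub>0 complex\<close> with convolution as multiplication
  form the ring \<open>\<complex>[\<zeta>, \<zeta>\<^sup>-\<^sup>1]\<close>.\<close>

type_synonym laurent = "int \<Rightarrow>\<^sub>0 complex"

definition lconst :: "complex \<Rightarrow> laurent" where
  "lconst c = Poly_Mapping.single 0 c"

definition zet :: "int \<Rightarrow> laurent" where
  "zet k = Poly_Mapping.single k 1"

definition lscale :: "complex \<Rightarrow> laurent \<Rightarrow> laurent" where
  "lscale c f = lconst c * f"

definition leval :: "laurent \<Rightarrow> complex \<Rightarrow> complex" where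
  "leval f z = (\<Sum>k\<in>Poly_Mapping.keys f. Poly_Mapping.lookup f k * z powi k)"

definition Lspace :: "nat \<Rightarrow> laurent set" where
  "Lspace D = {f. \<exists>c. f = (\<Sum>k = - int D..int D - 1. lscale (c k) (zet k))}"


section \<open>The non-symmetric dual q-Hahn polynomials\<close>

definition qpoch :: "'a::comm_ring_1 \<Rightarrow> 'a \<Rightarrow> nat \<Rightarrow> 'a" where
  "qpoch a q n = (\<Prod>j<n. 1 - a * q ^ j)"

text \<open>The series \<open>\<^sub>3\<phi>\<^sub>2(a\<^sub>1, a\<^sub>2, a\<^sub>3; b\<^sub>1, b\<^sub>2 | q; z)\<close> for scalars \<open>a\<^sub>1, b\<^sub>1, b\<^sub>2, z\<close> and Laurent
  polynomials \<open>a\<^sub>2, a\<^sub>3\<close>. \<open>Sum_any\<close> is the sum over all \<open>n\<close> of a family with finitely many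
  nonzero members. In the uses below \<open>a\<^sub>1 = q\<^sup>-\<^sup>i\<close>, so every term with \<open>n > i\<close> is zero (also when
  a lower Pochhammer symbol vanishes, as division by zero yields zero), and for \<open>n \<le> i\<close> the
  denominators do not vanish.\<close>

definition phi32 :: "complex \<Rightarrow> laurent \<Rightarrow> laurent \<Rightarrow> complex \<Rightarrow> complex \<Rightarrow> complex \<Rightarrow> complex
    \<Rightarrow> laurent" where
  "phi32 a1 a2 a3 b1 b2 q z = Sum_any (\<lambda>n::nat.
     lconst (qpoch a1 q n / (qpoch b1 q n * qpoch b2 q n) * (z ^ n / qpoch q q n))
       * qpoch a2 (lconst q) n * qpoch a3 (lconst q) n)"

definition tau :: "nat \<Rightarrow> nat \<Rightarrow> complex" where
  "tau q N = - complex_of_real (real q powr ((- real N - 1) / 2))"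

definition hpoly :: "nat \<Rightarrow> nat \<Rightarrow> nat \<Rightarrow> nat \<Rightarrow> laurent" where
  "hpoly q N D i = (let Q = (of_nat q :: complex); t = tau q N in
     lconst (qpoch (Q powi (int D - int N)) Q i * qpoch (Q powi (- int D)) Q i / t ^ i)
     * phi32 (Q powi (- int i)) (lconst t * zet (- 1)) (lconst t * zet 1)
         (Q powi (int D - int N)) (Q powi (- int D)) Q Q)"

definition hperp :: "nat \<Rightarrow> nat \<Rightarrow> nat \<Rightarrow> nat \<Rightarrow> laurent" where
  "hperp q N D i = (let Q = (of_nat q :: complex); t = tau q N in
     if i = D - 1
     then (\<Prod>j = 1..D - 1. zet 1 + zet (- 1) - lconst (t * Q ^ j)
             - lconst (inverse t * Q powi (- int j)))
     else lconst (qpoch (Q powi (int D - int N + 1)) Q i * qpoch (Q powi (2 - int D)) Q i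
                   / (t * Q) ^ i)
          * phi32 (Q powi (- int i)) (lconst (t * Q) * zet (- 1)) (lconst (t * Q) * zet 1)
              (Q powi (int D - int N + 1)) (Q powi (2 - int D)) Q Q)"

definition pperp :: "nat \<Rightarrow> nat \<Rightarrow> nat \<Rightarrow> laurent" where
  "pperp q N D = (let Q = (of_nat q :: complex); t = tau q N in
     zet (- 1) * (zet 1 - lconst t) * (zet 1 - lconst (inverse t * Q powi (- int D))))"

fun ell :: "nat \<Rightarrow> nat \<Rightarrow> nat \<Rightarrow> pm \<Rightarrow> nat \<Rightarrow> laurent" where
  "ell q N D Minus i = (let Q = (of_nat q :: complex); t = tau q N in
     lconst ((Q ^ D - Q ^ i) / (t ^ i * (Q ^ D - 1) * (qpoch Q Q i)\<^sup>2))
     * (hpoly q N D i -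
        (if i = 0 then 0
         else lconst ((1 - Q ^ i) / (Q ^ D - Q ^ i)) * pperp q N D * hperp q N D (i - 1))))"
| "ell q N D Plus i = (let Q = (of_nat q :: complex); t = tau q N in
     lconst ((Q ^ (i + 1) - 1) / (t ^ (i + 1) * (Q ^ D - 1) * (qpoch Q Q (i + 1))\<^sup>2))
     * (hpoly q N D (i + 1) - pperp q N D * hperp q N D i))"


section \<open>The Hermitian form\<close>

definition lam :: "nat \<Rightarrow> nat \<Rightarrow> int \<Rightarrow> complex" where
  "lam q N i = (if i \<ge> 0 then tau q N * of_nat q powi i else inverse (tau q N) * of_nat q powi i)"

definition omega :: "('k::field \<Rightarrow> 'v::ab_group_add \<Rightarrow> 'v) \<Rightarrow> nat \<Rightarrow> nat \<Rightarrow> nat \<Rightarrow> 'v set set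
    \<Rightarrow> 'v set \<Rightarrow> int \<Rightarrow> complex" where
  "omega sc q N D C x i =
     cinner (grass_verts sc D) (yvec sc q N D C x i) (yvec sc q N D C x i)"

definition omega_check :: "('k::field \<Rightarrow> 'v::ab_group_add \<Rightarrow> 'v) \<Rightarrow> nat \<Rightarrow> nat \<Rightarrow> nat \<Rightarrow> 'v set set
    \<Rightarrow> 'v set \<Rightarrow> int \<Rightarrow> complex" where
  "omega_check sc q N D C x i =
     cinner (grass_verts sc D) (yvec sc q N D C x i) (yvec sc q N D C x (- i))"

definition Lform :: "('k::field \<Rightarrow> 'v::ab_group_add \<Rightarrow> 'v) \<Rightarrow> nat \<Rightarrow> nat \<Rightarrow> nat \<Rightarrow> 'v set set
    \<Rightarrow> 'v set \<Rightarrow> laurent \<Rightarrow> laurent \<Rightarrow> complex" where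
  "Lform sc q N D C x f g =
     (\<Sum>i = - int D..int D - 1.
        leval f (lam q N i) * cnj (leval g (lam q N i)) * omega sc q N D C x i)
   + (\<Sum>i = 1..int D - 1.
        (leval f (lam q N i) * cnj (leval g (lam q N (- i)))
         + leval f (lam q N (- i)) * cnj (leval g (lam q N i))) * omega_check sc q N D C x i)"

end

theory Submission
  imports Defs
begin

text \<open>
  The key fact is that \<open>\<ell>\<^sub>i\<^sup>\<sigma>\<close> describes the characteristic vector of \<open>C\<^sub>i\<^sup>\<sigma>\<close> in the basis of the
  \<open>y\<^sub>k\<close>: it equals \<open>\<Sum>\<^sub>k \<ell>\<^sub>i\<^sup>\<sigma>(\<lambda>\<^sub>k) y\<^sub>k\<close>. Since \<open>y\<^sub>k\<close> lies in the \<open>\<bar>k\<bar>\<close>-th eigenspace of the adjacency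
  matrix, the form on \<open>\<L>\<close> is then the standard inner product of these vectors, and the cells are
  disjoint.

  To prove the key fact, count neighbours to see that the cells form an equitable partition (with
  the same quotient matrix for both kinds of maximal cliques). The vectors
  \<open>C\<^sub>i\<^sup>- + C\<^sub>i\<^sub>-\<^sub>1\<^sup>+\<close> and \<open>(q\<^sup>i - 1) C\<^sub>i\<^sup>- - (q\<^sup>D - q\<^sup>i) C\<^sub>i\<^sub>-\<^sub>1\<^sup>+\<close> turn out to satisfy, up to scaling, the
  three-term recurrences of \<open>h\<^sub>i\<close> and \<open>h\<^sup>\<bottom>\<^sub>i\<close>. Each recurrence ends with the zero vector, so its
  initial vector (\<open>x\<close>, respectively \<open>u\<^sub>0\<^sup>\<bottom>\<close>) is annihilated by a polynomial with simple roots
  in the adjacency matrix and splits into eigenvectors, on which the recurrence is solved by the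
  values of \<open>h\<^sub>i\<close> and \<open>h\<^sup>\<bottom>\<^sub>i\<close>. Finally \<open>y\<^sub>k + y\<^sub>-\<^sub>k = E\<^sub>k x\<close>, and
  \<open>p\<^sup>\<bottom>(\<lambda>\<^sub>k) y\<^sub>k + p\<^sup>\<bottom>(\<lambda>\<^sub>-\<^sub>k) y\<^sub>-\<^sub>k\<close> is a multiple of \<open>E\<^sub>k u\<^sub>0\<^sup>\<bottom>\<close> by a factor independent of \<open>k\<close>.
\<close>

section \<open>A three-term recurrence and its q-Hahn solution\<close>

text \<open>No diagonalisation of the whole adjacency matrix enters. The projections of x and of
  u_0^perp are identified from eigenvector decompositions of just these two vectors, by
  orthogonality of eigenspaces with distinct eigenvalues. The parameter b = q^{-M} of each family (M
  = D for h, M = D - 2 for h^perp) makes the end of the recurrence an annihilating polynomial. The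
  second family has tau q in place of tau, so its M + 1 nodes are those with index 1..D-1; hence
  u_0^perp has no component for the indices 0 and D, in accordance with the zeros of p^perp at
  lambda_0 and lambda_{-D}.

  The exceptional h^perp_{D-1} vanishes at the nodes 1..D-1, just as the last vector of the second
  recurrence is zero. It leaves the values of ell^+_{D-1} at all lambda_k unchanged; its purpose is
  to cancel the term zeta^D of h_D, which keeps ell^+_{D-1} in L. Independence of the ell follows
  because the cells are non-empty, and 2D independent elements fill L.\<close>

lemma qpoch_0 [simp]: "qpoch a q 0 = 1"
  by (simp add: qpoch_def)

lemma qpoch_Suc: "qpoch a q (Suc n) = qpoch a q n * (1 - a * q ^ n)"
  by (simp add: qpoch_def)

lemma qpoch_add: "qpoch a q (m + n) = qpoch a q m * qpoch (a * q ^ m) q n"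
  by (induction n) (simp_all add: qpoch_Suc power_add mult_ac)

lemma qpoch_Suc_left: "qpoch a q (Suc n) = (1 - a) * qpoch (a * q) q n"
  using qpoch_add[of a q 1 n] by (simp add: qpoch_Suc)

lemma qpoch_shift: "qpoch a q n * (1 - a * q ^ n) = (1 - a) * qpoch (a * q) q n"
  by (metis qpoch_Suc qpoch_Suc_left)

lemma qpoch_eq_0_iff:
  fixes a :: "'a :: idom"
  shows "qpoch a q n = 0 \<longleftrightarrow> (\<exists>j<n. a * q ^ j = 1)"
  by (auto simp: qpoch_def)

text \<open>
  The coefficient of the \<open>n\<close>-th summand of \<open>h\<^sub>i\<close>, with \<open>(a;q)\<^sub>i/(a;q)\<^sub>n\<close> and \<open>(b;q)\<^sub>i/(b;q)\<^sub>n\<close> written as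
  \<open>(aq\<^sup>n;q)\<^sub>i\<^sub>-\<^sub>n\<close> and \<open>(bq\<^sup>n;q)\<^sub>i\<^sub>-\<^sub>n\<close>. In this form it also makes sense for \<open>b = q\<^sup>-\<^sup>M\<close> and \<open>i = M + 1\<close>, where
  only the summand \<open>n = i\<close> survives.
\<close>

definition qhahn_coeff :: "complex \<Rightarrow> complex \<Rightarrow> complex \<Rightarrow> complex \<Rightarrow> nat \<Rightarrow> nat \<Rightarrow> complex" where
  "qhahn_coeff Q t a b i n = (if n \<le> i
     then qpoch (Q powi (- int i)) Q n / qpoch Q Q n * Q ^ n
            * qpoch (a * Q ^ n) Q (i - n) * qpoch (b * Q ^ n) Q (i - n) / t ^ i
     else 0)"

text \<open>With t = \<alpha>, a = \<alpha>\<beta>, b = \<alpha>\<gamma>, \<open>qhahn_A\<close> and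
  \<open>qhahn_C\<close> are the recurrence coefficients A_n, C_n of the continuous dual q-Hahn
  polynomials with parameters \<alpha>, \<beta>, \<gamma>. The polynomials are kept monic in \<zeta>
  + 1/\<zeta>, so the recurrence contains the product A_{n-1} C_n.\<close>

definition qhahn_A :: "complex \<Rightarrow> complex \<Rightarrow> complex \<Rightarrow> complex \<Rightarrow> nat \<Rightarrow> complex" where
  "qhahn_A Q t a b n = (1 - a * Q ^ n) * (1 - b * Q ^ n) / t"

definition qhahn_C :: "complex \<Rightarrow> complex \<Rightarrow> complex \<Rightarrow> complex \<Rightarrow> nat \<Rightarrow> complex" where
  "qhahn_C Q t a b n = t * (1 - Q ^ n) * (1 - a * b * Q ^ n / (Q * t\<^sup>2))"

text \<open>What is left of the three-term recurrence after division by the common coefficient, with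
  x = q^i and y = q^n: all Pochhammer symbols have cancelled.\<close>

lemma qhahn_scalar:
  fixes q x y a b t :: complex
  assumes "q \<noteq> 0" "t \<noteq> 0" "x \<noteq> 0" "y \<noteq> 0" "q * x - y \<noteq> 0"
  shows "(q * x - 1) / (q * x - y) * (1 - a * x) * (1 - b * x) / t
       = (1 + t\<^sup>2 * y\<^sup>2) / (t * y)
         - q * x * (1 - y) / (q * x - y) * (1 - a * y / q) * (1 - b * y / q) / (t * y)
         - (t + 1 / t - (1 - a * x) * (1 - b * x) / t - t * (1 - x) * (1 - a * b * x / (q * t\<^sup>2)))
         + x * t * (1 - a * b * x / (q * t\<^sup>2)) * (1 - y / x)"
  using assms by (simp add: divide_simps) (simp add: algebra_simps power2_eq_square)

text \<open>This is \<open>qpoch_shift\<close> for the base q^{-i-1}, whose product with q is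
  q^{-i}, after clearing the denominator q^{i+1}. It describes how the first symbol of a summand
  changes with the degree.\<close>

lemma qpoch_ratio_Suc:
  fixes Q :: complex
  assumes "Q \<noteq> 0" and "n \<le> i"
  shows "qpoch (Q powi (- int (Suc i))) Q n * (Q * Q ^ i - Q ^ n)
       = (Q * Q ^ i - 1) * qpoch (Q powi (- int i)) Q n"
proof -
  define w where "w = Q powi (- int (Suc i))"
  have w: "w * (Q * Q ^ i) = 1" "w * Q = Q powi (- int i)"
    using assms unfolding w_def power_int_minus power_int_of_nat by (simp_all add: field_simps)
  have dist: "(1 - w * c) * z = z - w * z * c" for c z by (simp add: algebra_simps)
  have e: "(1 - w * Q ^ n) * (Q * Q ^ i) = Q * Q ^ i - Q ^ n" "(1 - w) * (Q * Q ^ i) = Q * Q ^ i - 1"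
    using dist[of "Q ^ n" "Q * Q ^ i"] dist[of 1 "Q * Q ^ i"] unfolding w(1) by simp_all
  have "qpoch w Q n * (Q * Q ^ i - Q ^ n) = qpoch w Q n * (1 - w * Q ^ n) * (Q * Q ^ i)"
    by (simp only: e(1) [symmetric] mult.assoc)
  also have "\<dots> = ((1 - w) * (Q * Q ^ i)) * qpoch (w * Q) Q n"
    unfolding qpoch_shift by (simp only: mult_ac)
  finally show ?thesis unfolding e(2) w(2) unfolding w_def .
qed

text \<open>Comparison of the coefficients of the n-th product (t\<zeta>;q)_n (t/\<zeta>;q)_n in the
  monic recurrence. Multiplication by \<zeta> + 1/\<zeta> sends the product with index n - 1 partly
  to the one with index n, which explains the second summand.\<close>

lemma qhahn_coeff_rec:
  fixes Q t a b :: complex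
  assumes Q: "Q \<noteq> 0" "\<And>m. m > 0 \<Longrightarrow> Q ^ m \<noteq> 1" and t: "t \<noteq> 0" and n: "n \<le> i"
  shows "qhahn_coeff Q t a b (Suc i) n =
      (1 + t\<^sup>2 * Q ^ (2 * n)) / (t * Q ^ n) * qhahn_coeff Q t a b i n
      - (if n = 0 then 0 else qhahn_coeff Q t a b i (n - 1) / (t * Q ^ (n - 1)))
      - (t + 1 / t - qhahn_A Q t a b i - qhahn_C Q t a b i) * qhahn_coeff Q t a b i n
      - (if i = 0 then 0 else qhahn_A Q t a b (i - 1) * qhahn_C Q t a b i
            * qhahn_coeff Q t a b (i - 1) n)"
proof -
  define x y where "x = Q ^ i" and "y = Q ^ n"
  define r where "r = qpoch (Q powi (- int i)) Q n / qpoch Q Q n"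
  \<comment> \<open>The coefficient at (i, n). The other three are written as rational multiples of
    it, which reduces the claim to \<open>qhahn_scalar\<close>.\<close>
  define G where "G = r * y * qpoch (a * y) Q (i - n) * qpoch (b * y) Q (i - n) / t ^ i"
  have nz: "x \<noteq> 0" "y \<noteq> 0" using Q by (auto simp: x_def y_def)
  have qp: "qpoch Q Q m \<noteq> 0" for m
    using Q(2)[of "Suc _"] by (auto simp: qpoch_eq_0_iff)
  have inj: "Q ^ j = Q ^ l \<longleftrightarrow> j = l" for j l
  proof (induction j l rule: linorder_wlog)
    case (le j l)
    then obtain d where "l = j + d" using le_Suc_ex by blast
    then show ?case using Q(1) Q(2)[of d] by (auto simp: power_add)
  qed auto
  have ne: "Q * x - y \<noteq> 0"
    using inj[of "Suc i" n] n by (simp add: x_def y_def)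
  have y2: "Q ^ (2 * n) = y\<^sup>2" by (simp add: y_def power_mult [symmetric] mult.commute)
  have k0: "qhahn_coeff Q t a b i n = G"
    using n by (simp add: qhahn_coeff_def G_def r_def y_def)
  have k1: "qhahn_coeff Q t a b (Suc i) n
      = G * ((Q * x - 1) / (Q * x - y) * (1 - a * x) * (1 - b * x) / t)"
  proof -
    have "qpoch (Q powi (- int (Suc i))) Q n
        = (Q * x - 1) * qpoch (Q powi (- int i)) Q n / (Q * x - y)"
      using qpoch_ratio_Suc[OF Q(1) n] ne by (simp add: x_def y_def divide_simps)
    moreover have "Suc i - n = Suc (i - n)" using n by simp
    moreover have "y * Q ^ (i - n) = x"
      using n by (simp add: x_def y_def flip: power_add)
    ultimately show ?thesis
      using n unfolding qhahn_coeff_def G_def r_def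
      by (simp add: qpoch_Suc y_def [symmetric] mult.assoc) (simp add: mult_ac)
  qed
  have k2: "(if n = 0 then 0 else qhahn_coeff Q t a b i (n - 1) / (t * Q ^ (n - 1)))
      = G * (Q * x * (1 - y) / (Q * x - y) * (1 - a * y / Q) * (1 - b * y / Q) / (t * y))"
  proof (cases n)
    case 0
    then show ?thesis by (simp add: y_def)
  next
    case (Suc m)
    have y: "y = Q * Q ^ m" by (simp add: y_def Suc)
    have im: "i - m = Suc (i - n)" using n Suc by simp
    have "Q powi (- int i) * Q ^ m = Q ^ m / x"
      using Q by (simp add: x_def power_int_minus field_simps)
    then have qi: "qpoch (Q powi (- int i)) Q n = qpoch (Q powi (- int i)) Q m * (1 - Q ^ m / x)"
      by (simp add: Suc qpoch_Suc)
    have q1: "qpoch Q Q n = qpoch Q Q m * (1 - y)"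
      by (simp add: Suc qpoch_Suc y)
    have y1: "1 - y \<noteq> 0" using Q(2)[of n] Suc by (simp add: y_def)
    have r: "qpoch (Q powi (- int i)) Q m / qpoch Q Q m = r * (Q * x * (1 - y) / (Q * x - y))"
    proof -
      have "1 - Q ^ m / x = (Q * x - y) / (Q * x)"
        using Q nz by (simp add: y divide_simps) (simp add: algebra_simps)
      then show ?thesis
        unfolding r_def qi q1 using y1 ne nz Q by (simp add: divide_simps)
    qed
    have "c * Q ^ m = c * y / Q" "c * Q ^ m * Q = c * y" for c
      using Q by (auto simp: y)
    then have "qpoch (c * Q ^ m) Q (i - m) = (1 - c * y / Q) * qpoch (c * y) Q (i - n)" for c
      unfolding im qpoch_Suc_left by simp
    moreover have "m \<le> i" using n Suc by simp
    ultimately have "qhahn_coeff Q t a b i m = r * (Q * x * (1 - y) / (Q * x - y)) * Q ^ m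
        * ((1 - a * y / Q) * qpoch (a * y) Q (i - n)) * ((1 - b * y / Q) * qpoch (b * y) Q (i - n)) / t ^ i"
      by (simp add: qhahn_coeff_def r)
    then show ?thesis
      using Q t nz by (simp add: Suc G_def mult_ac)
  qed
  have k3: "(if i = 0 then 0 else qhahn_A Q t a b (i - 1) * qhahn_C Q t a b i
            * qhahn_coeff Q t a b (i - 1) n)
      = - (G * (x * t * (1 - a * b * x / (Q * t\<^sup>2)) * (1 - y / x)))"
  proof (cases "i = n")
    \<comment> \<open>The left side is 0 by the convention for n > i in \<open>qhahn_coeff\<close>,
      the right side because y = x.\<close>
    case True
    then show ?thesis
      using nz by (cases i) (simp_all add: qhahn_coeff_def x_def y_def)
  next
    case False
    then obtain j where j: "i = Suc j" and nj: "n \<le> j"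
      using n by (cases i) auto
    have x: "x = Q * Q ^ j" by (simp add: x_def j)
    have ij: "i - n = Suc (j - n)" using nj j by simp
    have "c * Q ^ n * Q ^ (j - n) = c * Q ^ j" for c
      using nj by (simp add: mult.assoc flip: power_add)
    then have qc: "qpoch (c * y) Q (i - n) = qpoch (c * y) Q (j - n) * (1 - c * Q ^ j)" for c
      by (simp add: ij qpoch_Suc y_def)
    have "x - 1 \<noteq> 0" using Q(2)[of i] by (simp add: x_def j)
    then have "qpoch (Q powi (- int j)) Q n = (x - y) / (x - 1) * qpoch (Q powi (- int i)) Q n"
      using qpoch_ratio_Suc[OF Q(1) nj] unfolding j [symmetric] x [symmetric] y_def [symmetric]
      by (simp add: divide_simps mult_ac)
    then have "qhahn_coeff Q t a b j n
        = (x - y) / (x - 1) * r * y * qpoch (a * y) Q (j - n) * qpoch (b * y) Q (j - n) / t ^ j"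
      using nj by (simp add: qhahn_coeff_def r_def y_def)
    moreover have "G = r * y * (qpoch (a * y) Q (j - n) * (1 - a * Q ^ j))
        * (qpoch (b * y) Q (j - n) * (1 - b * Q ^ j)) / (t * t ^ j)"
      unfolding G_def qc by (simp add: j)
    ultimately have "qhahn_A Q t a b j * qhahn_coeff Q t a b j n = (x - y) / (x - 1) * G"
      by (simp add: qhahn_A_def mult_ac)
    then have "qhahn_A Q t a b j * qhahn_C Q t a b i * qhahn_coeff Q t a b j n
        = (x - y) / (x - 1) * G * qhahn_C Q t a b i"
      by (metis mult.assoc mult.commute)
    also have "\<dots> = - (G * (x * t * (1 - a * b * x / (Q * t\<^sup>2)) * (1 - y / x)))"
    proof -
      have "(x - y) / (x - 1) * (1 - x) = - (x * (1 - y / x))"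
        using \<open>x - 1 \<noteq> 0\<close> nz by (simp add: divide_simps) (simp add: algebra_simps)
      then have "(x - y) / (x - 1) * (1 - x) * (G * t * (1 - a * b * x / (Q * t\<^sup>2)))
         = - (x * (1 - y / x)) * (G * t * (1 - a * b * x / (Q * t\<^sup>2)))"
        by simp
      then show ?thesis by (simp add: qhahn_C_def x_def [symmetric] mult_ac)
    qed
    finally show ?thesis by (simp add: j)
  qed
  show ?thesis
    unfolding k0 k1 k2 k3 y2 qhahn_scalar[OF Q(1) t nz ne]
    unfolding qhahn_A_def qhahn_C_def x_def [symmetric] y_def [symmetric]
    by (simp add: algebra_simps)
qed

text \<open>The case n = i + 1 that \<open>qhahn_coeff_rec\<close> leaves out: only the shifted term
  reaches it. Iterated over i, it says that the polynomials are monic in \<zeta> +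
  1/\<zeta>.\<close>

lemma qhahn_coeff_diag:
  fixes Q t a b :: complex
  assumes Q: "Q \<noteq> 0" "\<And>m. m > 0 \<Longrightarrow> Q ^ m \<noteq> 1" and t: "t \<noteq> 0"
  shows "qhahn_coeff Q t a b (Suc i) (Suc i) = - qhahn_coeff Q t a b i i / (t * Q ^ i)"
proof -
  define z where "z = Q * Q ^ i"
  have z: "z \<noteq> 0" "1 - z \<noteq> 0" using Q(1) Q(2)[of "Suc i"] by (auto simp: z_def)
  have w: "Q powi (- int (Suc i)) = 1 / z" "1 / z * Q = Q powi (- int i)"
    using Q(1) unfolding z_def power_int_minus power_int_of_nat by (simp_all add: field_simps)
  have "qpoch (Q powi (- int (Suc i))) Q (Suc i) = (1 - 1 / z) * qpoch (Q powi (- int i)) Q i"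
    unfolding w(1) qpoch_Suc_left w(2) by simp
  moreover have "qpoch Q Q (Suc i) = qpoch Q Q i * (1 - z)" by (simp add: qpoch_Suc z_def)
  moreover have "(1 - 1 / z) / (1 - z) = - 1 / z"
    using z by (simp add: divide_simps)
  then have "(1 - 1 / z) * c / (d * (1 - z)) = - 1 / z * (c / d)" for c d
    by (metis mult.commute times_divide_times_eq)
  ultimately have "qpoch (Q powi (- int (Suc i))) Q (Suc i) / qpoch Q Q (Suc i)
      = - 1 / z * (qpoch (Q powi (- int i)) Q i / qpoch Q Q i)"
    by simp
  then show ?thesis
    using Q(1) unfolding qhahn_coeff_def by (simp add: z_def)
qed

section \<open>Splitting a vector by an annihilating polynomial with simple roots\<close>

definition lin_op :: "(('x \<Rightarrow> complex) \<Rightarrow> 'x \<Rightarrow> complex) \<Rightarrow> bool" where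
  "lin_op B \<longleftrightarrow> (\<forall>f g. B (\<lambda>y. f y + g y) = (\<lambda>y. B f y + B g y))
     \<and> (\<forall>c f. B (\<lambda>y. c * f y) = (\<lambda>y. c * B f y))"

lemma lin_op_add: "lin_op B \<Longrightarrow> B (\<lambda>y. f y + g y) = (\<lambda>y. B f y + B g y)"
  and lin_op_scale: "lin_op B \<Longrightarrow> B (\<lambda>y. c * f y) = (\<lambda>y. c * B f y)"
  unfolding lin_op_def by blast+

lemma lin_op_zero: "lin_op B \<Longrightarrow> B (\<lambda>y. 0) = (\<lambda>y. 0)"
  using lin_op_scale[of B 0 "\<lambda>y. 0"] by simp

lemma lin_op_diff: "lin_op B \<Longrightarrow> B (\<lambda>y. f y - g y) = (\<lambda>y. B f y - B g y)"
  using lin_op_add[of B f "\<lambda>y. - 1 * g y"] lin_op_scale[of B "-1" g] by simp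

lemma lin_op_sum:
  assumes "lin_op B" "finite I"
  shows "B (\<lambda>y. \<Sum>i\<in>I. c i * f i y) = (\<lambda>y. \<Sum>i\<in>I. c i * B (f i) y)"
  using assms(2)
proof induction
  case empty
  then show ?case by (simp add: lin_op_zero[OF assms(1)])
next
  case (insert x F)
  then show ?case
    using lin_op_add[OF assms(1), of "\<lambda>y. c x * f x y" "\<lambda>y. \<Sum>i\<in>F. c i * f i y"]
      lin_op_scale[OF assms(1), of "c x" "f x"]
    by simp
qed

fun shift_prod :: "(('x \<Rightarrow> complex) \<Rightarrow> 'x \<Rightarrow> complex) \<Rightarrow> complex list \<Rightarrow> ('x \<Rightarrow> complex) \<Rightarrow> 'x \<Rightarrow> complex"
  where
  "shift_prod B [] u = u"
| "shift_prod B (z # zs) u = shift_prod B zs (\<lambda>y. B u y - z * u y)"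

lemma shift_prod_snoc:
  "shift_prod B (zs @ [z]) u = (\<lambda>y. B (shift_prod B zs u) y - z * shift_prod B zs u y)"
  by (induction zs arbitrary: u) simp_all

text \<open>Induction on the roots. Suppose (B - x)u is a sum of eigenvectors v_z. As z differs from
  x, v_z / (z - x) is a preimage of v_z under B - x, and what remains of u after subtracting these
  preimages is an x-eigenvector. Components may be zero.\<close>

lemma shift_prod_zero_decomp:
  assumes "lin_op B" "distinct zs" "shift_prod B zs u = (\<lambda>y. 0)"
  shows "\<exists>e. (\<forall>z\<in>set zs. B (e z) = (\<lambda>y. z * e z y)) \<and> u = (\<lambda>y. \<Sum>z\<in>set zs. e z y)"
  using assms(2,3)
proof (induction zs arbitrary: u)
  case Nil
  then show ?case by simp
next
  case (Cons x zs)
  then obtain v where v: "\<And>z. z \<in> set zs \<Longrightarrow> B (v z) = (\<lambda>y. z * v z y)"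
    and bu: "(\<lambda>y. B u y - x * u y) = (\<lambda>y. \<Sum>z\<in>set zs. v z y)"
    by fastforce
  define s where "s = (\<lambda>y. \<Sum>z\<in>set zs. 1 / (z - x) * v z y)"
  define e where "e = (\<lambda>z. if z = x then (\<lambda>y. u y - s y) else (\<lambda>y. 1 / (z - x) * v z y))"
  have ez: "e z = (\<lambda>y. 1 / (z - x) * v z y)" if "z \<in> set zs" for z
    using that Cons.prems by (auto simp: e_def)
  have ex: "e x = (\<lambda>y. u y - s y)" by (simp add: e_def)
  have Be: "B (e z) = (\<lambda>y. z * e z y)" if "z \<in> set zs" for z
    unfolding ez[OF that] lin_op_scale[OF assms(1)] v[OF that] by (simp add: mult_ac)
  have Bs: "B s y = (\<Sum>z\<in>set zs. 1 / (z - x) * (z * v z y))" for y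

    using fun_cong[OF lin_op_sum[OF assms(1), of "set zs" "\<lambda>z. 1 / (z - x)" v], of y]
    by (simp only: s_def finite_set v simp_thms cong: sum.cong)
  have "B s y - x * s y = B u y - x * u y" for y
  proof -
    have "B s y - x * s y = (\<Sum>z\<in>set zs. 1 / (z - x) * (z * v z y) - x * (1 / (z - x) * v z y))"
      by (simp only: Bs) (simp add: s_def sum_distrib_left sum_subtractf)
    also have "\<dots> = (\<Sum>z\<in>set zs. v z y)"
    proof (intro sum.cong refl)
      fix z assume "z \<in> set zs"
      then have "z - x \<noteq> 0" using Cons.prems by auto
      then show "1 / (z - x) * (z * v z y) - x * (1 / (z - x) * v z y) = v z y"
        by (simp add: divide_simps) (simp add: algebra_simps)
    qed
    finally show ?thesis using fun_cong[OF bu, of y] by simp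
  qed
  then have "B (e x) = (\<lambda>y. x * e x y)"
    unfolding ex lin_op_diff[OF assms(1)] by (auto simp: algebra_simps)
  moreover have "u = (\<lambda>y. \<Sum>z\<in>set (x # zs). e z y)"
  proof
    fix y
    have "(\<Sum>z\<in>set zs. e z y) = s y" unfolding s_def by (intro sum.cong) (simp_all add: ez)
    then show "u y = (\<Sum>z\<in>set (x # zs). e z y)" using Cons.prems by (simp add: ex)
  qed
  ultimately show ?case using Be by (intro exI[of _ e]) auto
qed

text \<open>
  The vector \<open>(t\<zeta>;q)\<^sub>n (t\<zeta>\<^sup>-\<^sup>1;q)\<^sub>n u\<close>, with the operator \<open>B\<close> substituted for \<open>\<zeta> + \<zeta>\<^sup>-\<^sup>1\<close>.
\<close>

fun qhahn_split :: "complex \<Rightarrow> complex \<Rightarrow> (('x \<Rightarrow> complex) \<Rightarrow> 'x \<Rightarrow> complex) \<Rightarrow> ('x \<Rightarrow> complex)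
    \<Rightarrow> nat \<Rightarrow> 'x \<Rightarrow> complex" where
  "qhahn_split Q t B u 0 = u"
| "qhahn_split Q t B u (Suc n) =
     (\<lambda>y. (1 + t\<^sup>2 * Q ^ (2 * n)) * qhahn_split Q t B u n y - t * Q ^ n * B (qhahn_split Q t B u n) y)"

text \<open>The value of \<zeta> + 1/\<zeta> at \<zeta> = t q^k, which is where the k-th factor of
  \<open>qhahn_split\<close> vanishes.\<close>

definition qhahn_node :: "complex \<Rightarrow> complex \<Rightarrow> nat \<Rightarrow> complex" where
  "qhahn_node Q t k = t * Q ^ k + 1 / (t * Q ^ k)"

definition qhahn_val :: "complex \<Rightarrow> complex \<Rightarrow> complex \<Rightarrow> complex \<Rightarrow> nat \<Rightarrow> complex \<Rightarrow> complex" where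
  "qhahn_val Q t a b i X =
     (\<Sum>n\<le>i. qhahn_coeff Q t a b i n * (\<Prod>j<n. 1 + t\<^sup>2 * Q ^ (2 * j) - t * Q ^ j * X))"

text \<open>B maps each split vector to a combination of itself and the next one, so the
  coefficients obey \<open>qhahn_coeff_rec\<close>. The index i = M + 1 is included because the
  vanishing of \<open>u (Suc M)\<close> will be read as a relation between split vectors.\<close>

lemma qhahn_split_expansion:
  fixes Q t a b :: complex
  assumes Q: "Q \<noteq> 0" "\<And>m. m > 0 \<Longrightarrow> Q ^ m \<noteq> 1" and t: "t \<noteq> 0" and B: "lin_op B"
    and rec: "\<And>n y. n \<le> M \<Longrightarrow> B (u n) y = u (Suc n) y
        + (t + 1 / t - qhahn_A Q t a b n - qhahn_C Q t a b n) * u n y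
        + (if n = 0 then 0 else qhahn_A Q t a b (n - 1) * qhahn_C Q t a b n * u (n - 1) y)"
    and i: "i \<le> Suc M"
  shows "u i = (\<lambda>y. \<Sum>n\<le>i. qhahn_coeff Q t a b i n * qhahn_split Q t B (u 0) n y)"
  using i
proof (induction i rule: less_induct)
  case (less i)
  show ?case
  proof (cases i)
    case 0
    then show ?thesis by (simp add: qhahn_coeff_def)
  next
    case (Suc m)
    let ?g = "qhahn_split Q t B (u 0)" and ?k = "qhahn_coeff Q t a b"
    let ?al = "t + 1 / t - qhahn_A Q t a b m - qhahn_C Q t a b m"
    let ?be = "qhahn_A Q t a b (m - 1) * qhahn_C Q t a b m"
    have Bg: "B (?g n) y = (1 + t\<^sup>2 * Q ^ (2 * n)) / (t * Q ^ n) * ?g n y - ?g (Suc n) y / (t * Q ^ n)" for n y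
      using Q t by (simp add: divide_simps)
    have um: "u m = (\<lambda>y. \<Sum>n\<le>m. ?k m n * ?g n y)"
      using less.prems Suc by (intro less.IH) simp_all
    have up: "u (m - 1) = (\<lambda>y. \<Sum>n\<le>m. ?k (m - 1) n * ?g n y)" if "m \<noteq> 0"
    proof -
      have "u (m - 1) = (\<lambda>y. \<Sum>n\<le>m - 1. ?k (m - 1) n * ?g n y)"
        using less.prems Suc that by (intro less.IH) simp_all
      moreover have "(\<Sum>n\<le>m - 1. ?k (m - 1) n * ?g n y) = (\<Sum>n\<le>m. ?k (m - 1) n * ?g n y)" for y
        by (rule sum.mono_neutral_left) (auto simp: qhahn_coeff_def)
      ultimately show ?thesis by simp
    qed
    have Bu: "B (u m) y = (\<Sum>n\<le>m. ?k m n * B (?g n) y)" for y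
      by (subst um, subst lin_op_sum[OF B]) simp_all
    show ?thesis
    proof
      fix y
      \<comment> \<open>Collects the parts - g_{n+1} / (t q^n) of B g_n, reindexed; nothing is
        shifted into the place n = 0.\<close>
      define h where "h = (\<lambda>n. if n = 0 then 0 else ?k m (n - 1) / (t * Q ^ (n - 1)))"
      have sh: "(\<Sum>n\<le>m. ?k m n * (?g (Suc n) y / (t * Q ^ n))) = (\<Sum>n\<le>Suc m. h n * ?g n y)"
        by (subst sum.atMost_Suc_shift) (simp add: h_def mult_ac)
      have "u i y = B (u m) y - ?al * u m y - (if m = 0 then 0 else ?be * u (m - 1) y)"
        using rec[of m y] less.prems Suc by simp
      also have "\<dots> = (\<Sum>n\<le>m. ?k m n * ((1 + t\<^sup>2 * Q ^ (2 * n)) / (t * Q ^ n) * ?g n y))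
          - (\<Sum>n\<le>Suc m. h n * ?g n y) - (\<Sum>n\<le>m. ?al * (?k m n * ?g n y))
          - (\<Sum>n\<le>m. (if m = 0 then 0 else ?be * ?k (m - 1) n) * ?g n y)"
      proof -
        have "B (u m) y = (\<Sum>n\<le>m. ?k m n * ((1 + t\<^sup>2 * Q ^ (2 * n)) / (t * Q ^ n) * ?g n y))
          - (\<Sum>n\<le>Suc m. h n * ?g n y)"
          unfolding Bu Bg right_diff_distrib sum_subtractf sh ..
        moreover have "?al * u m y = (\<Sum>n\<le>m. ?al * (?k m n * ?g n y))"
          by (subst um) (simp only: sum_distrib_left)
        moreover have "(if m = 0 then 0 else ?be * u (m - 1) y)
            = (\<Sum>n\<le>m. (if m = 0 then 0 else ?be * ?k (m - 1) n) * ?g n y)"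
        proof (cases "m = 0")
          case False
          then show ?thesis using up by (simp add: sum_distrib_left mult.assoc)
        qed simp
        ultimately show ?thesis by simp
      qed
      also have "\<dots> = (\<Sum>n\<le>m. ?k m n * ((1 + t\<^sup>2 * Q ^ (2 * n)) / (t * Q ^ n) * ?g n y) - h n * ?g n y
          - ?al * (?k m n * ?g n y) - (if m = 0 then 0 else ?be * ?k (m - 1) n) * ?g n y)
          - h (Suc m) * ?g (Suc m) y"
        unfolding sum_subtractf sum.atMost_Suc by (simp only: diff_diff_eq add_ac)
      also have "\<dots> = (\<Sum>n\<le>m. ((1 + t\<^sup>2 * Q ^ (2 * n)) / (t * Q ^ n) * ?k m n - h n - ?al * ?k m n
          - (if m = 0 then 0 else ?be * ?k (m - 1) n)) * ?g n y) - h (Suc m) * ?g (Suc m) y"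
        by (intro arg_cong2[where f = minus] sum.cong refl) (simp add: algebra_simps)
      also have "\<dots> = (\<Sum>n\<le>m. ?k (Suc m) n * ?g n y) + ?k (Suc m) (Suc m) * ?g (Suc m) y"
      proof -
        have "(\<Sum>n\<le>m. ((1 + t\<^sup>2 * Q ^ (2 * n)) / (t * Q ^ n) * ?k m n - h n - ?al * ?k m n
          - (if m = 0 then 0 else ?be * ?k (m - 1) n)) * ?g n y) = (\<Sum>n\<le>m. ?k (Suc m) n * ?g n y)"
          unfolding h_def by (intro sum.cong refl arg_cong2[where f = times] qhahn_coeff_rec[OF Q t, symmetric]) simp_all
        moreover have "- h (Suc m) = ?k (Suc m) (Suc m)"
          using qhahn_coeff_diag[OF Q t] by (simp add: h_def)
        ultimately show ?thesis by (simp only: diff_conv_add_uminus minus_mult_left)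
      qed
      finally show "u i y = (\<Sum>n\<le>i. ?k i n * ?g n y)" by (simp add: Suc)
    qed
  qed
qed

text \<open>By b q^M = 1, every coefficient of \<open>u (Suc M)\<close> except the last vanishes, so
  \<open>u (Suc M) = 0\<close> forces the split vector with index M + 1 to be zero. Up to a nonzero
  scalar this vector is the product of the B - X_k with k \<le> M, applied to \<open>u 0\<close>,
  and the nodes X_k are distinct.\<close>

proposition qhahn_spectral_expansion:
  fixes Q t a b :: complex
  assumes Q: "Q \<noteq> 0" "\<And>m. m > 0 \<Longrightarrow> Q ^ m \<noteq> 1" and t: "t \<noteq> 0" and B: "lin_op B"
    and rec: "\<And>n y. n \<le> M \<Longrightarrow> B (u n) y = u (Suc n) y
        + (t + 1 / t - qhahn_A Q t a b n - qhahn_C Q t a b n) * u n y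
        + (if n = 0 then 0 else qhahn_A Q t a b (n - 1) * qhahn_C Q t a b n * u (n - 1) y)"
    and top: "u (Suc M) = (\<lambda>y. 0)" and b: "b * Q ^ M = 1"
    and inj: "inj_on (qhahn_node Q t) {..M}"
  obtains e where "\<And>k. k \<le> M \<Longrightarrow> B (e k) = (\<lambda>y. qhahn_node Q t k * e k y)"
    and "\<And>i y. i \<le> M \<Longrightarrow> u i y = (\<Sum>k\<le>M. qhahn_val Q t a b i (qhahn_node Q t k) * e k y)"
proof -
  let ?g = "qhahn_split Q t B (u 0)" and ?X = "qhahn_node Q t" and ?k = "qhahn_coeff Q t a b"
  have factor: "1 + t\<^sup>2 * Q ^ (2 * n) - t * Q ^ n * z = - (t * Q ^ n) * (z - ?X n)" for n z
    using Q t by (simp add: qhahn_node_def field_simps power2_eq_square power_mult)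
  have g_shift: "?g n = (\<lambda>y. (\<Prod>j<n. - (t * Q ^ j)) * shift_prod B (map ?X [0..<n]) (u 0) y)" for n
  proof (induction n)
    case (Suc n)
    let ?c = "\<Prod>j<n. - (t * Q ^ j)" and ?s = "shift_prod B (map ?X [0..<n]) (u 0)"
    have "(1 + t\<^sup>2 * Q ^ (2 * n)) * (?c * ?s y) - t * Q ^ n * (?c * B ?s y)
        = ?c * (- (t * Q ^ n)) * (B ?s y - ?X n * ?s y)" for y
      using factor[of n 0] by (simp add: algebra_simps)
    then show ?case
      by (simp add: Suc lin_op_scale[OF B] shift_prod_snoc)
  qed simp
  have "?g (Suc M) = (\<lambda>y. 0)"
  proof -
    \<comment> \<open>The factor with index M - n of (b q^n; q)_{M+1-n} is 1 - b q^M.\<close>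
    have z: "?k (Suc M) n = 0" if "n \<le> M" for n
    proof -
      have "qpoch (b * Q ^ n) Q (Suc M - n) = 0"
        unfolding qpoch_eq_0_iff
        using that b by (intro exI[of _ "M - n"]) (auto simp: mult.assoc simp flip: power_add)
      then show ?thesis by (simp add: qhahn_coeff_def)
    qed
    have "qpoch (Q powi (- int m)) Q m \<noteq> 0" for m
    proof -
      have "Q powi (- int m) * Q ^ j \<noteq> 1" if "j < m" for j
      proof
        assume "Q powi (- int m) * Q ^ j = 1"
        then have "Q ^ j = Q ^ m"
          using Q unfolding power_int_minus power_int_of_nat by (simp add: field_simps)
        moreover have "Q ^ m = Q ^ j * Q ^ (m - j)" using that by (simp flip: power_add)
        ultimately have "Q ^ (m - j) = 1" using Q by simp
        then show False using Q(2)[of "m - j"] that by simp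
      qed
      then show ?thesis by (auto simp: qpoch_eq_0_iff)
    qed
    moreover have "qpoch Q Q m \<noteq> 0" for m using Q(2)[of "Suc _"] by (auto simp: qpoch_eq_0_iff)
    ultimately have "?k (Suc M) (Suc M) \<noteq> 0" using Q t by (simp add: qhahn_coeff_def del: of_nat_Suc)
    moreover have "?k (Suc M) (Suc M) * ?g (Suc M) y = 0" for y
      using fun_cong[OF qhahn_split_expansion[OF Q t B rec, of M "Suc M"], where x = y] z by (simp add: top)
    ultimately show ?thesis by (metis mult_eq_0_iff)
  qed
  then have "shift_prod B (map ?X [0..<Suc M]) (u 0) = (\<lambda>y. 0)"
    using Q t unfolding g_shift by (simp add: fun_eq_iff)
  moreover have "set [0..<Suc M] = {..M}" by auto
  moreover have "distinct (map ?X [0..<Suc M])"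
    unfolding distinct_map \<open>set [0..<Suc M] = {..M}\<close> using inj by simp
  ultimately obtain f where f: "\<And>k. k \<le> M \<Longrightarrow> B (f (?X k)) = (\<lambda>y. ?X k * f (?X k) y)"
    and u0: "u 0 = (\<lambda>y. \<Sum>z\<in>?X ` {..M}. f z y)"
    using shift_prod_zero_decomp[OF B, of "map ?X [0..<Suc M]" "u 0"] unfolding set_map by auto
  have g: "?g n = (\<lambda>y. \<Sum>k\<le>M. (\<Prod>j<n. 1 + t\<^sup>2 * Q ^ (2 * j) - t * Q ^ j * ?X k) * f (?X k) y)" for n
  proof (induction n)
    case 0
    then show ?case by (simp add: u0 sum.reindex[OF inj])
  next
    case (Suc n)
    show ?case
      by (simp add: Suc lin_op_sum[OF B] f sum_distrib_left)
        (simp add: algebra_simps flip: sum_subtractf sum.distrib)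
  qed
  have "u i y = (\<Sum>k\<le>M. qhahn_val Q t a b i (?X k) * f (?X k) y)" if "i \<le> M" for i y
  proof -
    have "u i y = (\<Sum>n\<le>i. \<Sum>k\<le>M. ?k i n * ((\<Prod>j<n. 1 + t\<^sup>2 * Q ^ (2 * j) - t * Q ^ j * ?X k) * f (?X k) y))"
      using fun_cong[OF qhahn_split_expansion[OF Q t B rec, of M i], where x = y] that
      by (simp add: g sum_distrib_left)
    also have "\<dots> = (\<Sum>k\<le>M. qhahn_val Q t a b i (?X k) * f (?X k) y)"
      by (subst sum.swap) (simp add: qhahn_val_def sum_distrib_right mult.assoc)
    finally show ?thesis .
  qed
  then show ?thesis using that[of "\<lambda>k. f (?X k)"] f by blast
qed

section \<open>Laurent polynomials\<close>

lemma poly_mapping_eq_sum_single: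
  fixes f :: "'a \<Rightarrow>\<^sub>0 'b::comm_monoid_add"
  shows "f = (\<Sum>k\<in>Poly_Mapping.keys f. Poly_Mapping.single k (Poly_Mapping.lookup f k))"
proof (rule poly_mapping_eqI)
  fix k
  show "Poly_Mapping.lookup f k = Poly_Mapping.lookup
      (\<Sum>k\<in>Poly_Mapping.keys f. Poly_Mapping.single k (Poly_Mapping.lookup f k)) k"
    by (simp add: lookup_sum lookup_single when_def in_keys_iff)
qed

lemma leval_superset:
  assumes "finite S" "Poly_Mapping.keys f \<subseteq> S"
  shows "leval f z = (\<Sum>k\<in>S. Poly_Mapping.lookup f k * z powi k)"
  unfolding leval_def using assms by (intro sum.mono_neutral_left) (auto simp: in_keys_iff)

lemma leval_add: "leval (f + g) z = leval f z + leval g z"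
proof -
  let ?S = "Poly_Mapping.keys f \<union> Poly_Mapping.keys g"
  have "leval h z = (\<Sum>k\<in>?S. Poly_Mapping.lookup h k * z powi k)" if "h \<in> {f, g, f + g}" for h
    using that Poly_Mapping.keys_add[of f g] by (intro leval_superset) auto
  then show ?thesis by (simp add: lookup_add sum.distrib distrib_right)
qed

lemma leval_single: "leval (Poly_Mapping.single k c) z = c * z powi k"
  by (simp add: leval_superset[of "{k}"])

lemma leval_zero [simp]: "leval 0 z = 0"
  by (simp add: leval_def)

lemma leval_lconst [simp]: "leval (lconst c) z = c"
  and leval_zet [simp]: "leval (zet k) z = z powi k"
  and leval_one [simp]: "leval 1 z = 1"
  using leval_single[of 0 1 z] by (simp_all add: lconst_def zet_def leval_single)

lemma leval_sum: "leval (\<Sum>i\<in>I. f i) z = (\<Sum>i\<in>I. leval (f i) z)"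
  by (induction I rule: infinite_finite_induct) (simp_all add: leval_add)

lemma leval_uminus: "leval (- f) z = - leval f z"
  by (simp add: leval_def sum_negf)

lemma leval_diff: "leval (f - g) z = leval f z - leval g z"
  using leval_add[of f "- g" z] by (simp add: leval_uminus)

lemma leval_mult:
  assumes "z \<noteq> 0"
  shows "leval (f * g) z = leval f z * leval g z"
proof -
  have "f * g = (\<Sum>k\<in>Poly_Mapping.keys f. \<Sum>l\<in>Poly_Mapping.keys g. Poly_Mapping.single (k + l)
      (Poly_Mapping.lookup f k * Poly_Mapping.lookup g l))"
    by (subst poly_mapping_eq_sum_single[of f], subst poly_mapping_eq_sum_single[of g])
      (simp add: sum_product mult_single)
  then show ?thesis
    using assms
    by (simp add: leval_sum leval_single) (simp add: leval_def sum_product power_int_add mult_ac)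
qed

lemma leval_prod:
  "z \<noteq> 0 \<Longrightarrow> leval (\<Prod>i\<in>I. f i) z = (\<Prod>i\<in>I. leval (f i) z)"
  by (induction I rule: infinite_finite_induct) (simp_all add: leval_mult)

lemma leval_lscale: "z \<noteq> 0 \<Longrightarrow> leval (lscale c f) z = c * leval f z"
  by (simp add: lscale_def leval_mult)

lemma lconst_mult: "lconst (c * d) = lconst c * lconst d"
  and lconst_add: "lconst (c + d) = lconst c + lconst d"
  and lconst_power: "lconst (c ^ n) = lconst c ^ n"
  and lconst_1: "lconst 1 = 1"
  and lconst_0: "lconst 0 = 0"
proof -
  show m: "lconst (c * d) = lconst c * lconst d" for c d by (simp add: lconst_def mult_single)
  show "lconst (c + d) = lconst c + lconst d" by (simp add: lconst_def single_add)
  show o: "lconst 1 = 1" by (simp add: lconst_def)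
  show "lconst 0 = 0" by (simp add: lconst_def)
  show "lconst (c ^ n) = lconst c ^ n" by (induction n) (simp_all add: m o)
qed

interpretation laurent: vector_space lscale
proof
  show "lscale a (x + y) = lscale a x + lscale a y" for a x y by (simp add: lscale_def distrib_left)
  show "lscale (a + b) x = lscale a x + lscale b x" for a b x
    by (simp add: lscale_def lconst_add distrib_right)
  show "lscale a (lscale b x) = lscale (a * b) x" for a b x
    by (simp add: lscale_def lconst_mult mult.assoc)
  show "lscale 1 x = x" for x by (simp add: lscale_def lconst_1)
qed

text \<open>Turns membership into a condition on the support, which degree estimates can
  verify.\<close>

lemma Lspace_iff: "f \<in> Lspace D \<longleftrightarrow> Poly_Mapping.keys f \<subseteq> {- int D..int D - 1}"
proof
  assume "f \<in> Lspace D"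
  then obtain c where f: "f = (\<Sum>k = - int D..int D - 1. lscale (c k) (zet k))"
    by (auto simp: Lspace_def)
  show "Poly_Mapping.keys f \<subseteq> {- int D..int D - 1}"
  proof
    fix k assume "k \<in> Poly_Mapping.keys f"
    then show "k \<in> {- int D..int D - 1}"
      unfolding in_keys_iff f
      by (auto simp: lookup_sum lscale_def lconst_def zet_def mult_single lookup_single when_def
          split: if_splits)
  qed
next
  assume k: "Poly_Mapping.keys f \<subseteq> {- int D..int D - 1}"
  have "f = (\<Sum>k\<in>Poly_Mapping.keys f. Poly_Mapping.single k (Poly_Mapping.lookup f k))"
    by (rule poly_mapping_eq_sum_single)
  also have "\<dots> = (\<Sum>k = - int D..int D - 1. lscale (Poly_Mapping.lookup f k) (zet k))"
    using k by (intro sum.mono_neutral_cong_left)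
      (auto simp: in_keys_iff lscale_def lconst_def zet_def mult_single)
  finally show "f \<in> Lspace D" unfolding Lspace_def by blast
qed

section \<open>Degree bounds and leading coefficients of Laurent polynomials\<close>

definition lbounded :: "nat \<Rightarrow> nat \<Rightarrow> laurent \<Rightarrow> bool" where
  "lbounded m n f \<longleftrightarrow> Poly_Mapping.keys f \<subseteq> {- int m..int n}"

text \<open>The coefficient c = 0 is allowed, so the cancellation of two leading terms is again a
  statement of this form.\<close>

definition ltop :: "int \<Rightarrow> complex \<Rightarrow> laurent \<Rightarrow> bool" where
  "ltop n c f \<longleftrightarrow> Poly_Mapping.keys (f - Poly_Mapping.single n c) \<subseteq> {..<n}"

lemma keys_diff_subset: "Poly_Mapping.keys (f - g) \<subseteq> Poly_Mapping.keys f \<union> Poly_Mapping.keys (g :: laurent)"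
  by (auto simp: in_keys_iff lookup_minus)

lemma lbounded_mono: "lbounded m n f \<Longrightarrow> m \<le> m' \<Longrightarrow> n \<le> n' \<Longrightarrow> lbounded m' n' f"
  unfolding lbounded_def by (erule order_trans) auto

lemma lbounded_add: "lbounded m n f \<Longrightarrow> lbounded m n g \<Longrightarrow> lbounded m n (f + g)"
  unfolding lbounded_def using Poly_Mapping.keys_add[of f g] by (meson Un_least order_trans)

lemma lbounded_diff: "lbounded m n f \<Longrightarrow> lbounded m n g \<Longrightarrow> lbounded m n (f - g)"
  unfolding lbounded_def using keys_diff_subset[of f g] by (meson Un_least order_trans)

lemma lbounded_mult:
  assumes "lbounded m n f" "lbounded m' n' g"
  shows "lbounded (m + m') (n + n') (f * g)"
  unfolding lbounded_def
proof
  fix k assume "k \<in> Poly_Mapping.keys (f * g)"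
  then obtain a b where "k = a + b" "a \<in> Poly_Mapping.keys f" "b \<in> Poly_Mapping.keys g"
    using keys_mult[of f g] by blast
  then show "k \<in> {- int (m + m')..int (n + n')}"
    using assms unfolding lbounded_def by fastforce
qed

lemma lbounded_lconst [simp]: "lbounded m n (lconst c)"
  and lbounded_one [simp]: "lbounded m n 1"
  and lbounded_zero [simp]: "lbounded m n 0"
  and lbounded_zet: "- int m \<le> k \<Longrightarrow> k \<le> int n \<Longrightarrow> lbounded m n (zet k)"
  by (simp_all add: lbounded_def lconst_def zet_def)

lemma lbounded_lconst_mult: "lbounded m n f \<Longrightarrow> lbounded m n (lconst c * f)"
  using lbounded_mult[of 0 0 "lconst c" m n f] by simp

lemma lbounded_sum: "(\<And>i. i \<in> I \<Longrightarrow> lbounded m n (f i)) \<Longrightarrow> lbounded m n (\<Sum>i\<in>I. f i)"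
  by (induction I rule: infinite_finite_induct) (simp_all add: lbounded_add)

lemma lbounded_prod:
  "finite I \<Longrightarrow> (\<And>i. i \<in> I \<Longrightarrow> lbounded m n (f i)) \<Longrightarrow> lbounded (card I * m) (card I * n) (\<Prod>i\<in>I. f i)"
  by (induction I rule: finite_induct) (simp_all add: lbounded_mult)

lemma ltop_mult:
  assumes "ltop m c f" "ltop n d g"
  shows "ltop (m + n) (c * d) (f * g)"
proof -
  define f' g' where "f' = f - Poly_Mapping.single m c" and "g' = g - Poly_Mapping.single n d"
  have k: "Poly_Mapping.keys f' \<subseteq> {..<m}" "Poly_Mapping.keys g' \<subseteq> {..<n}"
    using assms by (auto simp: ltop_def f'_def g'_def)
  have "f * g - Poly_Mapping.single (m + n) (c * d)
      = f' * g' + f' * Poly_Mapping.single n d + Poly_Mapping.single m c * g'"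
    by (simp add: f'_def g'_def algebra_simps mult_single)
  moreover have "Poly_Mapping.keys (f' * g') \<subseteq> {..<m + n}"
    using keys_mult[of f' g'] k by fastforce
  moreover have "Poly_Mapping.keys (f' * Poly_Mapping.single n d) \<subseteq> {..<m + n}"
    using keys_mult[of f' "Poly_Mapping.single n d"] k by (force split: if_splits)
  moreover have "Poly_Mapping.keys (Poly_Mapping.single m c * g') \<subseteq> {..<m + n}"
    using keys_mult[of "Poly_Mapping.single m c" g'] k by (force split: if_splits)
  moreover have "Poly_Mapping.keys (u + v + w) \<subseteq> Poly_Mapping.keys u \<union> Poly_Mapping.keys v \<union> Poly_Mapping.keys w"
    for u v w :: laurent
    using Poly_Mapping.keys_add[of "u + v" w] Poly_Mapping.keys_add[of u v] by blast
  ultimately show ?thesis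
    unfolding ltop_def by (simp only:) (meson Un_least order_trans)
qed

lemma ltop_one: "ltop 0 1 1"
  by (simp add: ltop_def)

lemma ltop_lconst: "ltop 0 c (lconst c)"
  by (simp add: ltop_def lconst_def)

lemma ltop_zet: "ltop k 1 (zet k)"
  by (simp add: ltop_def zet_def)

lemma ltop_lower: "Poly_Mapping.keys f \<subseteq> {..<n} \<Longrightarrow> ltop n 0 f"
  by (simp add: ltop_def)

lemma ltop_add: "ltop n c f \<Longrightarrow> ltop n d g \<Longrightarrow> ltop n (c + d) (f + g)"
proof -
  assume "ltop n c f" "ltop n d g"
  moreover have "f + g - Poly_Mapping.single n (c + d)
      = (f - Poly_Mapping.single n c) + (g - Poly_Mapping.single n d)"
    by (simp add: single_add)
  moreover have "Poly_Mapping.keys (u + v) \<subseteq> Poly_Mapping.keys u \<union> Poly_Mapping.keys v"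
    for u v :: laurent by (rule Poly_Mapping.keys_add)
  ultimately show "ltop n (c + d) (f + g)"
    unfolding ltop_def by (simp only:) (meson Un_least order_trans)
qed

lemma ltop_uminus: "ltop n c f \<Longrightarrow> ltop n (- c) (- f)"
proof -
  have "- f - Poly_Mapping.single n (- c) = - (f - Poly_Mapping.single n c)"
    by (simp add: single_uminus)
  moreover have "Poly_Mapping.keys (- g) = Poly_Mapping.keys g" for g :: laurent
    by (auto simp: in_keys_iff)
  ultimately have "Poly_Mapping.keys (- f - Poly_Mapping.single n (- c))
      = Poly_Mapping.keys (f - Poly_Mapping.single n c)" by metis
  then show "ltop n c f \<Longrightarrow> ltop n (- c) (- f)" unfolding ltop_def by simp
qed

lemma ltop_diff: "ltop n c f \<Longrightarrow> ltop n d g \<Longrightarrow> ltop n (c - d) (f - g)"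
  using ltop_add[of n c f "- d" "- g"] ltop_uminus[of n d g] by simp

lemma ltop_sum:
  "(\<And>i. i \<in> I \<Longrightarrow> ltop n (c i) (f i)) \<Longrightarrow> ltop n (\<Sum>i\<in>I. c i) (\<Sum>i\<in>I. f i)"
  by (induction I rule: infinite_finite_induct) (simp_all add: ltop_add ltop_lower)

lemma ltop_prod:
  "finite I \<Longrightarrow> (\<And>i. i \<in> I \<Longrightarrow> ltop (n i) (c i) (f i)) \<Longrightarrow> ltop (\<Sum>i\<in>I. n i) (\<Prod>i\<in>I. c i) (\<Prod>i\<in>I. f i)"
  by (induction I rule: finite_induct) (simp_all add: ltop_mult ltop_one)

lemma lbounded_reduce:
  assumes "lbounded m (Suc n) f" "ltop (int (Suc n)) 0 f"
  shows "lbounded m n f"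
  using assms unfolding lbounded_def ltop_def by fastforce

definition qfactor :: "complex \<Rightarrow> complex \<Rightarrow> nat \<Rightarrow> laurent" where
  "qfactor Q t n = qpoch (lconst t * zet (- 1)) (lconst Q) n * qpoch (lconst t * zet 1) (lconst Q) n"

lemma lbounded_qfactor: "lbounded n n (qfactor Q t n)"
proof -
  have "lbounded (card {..<n} * 1) (card {..<n} * 0) (qpoch (lconst t * zet (- 1)) (lconst Q) n)"
    unfolding qpoch_def lconst_power [symmetric]
    by (intro lbounded_prod lbounded_diff)
      (simp_all add: mult.commute[of _ "lconst _"] lbounded_lconst_mult lbounded_zet)
  moreover have "lbounded (card {..<n} * 0) (card {..<n} * 1) (qpoch (lconst t * zet 1) (lconst Q) n)"
    unfolding qpoch_def lconst_power [symmetric]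
    by (intro lbounded_prod lbounded_diff)
      (simp_all add: mult.commute[of _ "lconst _"] lbounded_lconst_mult lbounded_zet)
  ultimately show ?thesis
    using lbounded_mult unfolding qfactor_def by fastforce
qed

lemma ltop_qfactor: "ltop (int n) (\<Prod>j<n. - (t * Q ^ j)) (qfactor Q t n)"
proof -
  have "ltop 0 (1 - 0) (1 - lconst t * zet (- 1) * lconst Q ^ j)" for j
  proof (intro ltop_diff ltop_one ltop_lower)
    show "Poly_Mapping.keys (lconst t * zet (- 1) * lconst Q ^ j) \<subseteq> {..<0}"
      by (simp add: lconst_def zet_def mult_single flip: lconst_power[unfolded lconst_def])
  qed
  then have 1: "ltop (\<Sum>j<n. 0) (\<Prod>j<n. 1 - 0) (qpoch (lconst t * zet (- 1)) (lconst Q) n)"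
    unfolding qpoch_def by (intro ltop_prod) auto
  have "ltop 1 (0 - t * Q ^ j) (1 - lconst t * zet 1 * lconst Q ^ j)" for j
  proof (intro ltop_diff ltop_lower)
    show "ltop 1 (t * Q ^ j) (lconst t * zet 1 * lconst Q ^ j)"
      by (simp add: ltop_def lconst_def zet_def mult_single flip: lconst_power[unfolded lconst_def])
  qed simp
  then have 2: "ltop (\<Sum>j<n. 1) (\<Prod>j<n. 0 - t * Q ^ j) (qpoch (lconst t * zet 1) (lconst Q) n)"
    unfolding qpoch_def by (intro ltop_prod) auto
  show ?thesis using ltop_mult[OF 1 2] by (simp add: qfactor_def)
qed

text \<open>Factors of equal index in the two symbols multiply to a polynomial in z + 1/z, namely
  the factor of \<open>qhahn_split\<close> with B replaced by z + 1/z.\<close>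

lemma leval_qfactor:
  assumes "z \<noteq> 0"
  shows "leval (qfactor Q t n) z = (\<Prod>j<n. 1 + t\<^sup>2 * Q ^ (2 * j) - t * Q ^ j * (z + 1 / z))"
proof -
  have "(1 - t * inverse z * Q ^ j) * (1 - t * z * Q ^ j)
      = 1 + t\<^sup>2 * Q ^ (2 * j) - t * Q ^ j * (z + 1 / z)" for j
    using assms by (simp add: field_simps power2_eq_square power_mult)
  then show ?thesis
    using assms
    by (simp add: qfactor_def qpoch_def leval_mult leval_prod leval_diff lconst_power [symmetric]
        power_int_minus prod.distrib [symmetric])
qed

text \<open>For n \<le> i the quotient (a;q)_i / (a;q)_n is (a q^n; q)_{i-n}. The lower parameters
  are restricted for j < i only, which still admits i = M when b = q^{-M}; the case h_D depends on
  this.\<close>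

lemma phi32_eq_qhahn_sum:
  assumes Q: "Q \<noteq> 0" "\<And>m. m > 0 \<Longrightarrow> Q ^ m \<noteq> 1"
    and a: "\<And>j. j < i \<Longrightarrow> a * Q ^ j \<noteq> 1" and b: "\<And>j. j < i \<Longrightarrow> b * Q ^ j \<noteq> 1"
  shows "lconst (qpoch a Q i * qpoch b Q i / t ^ i)
      * phi32 (Q powi (- int i)) (lconst t * zet (- 1)) (lconst t * zet 1) a b Q Q
    = (\<Sum>n\<le>i. lconst (qhahn_coeff Q t a b i n) * qfactor Q t n)"
proof -
  have z: "qpoch (Q powi (- int i)) Q n = 0" if "n > i" for n
    unfolding qpoch_eq_0_iff using that Q
    by (intro exI[of _ i]) (simp add: power_int_minus)
  have c: "qpoch a Q i * qpoch b Q i / t ^ i * (qpoch (Q powi (- int i)) Q n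
      / (qpoch a Q n * qpoch b Q n) * (Q ^ n / qpoch Q Q n)) = qhahn_coeff Q t a b i n" if "n \<le> i" for n
  proof -
    have "qpoch a Q i = qpoch a Q n * qpoch (a * Q ^ n) Q (i - n)"
      "qpoch b Q i = qpoch b Q n * qpoch (b * Q ^ n) Q (i - n)"
      using that by (simp_all flip: qpoch_add)
    moreover have "qpoch a Q n \<noteq> 0" "qpoch b Q n \<noteq> 0"
      using a b that by (auto simp: qpoch_eq_0_iff)
    ultimately show ?thesis using that by (simp add: qhahn_coeff_def mult_ac)
  qed
  have "phi32 (Q powi (- int i)) (lconst t * zet (- 1)) (lconst t * zet 1) a b Q Q
    = (\<Sum>n\<le>i. lconst (qpoch (Q powi (- int i)) Q n
      / (qpoch a Q n * qpoch b Q n) * (Q ^ n / qpoch Q Q n)) * qfactor Q t n)"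
    unfolding phi32_def qfactor_def mult.assoc
  proof (rule Sum_any.expand_superset)
    show "{n. lconst (qpoch (Q powi (- int i)) Q n / (qpoch a Q n * qpoch b Q n)
        * (Q ^ n / qpoch Q Q n)) * (qpoch (lconst t * zet (- 1)) (lconst Q) n
        * qpoch (lconst t * zet 1) (lconst Q) n) \<noteq> 0} \<subseteq> {..i}"
    proof
      fix n assume n: "n \<in> {n. lconst (qpoch (Q powi (- int i)) Q n / (qpoch a Q n * qpoch b Q n)
        * (Q ^ n / qpoch Q Q n)) * (qpoch (lconst t * zet (- 1)) (lconst Q) n
        * qpoch (lconst t * zet 1) (lconst Q) n) \<noteq> 0}"
      show "n \<in> {..i}"
      proof (rule ccontr)
        assume "n \<notin> {..i}"
        then have "qpoch (Q powi (- int i)) Q n = 0" using z by simp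
        then show False using n by (simp add: lconst_0)
      qed
    qed
  qed simp
  then have "lconst (qpoch a Q i * qpoch b Q i / t ^ i)
      * phi32 (Q powi (- int i)) (lconst t * zet (- 1)) (lconst t * zet 1) a b Q Q
    = (\<Sum>n\<le>i. lconst (qpoch a Q i * qpoch b Q i / t ^ i) * (lconst (qpoch (Q powi (- int i)) Q n
        / (qpoch a Q n * qpoch b Q n) * (Q ^ n / qpoch Q Q n)) * qfactor Q t n))"
    by (simp only: sum_distrib_left)
  also have "\<dots> = (\<Sum>n\<le>i. lconst (qhahn_coeff Q t a b i n) * qfactor Q t n)"
  proof (intro sum.cong)
    fix n assume "n \<in> {..i}"
    then show "lconst (qpoch a Q i * qpoch b Q i / t ^ i) * (lconst (qpoch (Q powi (- int i)) Q n
        / (qpoch a Q n * qpoch b Q n) * (Q ^ n / qpoch Q Q n)) * qfactor Q t n)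
      = lconst (qhahn_coeff Q t a b i n) * qfactor Q t n"
      unfolding mult.assoc [of "lconst _" "lconst _", symmetric] lconst_mult [symmetric]
      by (subst c) simp_all
  qed simp
  finally show ?thesis .
qed

lemma leval_qhahn_sum:
  "z \<noteq> 0 \<Longrightarrow> leval (\<Sum>n\<le>i. lconst (qhahn_coeff Q t a b i n) * qfactor Q t n) z
     = qhahn_val Q t a b i (z + 1 / z)"
  by (simp add: leval_sum leval_mult leval_qfactor qhahn_val_def)

lemma lbounded_qhahn_sum: "lbounded i i (\<Sum>n\<le>i. lconst (qhahn_coeff Q t a b i n) * qfactor Q t n)"
  by (intro lbounded_sum lbounded_lconst_mult lbounded_mono[OF lbounded_qfactor]) auto

text \<open>Only the summand n = i reaches \<zeta>^i, and \<open>qhahn_coeff_diag\<close> makes its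
  leading coefficient 1.\<close>

lemma ltop_qhahn_sum:
  assumes Q: "Q \<noteq> 0" "\<And>m. m > 0 \<Longrightarrow> Q ^ m \<noteq> 1" and t: "t \<noteq> 0"
  shows "ltop (int i) 1 (\<Sum>n\<le>i. lconst (qhahn_coeff Q t a b i n) * qfactor Q t n)"
proof -
  have k: "qhahn_coeff Q t a b i i * (\<Prod>j<i. - (t * Q ^ j)) = 1" for i
  proof (induction i)
    case 0
    then show ?case by (simp add: qhahn_coeff_def)
  next
    case (Suc i)
    then show ?case using Q t by (simp add: qhahn_coeff_diag[OF Q t])
  qed
  have "ltop (int i) (\<Sum>n\<le>i. if n = i then 1 else 0)
      (\<Sum>n\<le>i. lconst (qhahn_coeff Q t a b i n) * qfactor Q t n)"
  proof (intro ltop_sum)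
    fix n assume n: "n \<in> {..i}"
    show "ltop (int i) (if n = i then 1 else 0) (lconst (qhahn_coeff Q t a b i n) * qfactor Q t n)"
    proof (cases "n = i")
      case True
      then show ?thesis
        using ltop_mult[OF ltop_lconst[of "qhahn_coeff Q t a b i i"] ltop_qfactor[of i t Q]] k by simp
    next
      case False
      have "lbounded n n (lconst (qhahn_coeff Q t a b i n) * qfactor Q t n)"
        by (intro lbounded_lconst_mult lbounded_qfactor)
      then show ?thesis using n False by (auto simp: lbounded_def intro!: ltop_lower)
    qed
  qed
  then show ?thesis by simp
qed

section \<open>Counting subspaces over a finite field\<close>

lemma qnum_0 [simp]: "qnum q 0 = 0" and qnum_1 [simp]: "q > 1 \<Longrightarrow> qnum q (Suc 0) = 1"
  by (simp_all add: qnum_def)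

lemma qnum_eq_0_iff: "q > 1 \<Longrightarrow> qnum q n = 0 \<longleftrightarrow> n = 0"
  using power_eq_1_iff[of "real q" n] by (auto simp: qnum_def)

lemma qnum_add: "q > 1 \<Longrightarrow> qnum q (m + n) = qnum q m + real q ^ m * qnum q n"
  by (simp add: qnum_def power_add add_divide_distrib [symmetric]) (simp add: algebra_simps)

locale finite_vs = finite_dimensional_vector_space scale Basis
  for scale :: "'k::{field,finite} \<Rightarrow> 'v::ab_group_add \<Rightarrow> 'v" and Basis :: "'v set" +
  fixes q :: nat
  assumes card_scalars: "CARD('k) = q"
begin

lemma q_gt_1: "q > 1"
proof -
  have "card {0, 1 :: 'k} \<le> q" unfolding card_scalars [symmetric] by (intro card_mono) auto
  then show ?thesis by simp
qed

lemma card_span_independent: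
  assumes "finite B" "independent B"
  shows "finite (span B) \<and> card (span B) = q ^ card B"
  using assms
proof (induction B)
  case empty
  then show ?case by simp
next
  case (insert b B)
  then have ind: "independent B" "b \<notin> span B"
    by (auto simp: independent_insert)
  have "bij_betw (\<lambda>(k, v). scale k b + v) (UNIV \<times> span B) (span (insert b B))"
    unfolding bij_betw_def
  proof
    show "inj_on (\<lambda>(k, v). scale k b + v) (UNIV \<times> span B)"
    proof (rule inj_onI, clarify)
      fix k v k' v' assume v: "v \<in> span B" "v' \<in> span B" and eq: "scale k b + v = scale k' b + v'"
      have "scale (k - k') b = v' - v" using eq by (simp add: scale_left_diff_distrib algebra_simps)
      then have "scale (k - k') b \<in> span B" using v by (simp add: span_diff)
      then have "scale (inverse (k - k')) (scale (k - k') b) \<in> span B" by (rule span_scale)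
      then have "k = k'" using ind(2) by (cases "k = k'") simp_all
      then show "k = k' \<and> v = v'" using eq by simp
    qed
    show "(\<lambda>(k, v). scale k b + v) ` (UNIV \<times> span B) = span (insert b B)"
    proof (intro equalityI subsetI)
      fix u assume "u \<in> span (insert b B)"
      then obtain k where "u - scale k b \<in> span B" by (auto simp: span_breakdown_eq)
      then show "u \<in> (\<lambda>(k, v). scale k b + v) ` (UNIV \<times> span B)"
        by (intro image_eqI[of _ _ "(k, u - scale k b)"]) auto
    qed (auto simp: span_breakdown_eq, metis add_diff_cancel_left')
  qed
  moreover have "finite (span B)" "card (span B) = q ^ card B" using insert ind by auto
  ultimately show ?case
    using insert by (auto simp: bij_betw_finite[symmetric] bij_betw_same_card[symmetric] card_cartesian_product card_scalars)
qed

lemma card_subspace: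
  assumes "subspace S"
  shows "finite S" "card S = q ^ dim S"
proof -
  obtain B where B: "B \<subseteq> S" "independent B" "S \<subseteq> span B" "card B = dim S"
    using basis_exists by blast
  then have "span B = S" using assms by (metis span_subspace)
  then show "finite S" "card S = q ^ dim S"
    using card_span_independent[of B] B finiteI_independent by auto
qed

lemma finite_sets [simp]: "finite (A :: 'v set set)"
  by (rule finite_subset[OF subset_UNIV]) (use card_subspace(1)[OF subspace_UNIV] in \<open>simp add: Finite_Set.finite_set\<close>)

lemma dim_Un_Int:
  assumes "subspace S" "subspace T"
  shows "dim (S \<union> T) + dim (S \<inter> T) = dim S + dim T"
proof -
  have "span (S \<union> T) = {x + y |x y. x \<in> S \<and> y \<in> T}"
    using assms by (auto simp: span_Un span_eq_iff[THEN iffD2])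
  then show ?thesis using dim_sums_Int[OF assms] by (metis dim_span)
qed

lemma subspace_eqI: "subspace S \<Longrightarrow> subspace T \<Longrightarrow> S \<subseteq> T \<Longrightarrow> dim S = dim T \<Longrightarrow> S = T"
  using subspace_dim_equal by simp

lemma dim_psubset_subspace: "subspace S \<Longrightarrow> subspace T \<Longrightarrow> S \<subset> T \<Longrightarrow> dim S < dim T"
  using dim_psubset[of S T] by (simp add: span_eq_iff[THEN iffD2])

text \<open>The sets z - s partition t - s, and each of them has q^{dim s + 1} - q^{dim s}
  elements.\<close>

lemma card_covers_within:
  assumes s: "subspace s" and t: "subspace t" and st: "s \<subseteq> t"
  shows "real (card {z. subspace z \<and> s \<subseteq> z \<and> z \<subseteq> t \<and> dim z = Suc (dim s)})
    = qnum q (dim t - dim s)"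
proof -
  let ?Z = "{z. subspace z \<and> s \<subseteq> z \<and> z \<subseteq> t \<and> dim z = Suc (dim s)}"
  have U: "t - s = (\<Union>z\<in>?Z. z - s)"
  proof (intro equalityI subsetI)
    fix v assume v: "v \<in> t - s"
    have "v \<notin> span s" using v s by (simp add: span_eq_iff[THEN iffD2])
    then have "dim (span (insert v s)) = Suc (dim s)"
      using dim_insert[of v s] by (simp only: dim_span if_False Suc_eq_plus1)
    moreover have "span (insert v s) \<subseteq> t" using v st t by (intro span_minimal) auto
    ultimately have "span (insert v s) \<in> ?Z" by (auto simp: span_base)
    then show "v \<in> (\<Union>z\<in>?Z. z - s)" using v by (blast intro: span_base)
  qed auto
  have disj: "(z - s) \<inter> (z' - s) = {}" if "z \<in> ?Z" "z' \<in> ?Z" "z \<noteq> z'" for z z'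
  proof (rule ccontr)
    assume "(z - s) \<inter> (z' - s) \<noteq> {}"
    then have "s \<subset> z \<inter> z'" using that by auto
    then have "dim s < dim (z \<inter> z')"
      using that s by (intro dim_psubset_subspace) (auto simp: subspace_inter)
    moreover have "dim (z \<inter> z') \<le> dim z" "dim (z \<inter> z') \<le> dim z'" by (intro dim_subset; blast)+
    ultimately have "dim (z \<inter> z') = dim z" "dim (z \<inter> z') = dim z'" using that by auto
    then have "z \<inter> z' = z" "z \<inter> z' = z'"
      using that by (intro subspace_eqI; auto simp: subspace_inter)+
    then show False using that by auto
  qed
  have cd: "card (z - s) = q ^ Suc (dim s) - q ^ dim s" if "z \<in> ?Z" for z
    using that s card_subspace by (subst card_Diff_subset) auto
  have "q ^ dim t - q ^ dim s = card (t - s)"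
    using card_subspace[OF s] card_subspace[OF t] st by (subst card_Diff_subset) auto
  also have "\<dots> = (\<Sum>z\<in>?Z. card (z - s))"
    unfolding U using disj card_subspace(1) by (intro card_UN_disjoint) auto
  also have "\<dots> = card ?Z * (q ^ Suc (dim s) - q ^ dim s)"
    using cd by (simp only: sum_constant sum.cong) simp
  finally have "q ^ dim t - q ^ dim s = card ?Z * (q ^ Suc (dim s) - q ^ dim s)" .
  then have "real (q ^ dim t - q ^ dim s) = real (card ?Z * (q ^ Suc (dim s) - q ^ dim s))" by simp
  moreover have le: "dim s \<le> dim t" using dim_subset[OF st] .
  then have "q ^ dim s \<le> q ^ dim t" "q ^ dim s \<le> q ^ Suc (dim s)"
    using q_gt_1 by (auto intro!: power_increasing simp del: power_Suc)
  ultimately have "real q ^ dim t - real q ^ dim s = real (card ?Z) * (real q ^ Suc (dim s) - real q ^ dim s)"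
    by (simp only: of_nat_diff of_nat_mult of_nat_power)
  moreover have "real q ^ dim t = real q ^ dim s * real q ^ (dim t - dim s)"
    using le by (simp flip: power_add)
  ultimately have "real q ^ dim s * (real q ^ (dim t - dim s) - 1) = real q ^ dim s * (real (card ?Z) * (real q - 1))"
    by (simp add: algebra_simps)
  then have "real q ^ (dim t - dim s) - 1 = real (card ?Z) * (real q - 1)"
    using q_gt_1 by simp
  then show ?thesis using q_gt_1 by (simp add: qnum_def field_simps)
qed

definition hyps :: "'v set \<Rightarrow> 'v set set" where
  "hyps y = {s. subspace s \<and> s \<subseteq> y \<and> Suc (dim s) = dim y}"

definition covers :: "'v set \<Rightarrow> 'v set set" where
  "covers s = {z. subspace z \<and> s \<subseteq> z \<and> dim z = Suc (dim s)}"

text \<open>Double counting takes the place of duality. Count pairs (l, s) where l covers r and s is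
  a hyperplane of y containing l. Each l has [m - 1] partners by induction and each s has [m - 1]
  partners by \<open>card_covers_within\<close>, so there are as many s as l.\<close>

lemma card_hyps_containing:
  assumes "subspace r" "subspace y" "r \<subseteq> y"
  shows "real (card {s \<in> hyps y. r \<subseteq> s}) = qnum q (dim y - dim r)"
  using assms
proof (induction "dim y - dim r" arbitrary: r rule: less_induct)
  case less
  have le: "dim r \<le> dim y" using dim_subset less.prems(3) .
  let ?S = "{s \<in> hyps y. r \<subseteq> s}"
  consider "dim y = dim r" | "dim y = Suc (dim r)" | "dim y > Suc (dim r)" using le by linarith
  then show ?case
  proof cases
    case 1
    then have "s \<notin> ?S" for s using dim_subset[of r s] by (auto simp: hyps_def)
    then have "?S = {}" by blast
    then show ?thesis using 1 by simp
  next
    case 2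
    have "s = r" if "s \<in> ?S" for s
    proof -
      have "subspace s" "r \<subseteq> s" "dim r = dim s" using that 2 by (simp_all add: hyps_def)
      then show ?thesis using less.prems(1) subspace_eqI by blast
    qed
    moreover have "r \<in> ?S" using 2 less.prems by (simp add: hyps_def)
    ultimately have "?S = {r}" by blast
    moreover have "dim y - dim r = Suc 0" using 2 by simp
    ultimately show ?thesis using q_gt_1 by simp
  next
    case 3
    let ?L = "{l. subspace l \<and> r \<subseteq> l \<and> l \<subseteq> y \<and> dim l = Suc (dim r)}"
    let ?m = "dim y - dim r"
    have L: "real (card ?L) = qnum q ?m" using card_covers_within less.prems by blast
    have s: "real (card {l \<in> ?L. l \<subseteq> s}) = qnum q (?m - 1)" if "s \<in> ?S" for s
    proof -
      have "{l \<in> ?L. l \<subseteq> s} = {l. subspace l \<and> r \<subseteq> l \<and> l \<subseteq> s \<and> dim l = Suc (dim r)}"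
        using that by (auto simp: hyps_def)
      moreover have "dim s - dim r = ?m - 1" using that by (auto simp: hyps_def)
      ultimately show ?thesis using card_covers_within[of r s] that less.prems by (auto simp: hyps_def)
    qed
    have l: "real (card {s \<in> ?S. l \<subseteq> s}) = qnum q (?m - 1)" if "l \<in> ?L" for l
    proof -
      have "{s \<in> ?S. l \<subseteq> s} = {s \<in> hyps y. l \<subseteq> s}" using that by auto
      moreover have "dim y - dim l = ?m - 1" "dim y - dim l < ?m" using that 3 by auto
      ultimately show ?thesis using less.hyps[of l] that less.prems by auto
    qed
    have "real (card ?S) * qnum q (?m - 1) = (\<Sum>s\<in>?S. real (card {l \<in> ?L. l \<subseteq> s}))"
      using s by simp
    also have "\<dots> = (\<Sum>s\<in>?S. \<Sum>l\<in>?L. if l \<subseteq> s then 1 else 0)"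
      by (simp add: sum.If_cases Int_def)
    also have "\<dots> = (\<Sum>l\<in>?L. \<Sum>s\<in>?S. if l \<subseteq> s then 1 else 0)"
      by (rule sum.swap)
    also have "\<dots> = (\<Sum>l\<in>?L. real (card {s \<in> ?S. l \<subseteq> s}))"
      by (simp add: sum.If_cases Int_def)
    also have "\<dots> = real (card ?L) * qnum q (?m - 1)" using l by simp
    finally have "real (card ?S) * qnum q (?m - 1) = real (card ?L) * qnum q (?m - 1)" .
    \<comment> \<open>Cancelling [m - 1] requires m > 1, hence the separate treatment of codimension
      1.\<close>
    moreover have "qnum q (?m - 1) \<noteq> 0" using 3 q_gt_1 by (simp add: qnum_eq_0_iff)
    ultimately show ?thesis unfolding L [symmetric] by (rule mult_right_cancel [THEN iffD1, rotated])
  qed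
qed

lemma dim_hyp_Int:
  assumes "s \<in> hyps y" "subspace y" "subspace W" "W \<subseteq> y" "\<not> W \<subseteq> s"
  shows "Suc (dim (s \<inter> W)) = dim W"
proof -
  have s: "subspace s" "s \<subseteq> y" "Suc (dim s) = dim y" using assms by (auto simp: hyps_def)
  have "dim (s \<union> W) + dim (s \<inter> W) = dim s + dim W" using dim_Un_Int s assms by blast
  moreover have "dim (s \<union> W) \<le> dim y" using s assms by (intro dim_subset) auto
  moreover have "dim s < dim (s \<union> W)"
  proof -
    have "s \<subset> span (s \<union> W)" using assms(5) span_superset[of "s \<union> W"] by auto
    then show ?thesis using dim_psubset_subspace[of s "span (s \<union> W)"] s by simp
  qed
  ultimately show ?thesis using s by linarith
qed

text \<open>If z meets W outside s, then z = s + (z \<inter> W) because z covers s, and so z lies in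
  s + W. Conversely, a vector of z outside s, written as a + w with a in s and w in W, gives a
  vector w of z and W outside s.\<close>

lemma dim_cover_Int:
  assumes z: "z \<in> covers s" and s: "subspace s" and W: "subspace W"
  shows "dim (z \<inter> W) = dim (s \<inter> W) + (if z \<subseteq> span (s \<union> W) then 1 else 0)"
proof -
  have z': "subspace z" "s \<subseteq> z" "dim z = Suc (dim s)" using z by (auto simp: covers_def)
  have sz: "s \<in> hyps z" using z' s by (auto simp: hyps_def)
  have sub: "subspace (z \<inter> W)" using z' W by (simp add: subspace_inter)
  have int: "s \<inter> (z \<inter> W) = s \<inter> W" using z' by auto
  show ?thesis
  proof (cases "z \<inter> W \<subseteq> s")
    case True
    then have "z \<inter> W = s \<inter> W" using z' by auto
    moreover have "\<not> z \<subseteq> span (s \<union> W)"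
    proof
      assume a: "z \<subseteq> span (s \<union> W)"
      have "\<not> z \<subseteq> s" using z' dim_subset[of z s] by auto
      then obtain v where v: "v \<in> z" "v \<notin> s" by auto
      then obtain a w where aw: "v = a + w" "a \<in> s" "w \<in> W"
        using a s W by (auto simp: span_Un span_eq_iff[THEN iffD2] subset_iff)
      then have "w \<in> z" using v z' subspace_diff[of z v a] by auto
      then have "w \<in> s" using True aw by auto
      then show False using aw v s subspace_add by auto
    qed
    ultimately show ?thesis by simp
  next
    case False
    have "Suc (dim (s \<inter> W)) = dim (z \<inter> W)"
      using dim_hyp_Int[OF sz z'(1) sub _ False] int by simp
    moreover have "span (s \<union> (z \<inter> W)) = z"
    proof (rule subspace_eqI)
      show sub': "span (s \<union> z \<inter> W) \<subseteq> z" using z' by (intro span_minimal) auto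
      have "s \<subset> span (s \<union> (z \<inter> W))" using False span_superset[of "s \<union> (z \<inter> W)"] by auto
      then have "dim s < dim (span (s \<union> (z \<inter> W)))"
        using s by (intro dim_psubset_subspace) auto
      then show "dim (span (s \<union> z \<inter> W)) = dim z"
        using dim_subset[OF sub'] z' by (simp del: dim_span)
    qed (use z' in auto)
    then have "z \<subseteq> span (s \<union> W)" using span_mono[of "s \<union> (z \<inter> W)" "s \<union> W"] by auto
    ultimately show ?thesis by simp
  qed
qed

lemma dim_Int_hyps_le:
  assumes "s \<in> hyps y" "subspace y" "subspace W" "W \<subseteq> y"
  shows "dim W \<le> Suc (dim (s \<inter> W))"
proof (cases "W \<subseteq> s")
  case True
  then show ?thesis by (simp add: Int_absorb1)
next
  case False
  then show ?thesis using dim_hyp_Int[OF assms] by simp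
qed

text \<open>Stepping down to a hyperplane and up again, a neighbour z is reached only through y
  \<inter> z, the vertex y itself through each of its [D] hyperplanes, and any other vertex not at
  all.\<close>

lemma sum_hyps_covers:
  fixes f :: "'v set \<Rightarrow> complex"
  assumes y: "y \<in> grass_verts scale D" and D: "D > 0"
  shows "(\<Sum>s\<in>hyps y. \<Sum>z\<in>covers s. f z)
    = (\<Sum>z | z \<in> grass_verts scale D \<and> (y, z) \<in> grass_edges scale D. f z)
      + complex_of_real (qnum q D) * f y"
proof -
  let ?X = "grass_verts scale D"
  have X: "z \<in> ?X \<longleftrightarrow> subspace z \<and> dim z = D" for z by (simp add: grass_verts_def)
  have cov: "covers s = {z \<in> ?X. s \<subseteq> z}" if "s \<in> hyps y" for s
    using that y by (auto simp: covers_def X hyps_def)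
  define N where "N = (\<lambda>z. card {s \<in> hyps y. s \<subseteq> z})"
  have Ny: "real (N y) = qnum q D"
  proof -
    have "{s \<in> hyps y. s \<subseteq> y} = {s \<in> hyps y. {0} \<subseteq> s}"
      by (auto simp: hyps_def subspace_0)
    moreover have "dim {0} = 0" by simp
    ultimately show ?thesis
      using card_hyps_containing[of "{0}" y] y by (simp add: N_def X subspace_0 subspace_single_0)
  qed
  have Nz: "N z = (if (y, z) \<in> grass_edges scale D then 1 else 0)" if z: "z \<in> ?X" "z \<noteq> y" for z
  proof -
    have sub: "subspace (y \<inter> z)" using y z by (simp add: X subspace_inter)
    have "y \<inter> z \<noteq> y" using z y subspace_eqI[of y z] by (auto simp: X)
    then have lt: "dim (y \<inter> z) < D" using dim_psubset_subspace[OF sub, of y] y by (auto simp: X)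
    have eq: "s = y \<inter> z" if "s \<in> hyps y" "s \<subseteq> z" for s
      using that sub y lt dim_subset[of s "y \<inter> z"] by (intro subspace_eqI) (auto simp: hyps_def X)
    show ?thesis
    proof (cases "dim (y \<inter> z) = D - 1")
      case True
      then have "y \<inter> z \<in> hyps y" using sub y D by (auto simp: hyps_def X)
      then have "{s \<in> hyps y. s \<subseteq> z} = {y \<inter> z}" using eq by blast
      then show ?thesis using True y z by (simp add: N_def grass_edges_def)
    next
      case False
      then have "{s \<in> hyps y. s \<subseteq> z} = {}" using eq y D by (fastforce simp: hyps_def X)
      then have "N z = 0" by (simp only: N_def card.empty)
      then show ?thesis using False by (simp add: grass_edges_def)
    qed
  qed
  have irr: "(y, y) \<notin> grass_edges scale D" using y D by (auto simp: grass_edges_def X)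
  have "(\<Sum>s\<in>hyps y. \<Sum>z\<in>covers s. f z) = (\<Sum>s\<in>hyps y. \<Sum>z\<in>?X. if s \<subseteq> z then f z else 0)"
    using cov by (intro sum.cong [OF refl, of "hyps y"]) (simp add: sum.inter_filter)
  also have "\<dots> = (\<Sum>z\<in>?X. \<Sum>s\<in>hyps y. if s \<subseteq> z then f z else 0)" by (rule sum.swap)
  also have "\<dots> = (\<Sum>z\<in>?X. of_nat (N z) * f z)"
    by (intro sum.cong [OF refl, of ?X]) (simp add: sum.If_cases Int_def N_def)
  also have "\<dots> = of_nat (N y) * f y + (\<Sum>z\<in>?X - {y}. of_nat (N z) * f z)"
    using y by (intro sum.remove) auto
  also have "(\<Sum>z\<in>?X - {y}. of_nat (N z) * f z)
      = (\<Sum>z\<in>?X - {y}. if (y, z) \<in> grass_edges scale D then f z else 0)"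
    by (intro sum.cong refl) (auto simp: Nz)
  also have "\<dots> = (\<Sum>z | z \<in> ?X - {y} \<and> (y, z) \<in> grass_edges scale D. f z)"
    by (simp add: sum.If_cases Int_def)
  also have "{z. z \<in> ?X - {y} \<and> (y, z) \<in> grass_edges scale D} = {z. z \<in> ?X \<and> (y, z) \<in> grass_edges scale D}"
    using irr by auto
  also have "of_nat (N y) = complex_of_real (qnum q D)"
    unfolding Ny [symmetric] by simp
  finally show ?thesis by (simp add: add.commute)
qed

lemma sum_three_parts:
  fixes f :: "'v set \<Rightarrow> complex"
  assumes "A \<subseteq> B" "\<And>s. s \<in> H \<Longrightarrow> s \<in> A \<Longrightarrow> f s = a" "\<And>s. s \<in> H \<Longrightarrow> s \<in> B \<Longrightarrow> s \<notin> A \<Longrightarrow> f s = b"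
    "\<And>s. s \<in> H \<Longrightarrow> s \<notin> B \<Longrightarrow> f s = c"
  shows "(\<Sum>s\<in>H. f s) = of_nat (card (H \<inter> A)) * a
    + (of_nat (card (H \<inter> B)) - of_nat (card (H \<inter> A))) * b
    + (of_nat (card H) - of_nat (card (H \<inter> B))) * c"
proof -
  have "(\<Sum>s\<in>H. f s) = (\<Sum>s\<in>H \<inter> B. f s) + (\<Sum>s\<in>H - B. f s)"
    by (rule sum.Int_Diff) simp
  also have "(\<Sum>s\<in>H \<inter> B. f s) = (\<Sum>s\<in>H \<inter> B \<inter> A. f s) + (\<Sum>s\<in>H \<inter> B - A. f s)"
    by (rule sum.Int_Diff) simp
  also have "(\<Sum>s\<in>H \<inter> B \<inter> A. f s) = (\<Sum>s\<in>H \<inter> A. a)"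
    using assms(1,2) by (intro sum.cong) auto
  also have "(\<Sum>s\<in>H \<inter> B - A. f s) = (\<Sum>s\<in>H \<inter> B - A. b)"
    using assms(3) by (intro sum.cong) auto
  also have "(\<Sum>s\<in>H - B. f s) = (\<Sum>s\<in>H - B. c)"
    using assms(4) by (intro sum.cong) auto
  also have "card (H \<inter> B - A) = card (H \<inter> B) - card (H \<inter> A)"
  proof -
    have "H \<inter> B \<inter> A = H \<inter> A" using assms(1) by auto
    then show ?thesis by (simp add: card_Diff_subset_Int)
  qed
  moreover have "card (H - B) = card H - card (H \<inter> B)"
    by (simp add: card_Diff_subset_Int)
  moreover have "card (H \<inter> A) \<le> card (H \<inter> B)" "card (H \<inter> B) \<le> card H"
    using assms(1) by (auto intro!: card_mono)
  ultimately show ?thesis by (simp add: of_nat_diff)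
qed

end

text \<open>
  For the clique of all vertices above a subspace \<open>U\<close> of dimension \<open>D - 1\<close>, the cell of a vertex is
  determined by its position relative to the flag \<open>U \<subset> x\<close>; for the clique of all vertices inside a
  subspace \<open>U\<close> of dimension \<open>D + 1\<close>, by its position relative to the flag \<open>x \<subset> U\<close>. Neighbours are
  counted by first going down to a hyperplane and then up again.
\<close>

locale flag_vs = finite_vs scale Basis q
  for scale :: "'k::{field,finite} \<Rightarrow> 'v::ab_group_add \<Rightarrow> 'v" and Basis :: "'v set" and q :: nat +
  fixes S T :: "'v set" and d N :: nat
  assumes S: "subspace S" "dim S = d" and T: "subspace T" "dim T = Suc d" and ST: "S \<subseteq> T"
    and N: "dim UNIV = N"
begin

text \<open>\<open>lev\<close> and \<open>top_gap\<close> fix the position relative to the flag: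
  from S to T the intersection grows by at most one dimension (\<open>dim_Int_T\<close>), and
  \<open>top_gap\<close> tells whether it does.\<close>

definition lev :: "'v set \<Rightarrow> nat" where "lev y = dim (y \<inter> S)"
definition top_gap :: "'v set \<Rightarrow> bool" where "top_gap y \<longleftrightarrow> dim (y \<inter> T) \<noteq> dim (y \<inter> S)"

lemma dim_Int_T:
  assumes "subspace y"
  shows "dim (y \<inter> T) = lev y + (if top_gap y then 1 else 0)"
proof -
  have "S \<in> hyps T" using S T ST by (simp add: hyps_def)
  then have "dim (y \<inter> T) \<le> Suc (dim (S \<inter> (y \<inter> T)))"
    using assms T by (intro dim_Int_hyps_le[of S T]) (auto simp: subspace_inter)
  moreover have "S \<inter> (y \<inter> T) = y \<inter> S" using ST by auto
  moreover have "dim (y \<inter> S) \<le> dim (y \<inter> T)" using ST by (intro dim_subset) auto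
  ultimately show ?thesis by (auto simp: lev_def top_gap_def)
qed

abbreviation qn :: "nat \<Rightarrow> complex" where "qn n \<equiv> complex_of_real (qnum q n)"

text \<open>Sum over the hyperplanes of a D-dimensional y in position (j, b). Those containing y
  \<inter> T keep the position, those containing only y \<inter> S lose the gap, and all others drop
  one level and keep the gap. For j = 0 the truncated j - 1 has coefficient [D] - [D] = 0.\<close>

definition down :: "nat \<Rightarrow> (nat \<Rightarrow> bool \<Rightarrow> complex) \<Rightarrow> nat \<Rightarrow> bool \<Rightarrow> complex" where
  "down D G j b = (if b
     then qn (D - j - 1) * G j True + (qn (D - j) - qn (D - j - 1)) * G j False
          + (qn D - qn (D - j)) * G (j - 1) True
     else qn (D - j) * G j False + (qn D - qn (D - j)) * G (j - 1) False)"

text \<open>Sum over the covers z of a (D-1)-dimensional s in position (j, b). Those inside s + S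
  rise one level, those inside s + T but not s + S open the gap (none exist if it is open already),
  and the others keep the position.\<close>

definition up :: "nat \<Rightarrow> (nat \<Rightarrow> bool \<Rightarrow> complex) \<Rightarrow> nat \<Rightarrow> bool \<Rightarrow> complex" where
  "up D F j b = (if b
     then qn (d - j) * F (Suc j) True + (qn (N - D + 1) - qn (d - j)) * F j True
     else qn (d - j) * F (Suc j) False + (qn (d + 1 - j) - qn (d - j)) * F j True
          + (qn (N - D + 1) - qn (d + 1 - j)) * F j False)"

lemma sum_hyps:
  assumes y: "subspace y" "dim y = D"
  shows "(\<Sum>s\<in>hyps y. G (lev s) (top_gap s)) = down D G (lev y) (top_gap y)"
proof -
  let ?A = "{s. y \<inter> T \<subseteq> s}" and ?B = "{s. y \<inter> S \<subseteq> s}"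
  let ?j = "lev y" and ?b = "top_gap y"
  have sub: "subspace (y \<inter> S)" "subspace (y \<inter> T)" using y S T by (auto simp: subspace_inter)
  have cA: "real (card (hyps y \<inter> ?A)) = qnum q (D - dim (y \<inter> T))"
    using card_hyps_containing[OF sub(2) y(1)] y by (simp add: Int_def)
  have cB: "real (card (hyps y \<inter> ?B)) = qnum q (D - lev y)"
    using card_hyps_containing[OF sub(1) y(1)] y by (simp add: Int_def lev_def)
  have c: "real (card (hyps y)) = qnum q D"
  proof -
    have "{s \<in> hyps y. {0} \<subseteq> s} = hyps y" by (auto simp: hyps_def subspace_0)
    then show ?thesis
      using card_hyps_containing[of "{0}" y] y by (simp add: subspace_0 subspace_single_0)
  qed
  have "(\<Sum>s\<in>hyps y. G (lev s) (top_gap s)) = of_nat (card (hyps y \<inter> ?A)) * G ?j ?b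
    + (of_nat (card (hyps y \<inter> ?B)) - of_nat (card (hyps y \<inter> ?A))) * G ?j False
    + (of_nat (card (hyps y)) - of_nat (card (hyps y \<inter> ?B))) * G (?j - 1) ?b"
  proof (rule sum_three_parts)
    show "?A \<subseteq> ?B" using ST by auto
  next
    fix s assume s: "s \<in> hyps y" "s \<in> ?A"
    then have "s \<inter> T = y \<inter> T" "s \<inter> S = y \<inter> S" using ST by (auto simp: hyps_def)
    then show "G (lev s) (top_gap s) = G ?j ?b" by (simp add: lev_def top_gap_def)
  next
    fix s assume s: "s \<in> hyps y" "s \<in> ?B" "s \<notin> ?A"
    have sS: "s \<inter> S = y \<inter> S" using s by (auto simp: hyps_def)
    have "Suc (dim (s \<inter> (y \<inter> T))) = dim (y \<inter> T)"
      using s y sub by (intro dim_hyp_Int) auto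
    moreover have "s \<inter> (y \<inter> T) = s \<inter> T" using s by (auto simp: hyps_def)
    moreover have "dim (s \<inter> S) \<le> dim (s \<inter> T)" using ST by (intro dim_subset) auto
    ultimately have "Suc (dim (s \<inter> T)) = dim (y \<inter> T)" "dim (y \<inter> S) \<le> dim (s \<inter> T)"
      using sS by simp_all
    then have "dim (s \<inter> T) = dim (s \<inter> S)"
      using dim_Int_T[OF y(1)] unfolding lev_def sS by (cases ?b) simp_all
    then have "\<not> top_gap s" unfolding top_gap_def by simp
    then show "G (lev s) (top_gap s) = G ?j False" by (simp add: lev_def sS)
  next
    fix s assume s: "s \<in> hyps y" "s \<notin> ?B"
    have "Suc (dim (s \<inter> (y \<inter> S))) = dim (y \<inter> S)"
      using s y sub by (intro dim_hyp_Int) auto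
    moreover have "s \<inter> (y \<inter> S) = s \<inter> S" using s by (auto simp: hyps_def)
    moreover have "\<not> y \<inter> T \<subseteq> s" using s ST by auto
    then have "Suc (dim (s \<inter> (y \<inter> T))) = dim (y \<inter> T)"
      using s y sub by (intro dim_hyp_Int) auto
    moreover have "s \<inter> (y \<inter> T) = s \<inter> T" using s by (auto simp: hyps_def)
    ultimately have "lev s = ?j - 1" "top_gap s = ?b"
      by (auto simp: lev_def top_gap_def)
    then show "G (lev s) (top_gap s) = G (?j - 1) ?b" by simp
  qed
  moreover have "of_nat (card (hyps y \<inter> ?A)) = qn (D - dim (y \<inter> T))"
    using cA by (metis of_real_of_nat_eq)
  moreover have "of_nat (card (hyps y \<inter> ?B)) = qn (D - lev y)"
    using cB by (metis of_real_of_nat_eq)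
  moreover have "of_nat (card (hyps y)) = qn D"
    using c by (metis of_real_of_nat_eq)
  ultimately show ?thesis
    unfolding down_def by (cases ?b) (simp_all add: dim_Int_T[OF y(1)])
qed

lemma sum_covers:
  assumes s: "subspace s" "Suc (dim s) = D" and DN: "D \<le> N"
  shows "(\<Sum>z\<in>covers s. F (lev z) (top_gap z)) = up D F (lev s) (top_gap s)"
proof -
  let ?A = "{z. z \<subseteq> span (s \<union> S)}" and ?B = "{z. z \<subseteq> span (s \<union> T)}"
  let ?j = "lev s" and ?b = "top_gap s"
  have card_within: "real (card (covers s \<inter> {z. z \<subseteq> span (s \<union> W)})) = qnum q (dim W - dim (s \<inter> W))"
    if "subspace W" for W
  proof -
    have "dim (s \<union> W) - dim s = dim W - dim (s \<inter> W)" using dim_Un_Int[OF s(1) that] by linarith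
    moreover have "covers s \<inter> {z. z \<subseteq> span (s \<union> W)}
      = {z. subspace z \<and> s \<subseteq> z \<and> z \<subseteq> span (s \<union> W) \<and> dim z = Suc (dim s)}"
      by (auto simp: covers_def)
    moreover have "s \<subseteq> span (s \<union> W)" using span_superset[of "s \<union> W"] by auto
    ultimately show ?thesis using card_covers_within[OF s(1), of "span (s \<union> W)"] by simp
  qed
  have c: "real (card (covers s)) = qnum q (N - D + 1)"
  proof -
    have "covers s = covers s \<inter> {z. z \<subseteq> span (s \<union> UNIV)}" by auto
    moreover have "dim UNIV - dim (s \<inter> UNIV) = N - D + 1" using s DN N by simp
    ultimately show ?thesis using card_within[OF subspace_UNIV] by simp
  qed
  have main: "(\<Sum>z\<in>covers s. F (lev z) (top_gap z)) = of_nat (card (covers s \<inter> ?A)) * F (Suc ?j) ?b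
    + (of_nat (card (covers s \<inter> ?B)) - of_nat (card (covers s \<inter> ?A))) * F ?j True
    + (of_nat (card (covers s)) - of_nat (card (covers s \<inter> ?B))) * F ?j ?b"
  proof (rule sum_three_parts)
    show AB: "?A \<subseteq> ?B" using span_mono[of "s \<union> S" "s \<union> T"] ST by auto
    fix z assume z: "z \<in> covers s"
    have dz: "dim (z \<inter> W) = dim (s \<inter> W) + (if z \<subseteq> span (s \<union> W) then 1 else 0)" if "subspace W" for W
      using dim_cover_Int[OF z s(1) that] .
    have z': "subspace z" using z by (simp add: covers_def)
    note dT = dim_Int_T[OF s(1)] dim_Int_T[OF z']
    {
      assume "z \<in> ?A"
      moreover from this have "z \<in> ?B" using AB by auto
      ultimately have "lev z = Suc ?j" "top_gap z = ?b"
        using dz[OF S(1)] dz[OF T(1)] by (auto simp: lev_def top_gap_def)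
      then show "F (lev z) (top_gap z) = F (Suc ?j) ?b" by simp
    next
      assume "z \<in> ?B" "z \<notin> ?A"
      then have "lev z = ?j" "top_gap z"
        using dz[OF S(1)] dz[OF T(1)] dT by (auto simp: lev_def split: if_splits)
      then show "F (lev z) (top_gap z) = F ?j True" by simp
    next
      assume "z \<notin> ?B"
      moreover from this have "z \<notin> ?A" using AB by auto
      ultimately have "lev z = ?j" "top_gap z = ?b"
        using dz[OF S(1)] dz[OF T(1)] by (auto simp: lev_def top_gap_def)
      then show "F (lev z) (top_gap z) = F ?j ?b" by simp
    }
  qed
  have "of_nat k = qn m" if "real k = qnum q m" for k m
    using that by (metis of_real_of_nat_eq)
  note conv = this
  have "of_nat (card (covers s \<inter> ?A)) = qn (d - lev s)"
    using card_within[OF S(1)] S by (intro conv) (simp add: lev_def)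
  moreover have "of_nat (card (covers s \<inter> ?B)) = qn (d + 1 - lev s - (if ?b then 1 else 0))"
    using card_within[OF T(1)] T by (intro conv) (simp add: dim_Int_T[OF s(1)])
  moreover have "of_nat (card (covers s)) = qn (N - D + 1)" using c by (rule conv)
  ultimately show ?thesis unfolding up_def main by (cases ?b) simp_all
qed

lemma adj_sum:
  assumes y: "y \<in> grass_verts scale D" and D: "0 < D" "D \<le> N"
  shows "(\<Sum>z | z \<in> grass_verts scale D \<and> (y, z) \<in> grass_edges scale D. F (lev z) (top_gap z))
    = down D (up D F) (lev y) (top_gap y) - qn D * F (lev y) (top_gap y)"
proof -
  have y': "subspace y" "dim y = D" using y by (auto simp: grass_verts_def)
  have "(\<Sum>s\<in>hyps y. \<Sum>z\<in>covers s. F (lev z) (top_gap z)) = (\<Sum>s\<in>hyps y. up D F (lev s) (top_gap s))"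
    using y' D by (intro sum.cong refl sum_covers) (auto simp: hyps_def)
  also have "\<dots> = down D (up D F) (lev y) (top_gap y)" by (rule sum_hyps[OF y'])
  finally show ?thesis using sum_hyps_covers[OF y D(1), of "\<lambda>z. F (lev z) (top_gap z)"]
    by (simp only: eq_diff_eq)
qed

end

text \<open>
  For \<open>i = 0\<close> the truncated index \<open>i - 1\<close> is harmless, since its coefficient contains
  \<open>qnum q 0 = 0\<close>; likewise \<open>qnum q (D - 1 - i)\<close> vanishes for \<open>i = D - 1\<close>.
\<close>

fun clique_quot :: "nat \<Rightarrow> nat \<Rightarrow> nat \<Rightarrow> (pm \<Rightarrow> nat \<Rightarrow> complex) \<Rightarrow> pm \<Rightarrow> nat \<Rightarrow> complex" where
  "clique_quot q N D F Minus i = (let n = (\<lambda>k. complex_of_real (qnum q k)); Q = (of_nat q :: complex) in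
      (n i)\<^sup>2 * F Minus (i - 1) + Q ^ i * n i * F Plus (i - 1)
    + Q ^ (2 * i + 1) * n (N - D - i) * F Plus i
    + Q ^ (2 * i + 2) * n (D - 1 - i) * n (N - D - i) * F Minus (i + 1)
    + (Q * n D * n (N - D) - ((n i)\<^sup>2 + Q ^ i * n i + Q ^ (2 * i + 1) * n (N - D - i)
         + Q ^ (2 * i + 2) * n (D - 1 - i) * n (N - D - i))) * F Minus i)"
| "clique_quot q N D F Plus i = (let n = (\<lambda>k. complex_of_real (qnum q k)); Q = (of_nat q :: complex) in
      n i * n (i + 1) * F Plus (i - 1) + Q ^ i * n (i + 1) * F Minus i
    + Q ^ (2 * i + 2) * n (D - 1 - i) * F Minus (i + 1)
    + Q ^ (2 * i + 3) * n (D - 1 - i) * n (N - D - 1 - i) * F Plus (i + 1)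
    + (Q * n D * n (N - D) - (n i * n (i + 1) + Q ^ i * n (i + 1) + Q ^ (2 * i + 2) * n (D - 1 - i)
         + Q ^ (2 * i + 3) * n (D - 1 - i) * n (N - D - 1 - i))) * F Plus i)"

context flag_vs
begin

lemma qn_Suc: "qn (Suc k) = 1 + of_nat q * qn k" "qn (Suc k) = qn k + of_nat q ^ k"
proof -
  have "qnum q (Suc k) = 1 + real q * qnum q k"
    using qnum_add[OF q_gt_1, of 1 k] q_gt_1 by simp
  then show "qn (Suc k) = 1 + of_nat q * qn k" by simp
  have "qnum q (Suc k) = qnum q k + real q ^ k"
    using qnum_add[OF q_gt_1, of k 1] q_gt_1 by simp
  then show "qn (Suc k) = qn k + of_nat q ^ k" by simp
qed

lemma qn_split: "m \<le> k \<Longrightarrow> qn k = qn m + of_nat q ^ m * qn (k - m)"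
  using qnum_add[OF q_gt_1, of m "k - m"] by simp

text \<open>Here S = U and T = x, so a gap means that y meets x in one dimension more than U, which
  puts y into a Minus cell; the index is D - 1 - j. After all q-numbers are expressed through q,
  q^i, [i], [D-1-i] and [N-D-1-i], both sides are equal polynomials.\<close>

lemma down_up_bottom_flag:
  fixes F :: "pm \<Rightarrow> nat \<Rightarrow> complex"
  assumes d: "Suc d = D" and D: "0 < D" "2 * D \<le> N" and j: "j < D"
  defines "F' \<equiv> \<lambda>j b. F (if b then Minus else Plus) (D - 1 - j)"
  shows "down D (up D F') j b - qn D * F' j b
     = clique_quot q N D F (if b then Minus else Plus) (D - 1 - j)"
proof -
  define i where "i = D - 1 - j"
  define Q where "Q = (of_nat q :: complex)"
  have ji: "j = D - 1 - i" "i < D" using j by (auto simp: i_def)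
  define w X Z a where "w = Q ^ i" and "X = qn (D - 1 - i)" and "Z = qn (N - D - 1 - i)" and "a = qn i"
  have ar: "D - j - 1 = i" "D - j = Suc i" "d - j = i" "d + 1 - j = Suc i" "D - 1 - j = i"
    "D - 1 - Suc j = i - 1"
    using ji d by auto
  have n1: "qn (Suc i) = a + w" by (simp add: qn_Suc(2) a_def w_def Q_def)
  have n2: "qn (Suc (Suc i)) = a + w + Q * w" by (simp add: qn_Suc(2) a_def w_def Q_def)
  have nD: "qn D = a + w + Q * w * X"
    using qn_split[of "Suc i" D] ji n1 by (simp add: X_def w_def Q_def)
  have nNi: "qn (N - D - i) = 1 + Q * Z"
    using qn_Suc(1)[of "N - D - 1 - i"] ji D by (simp add: Z_def Q_def Suc_diff_Suc)
  have nN1: "qn (Suc (N - D)) = a + w + Q * w * (1 + Q * Z)"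
    using qn_split[of "Suc i" "Suc (N - D)"] ji n1 nNi D by (simp add: w_def Q_def)
  \<comment> \<open>The relation q [i] = [i] + q^i - 1 is built into this expression, because the
    closing simplification treats \<open>a\<close> and \<open>w\<close> as independent
    symbols.\<close>
  have nN: "Q * qn (N - D) = a + w + Q * w * (1 + Q * Z) - 1"
    using qn_Suc(1)[of "N - D"] nN1 by (simp add: Q_def)
  have p: "Q ^ (2 * i + 1) = Q * w * w" "Q ^ (2 * i + 2) = Q * Q * w * w" "Q ^ (2 * i + 3) = Q * Q * Q * w * w"
    by (simp_all add: w_def power_add mult_2 numeral_eq_Suc mult_ac)
  have diag: "Q * (a + w + Q * w * X) * qn (N - D) = (a + w + Q * w * X) * (a + w + Q * w * (1 + Q * Z) - 1)"
    unfolding nN [symmetric] by (simp only: mult_ac)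
  note quot = clique_quot.simps Let_def Q_def [symmetric] p w_def [symmetric] a_def [symmetric]
    X_def [symmetric] Z_def [symmetric] diag nNi
  have arith: "Suc i - 1 = i" "i + 1 = Suc i" "N - D + 1 = Suc (N - D)" by simp_all
  show ?thesis
  proof (cases "j = 0")
    \<comment> \<open>At level 0 the truncated j - 1 does not correspond to the index i + 1; then i
      = D - 1, and the terms concerned carry the factor X = 0.\<close>
    case True
    then have X0: "X = 0" and ar0: "D - 1 - (j - 1) = i" "d - (j - 1) = i" "d + 1 - (j - 1) = Suc i"
      using ji d by (auto simp: X_def)
    show ?thesis
      unfolding i_def [symmetric]
      by (cases b; simp only: down_def up_def F'_def if_True if_False simp_thms arith ar ar0 nD n1 nN1 quot
          a_def [symmetric]; simp add: X0 power2_eq_square algebra_simps)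
  next
    case False
    then have ar': "D - 1 - (j - 1) = Suc i" "d - (j - 1) = Suc i" "d + 1 - (j - 1) = Suc (Suc i)"
      "Suc (j - 1) = j"
      using ji d by auto
    show ?thesis
      unfolding i_def [symmetric]
      by (cases b; simp only: down_def up_def F'_def if_True if_False simp_thms arith ar ar' nD n1 n2 nN1 quot
          a_def [symmetric]; simp add: power2_eq_square algebra_simps)
  qed
qed

text \<open>Here S = x and T = U, so a gap means that y is nearer to the clique than to x, which
  puts it into a Plus cell. The intersection with U has dimension j + 1 or j, hence the two index
  formulas. Level 0 without a gap is excluded because y and U have dimensions D and D + 1 in a space
  of dimension 2D.\<close>

lemma down_up_top_flag:
  fixes F :: "pm \<Rightarrow> nat \<Rightarrow> complex"
  assumes d: "d = D" and D: "0 < D" "2 * D = N" and j: "if b then j < D else 0 < j \<and> j \<le> D"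
  defines "F' \<equiv> \<lambda>j b. F (if b then Plus else Minus) (if b then D - 1 - j else D - j)"
  shows "down D (up D F') j b - qn D * F' j b
     = clique_quot q N D F (if b then Plus else Minus) (if b then D - 1 - j else D - j)"
proof -
  define i where "i = (if b then D - 1 - j else D - j)"
  define Q where "Q = (of_nat q :: complex)"
  have ji: "j = (if b then D - 1 - i else D - i)" "i < D" using j by (auto simp: i_def)
  define w X a where "w = Q ^ i" and "X = qn (D - 1 - i)" and "a = qn i"
  have n1: "qn (Suc i) = a + w" by (simp add: qn_Suc(2) a_def w_def Q_def)
  have n2: "qn (Suc (Suc i)) = a + w + Q * w" by (simp add: qn_Suc(2) a_def w_def Q_def)
  have nD: "qn D = a + w + Q * w * X"
    using qn_split[of "Suc i" D] ji n1 by (simp add: X_def w_def Q_def)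
  have ND: "N - D = D" using D by simp
  have nDi: "qn (D - i) = 1 + Q * X"
    using qn_Suc(1)[of "D - 1 - i"] ji D by (simp add: X_def Q_def Suc_diff_Suc)
  have nD1: "qn (Suc D) = a + w + Q * w * (1 + Q * X)"
    using qn_split[of "Suc i" "Suc D"] ji n1 nDi D by (simp add: w_def Q_def)
  have nN: "Q * qn D = a + w + Q * w * (1 + Q * X) - 1"
    using qn_Suc(1)[of D] nD1 by (simp add: Q_def)
  have p: "Q ^ (2 * i + 1) = Q * w * w" "Q ^ (2 * i + 2) = Q * Q * w * w" "Q ^ (2 * i + 3) = Q * Q * Q * w * w"
    by (simp_all add: w_def power_add mult_2 numeral_eq_Suc mult_ac)
  have diag: "Q * (a + w + Q * w * X) * qn (N - D) = (a + w + Q * w * X) * (a + w + Q * w * (1 + Q * X) - 1)"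
    unfolding nN [symmetric] ND by (simp only: mult_ac)
  have ND1: "D - Suc 0 - i = D - 1 - i" "N - D - i = D - i" "N - D - 1 - i = D - 1 - i" by (simp_all add: ND)
  have nN1: "qn (N - D + 1) = a + w + Q * w * (1 + Q * X)" using nD1 ND by simp
  note quot = clique_quot.simps Let_def Q_def [symmetric] p w_def [symmetric] a_def [symmetric]
    X_def [symmetric] diag
  have arith: "Suc i - 1 = i" "i + 1 = Suc i" by simp_all
  show ?thesis
  proof (cases b)
    case False
    have ar: "D - j = i" "d - j = i" "d + 1 - j = Suc i" "D - Suc j = i - 1"
      "D - (j - 1) = Suc i" "d - (j - 1) = Suc i" "d + 1 - (j - 1) = Suc (Suc i)" "Suc (j - 1) = j"
      "D - 1 - (j - 1) = i" "D - 1 - j = i - 1"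
      using ji d False j by auto
    show ?thesis
      unfolding i_def [symmetric]
      by (simp only: down_def up_def F'_def if_True if_False simp_thms False arith ND1 ar nD nN1 n1 n2 nDi quot
          a_def [symmetric]; simp add: power2_eq_square algebra_simps)
  next
    case True
    have ar: "D - 1 - j = i" "D - j - 1 = i" "D - j = Suc i" "d - j = Suc i" "d + 1 - j = Suc (Suc i)"
      "D - 1 - Suc j = i - 1" "D - Suc j = i"
      using ji d True j by auto
    show ?thesis
    proof (cases "j = 0")
      case j0: True
      then have X0: "X = 0" using ji True by (auto simp: X_def)
      have ar0: "D - 1 - (j - 1) = i" "d - (j - 1) = Suc i" "j - 1 = j" using j0 ar by auto
      show ?thesis
        unfolding i_def [symmetric]
        by (simp only: down_def up_def F'_def if_True if_False simp_thms True arith ND1 ar ar0 nD nN1 n1 n2 nDi quot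
          a_def [symmetric]; simp add: X0 power2_eq_square algebra_simps)
    next
      case False
      then have ar': "D - 1 - (j - 1) = Suc i" "d - (j - 1) = Suc (Suc i)" "Suc (j - 1) = j"
        using ji d True by auto
      show ?thesis
        unfolding i_def [symmetric]
        by (simp only: down_def up_def F'_def if_True if_False simp_thms True arith ND1 ar ar' nD nN1 n1 n2 nDi quot
          a_def [symmetric]; simp add: power2_eq_square algebra_simps)
    qed
  qed
qed

end

section \<open>Delsarte cliques and their distance partition\<close>

lemma qnum_le_iff: "q > 1 \<Longrightarrow> qnum q m \<le> qnum q n \<longleftrightarrow> m \<le> n"
  by (simp add: qnum_def divide_le_cancel)

context finite_vs
begin

lemma mem_grass_verts: "z \<in> grass_verts scale D \<longleftrightarrow> subspace z \<and> dim z = D"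
  by (simp add: grass_verts_def)

lemma ex_cover:
  assumes "subspace s" "v \<notin> s"
  obtains z where "z \<in> covers s" "v \<in> z"
proof
  have "v \<notin> span s" using assms by (simp add: span_eq_iff[THEN iffD2])
  then have "dim (span (insert v s)) = Suc (dim s)"
    using dim_insert[of v s] by (simp only: dim_span if_False Suc_eq_plus1)
  then show "span (insert v s) \<in> covers s" by (auto simp: covers_def span_base)
  show "v \<in> span (insert v s)" by (simp add: span_base)
qed

lemma ex_hyp:
  assumes "subspace r" "subspace y" "r \<subseteq> y" "dim r < dim y"
  obtains s where "s \<in> hyps y" "r \<subseteq> s"
proof -
  have "qnum q (dim y - dim r) \<noteq> 0" using assms q_gt_1 by (simp add: qnum_eq_0_iff)
  then have "{s \<in> hyps y. r \<subseteq> s} \<noteq> {}"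
    using card_hyps_containing[OF assms(1-3)] by (metis card.empty of_nat_0)
  then show ?thesis using that by blast
qed

lemma dim_Int_less:
  assumes "y \<in> grass_verts scale D" "z \<in> grass_verts scale D" "y \<noteq> z"
  shows "dim (y \<inter> z) < D"
proof -
  have "y \<inter> z \<noteq> y" using assms subspace_eqI[of y z] by (auto simp: mem_grass_verts)
  then show ?thesis
    using dim_psubset_subspace[of "y \<inter> z" y] assms by (auto simp: mem_grass_verts subspace_inter)
qed

text \<open>For an edge from w to z the subspace w \<inter> z is a hyperplane of w, so each step
  costs the intersection with y at most one dimension.\<close>

lemma grass_path_lower:
  assumes "(y, z) \<in> grass_edges scale D ^^ n" "y \<in> grass_verts scale D" "D > 0"
  shows "z \<in> grass_verts scale D \<and> D \<le> n + dim (y \<inter> z)"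
  using assms(1)
proof (induction n arbitrary: z)
  case 0
  then show ?case using assms(2) by (simp add: mem_grass_verts)
next
  case (Suc n)
  then obtain w where w: "(y, w) \<in> grass_edges scale D ^^ n" "(w, z) \<in> grass_edges scale D" by auto
  have w': "w \<in> grass_verts scale D" "z \<in> grass_verts scale D" "dim (w \<inter> z) = D - 1"
    using w(2) by (auto simp: grass_edges_def)
  have "w \<inter> z \<in> hyps w" using w' assms(3) by (auto simp: hyps_def mem_grass_verts subspace_inter)
  then have "dim (y \<inter> w) \<le> Suc (dim (w \<inter> z \<inter> (y \<inter> w)))"
    using w' assms(2) by (intro dim_Int_hyps_le) (auto simp: mem_grass_verts subspace_inter)
  moreover have "dim (w \<inter> z \<inter> (y \<inter> w)) \<le> dim (y \<inter> z)" by (intro dim_subset) auto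
  ultimately show ?case using Suc.IH[OF w(1)] w' by linarith
qed

text \<open>An exchange step: take a hyperplane s of y containing y \<inter> z, add a vector of z
  outside y, and obtain a neighbour of y with a larger intersection with z.\<close>

lemma grass_path_exists:
  assumes "y \<in> grass_verts scale D" "z \<in> grass_verts scale D" "D \<le> m + dim (y \<inter> z)" "D > 0"
  shows "\<exists>n\<le>m. (y, z) \<in> grass_edges scale D ^^ n"
  using assms
proof (induction m arbitrary: y)
  case 0
  then have "y = z" using dim_Int_less[of y D z] by force
  then show ?case by (intro exI[of _ 0]) simp
next
  case (Suc m)
  show ?case
  proof (cases "y = z")
    case True
    then show ?thesis by (intro exI[of _ 0]) simp
  next
    case False
    have sub: "subspace y" "subspace z" "dim y = D" "dim z = D" "subspace (y \<inter> z)"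
      using Suc.prems by (auto simp: mem_grass_verts subspace_inter)
    have lt: "dim (y \<inter> z) < dim y" using dim_Int_less Suc.prems False sub by metis
    obtain s where s: "s \<in> hyps y" "y \<inter> z \<subseteq> s" using ex_hyp[OF sub(5,1) _ lt] by blast
    have "\<not> z \<subseteq> y" using subspace_eqI[of z y] sub False by auto
    then obtain v where v: "v \<in> z" "v \<notin> y" by blast
    have s': "subspace s" "s \<subseteq> y" "Suc (dim s) = D" using s sub by (auto simp: hyps_def)
    obtain w where w: "w \<in> covers s" "v \<in> w" using ex_cover[OF s'(1), of v] v s' by blast
    have w': "w \<in> grass_verts scale D" "s \<subseteq> w" using w s' by (auto simp: covers_def mem_grass_verts)
    have "y \<noteq> w" using v w by auto
    then have "dim (y \<inter> w) < D" using dim_Int_less Suc.prems w' by blast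
    moreover have "dim s \<le> dim (y \<inter> w)" using s' w' by (intro dim_subset) auto
    ultimately have e: "(y, w) \<in> grass_edges scale D"
      using Suc.prems w' s' by (auto simp: grass_edges_def)
    have "y \<inter> z \<subset> w \<inter> z" using s w' v w by auto
    then have "dim (y \<inter> z) < dim (w \<inter> z)"
      using sub w' by (intro dim_psubset_subspace) (auto simp: subspace_inter mem_grass_verts)
    then obtain n where n: "n \<le> m" "(w, z) \<in> grass_edges scale D ^^ n"
      using Suc.IH[OF w'(1)] Suc.prems by auto
    have "(y, z) \<in> grass_edges scale D ^^ Suc n" using relpow_Suc_I2[OF e n(2)] .
    then show ?thesis using n by (intro exI[of _ "Suc n"]) simp
  qed
qed

lemma grass_dist_eq:
  assumes "y \<in> grass_verts scale D" "z \<in> grass_verts scale D" "D > 0"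
  shows "grass_dist scale D y z = D - dim (y \<inter> z)"
  unfolding grass_dist_def path_dist_def
proof (rule Least_equality)
  show "(y, z) \<in> grass_edges scale D ^^ (D - dim (y \<inter> z))"
  proof -
    obtain n where n: "n \<le> D - dim (y \<inter> z)" "(y, z) \<in> grass_edges scale D ^^ n"
      using grass_path_exists[OF assms(1,2) _ assms(3), of "D - dim (y \<inter> z)"] by (auto simp: le_diff_conv [symmetric])
    then have "n = D - dim (y \<inter> z)" using grass_path_lower[OF n(2) assms(1,3)] by linarith
    then show ?thesis using n by simp
  qed
  show "D - dim (y \<inter> z) \<le> n" if "(y, z) \<in> grass_edges scale D ^^ n" for n
    using grass_path_lower[OF that assms(1,3)] by linarith
qed

text \<open>A cover of U meets y in at most one dimension more than U does; equality holds for the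
  cover generated by a vector of y outside U.\<close>

lemma dist_clique_covers:
  assumes U: "subspace U" "Suc (dim U) = D" and y: "y \<in> grass_verts scale D"
  shows "Min ((\<lambda>z. grass_dist scale D y z) ` covers U) = D - 1 - dim (y \<inter> U)"
proof (rule Min_eqI)
  have cov: "z \<in> grass_verts scale D" "U \<in> hyps z" "subspace z" if "z \<in> covers U" for z
    using that U by (auto simp: covers_def mem_grass_verts hyps_def)
  have D: "D > 0" using U by auto
  show "D - 1 - dim (y \<inter> U) \<le> k" if k: "k \<in> (\<lambda>z. grass_dist scale D y z) ` covers U" for k
  proof -
    obtain z where z: "z \<in> covers U" "k = D - dim (y \<inter> z)"
      using k grass_dist_eq[OF y cov(1) D] by auto
    have "dim (y \<inter> z) \<le> Suc (dim (U \<inter> (y \<inter> z)))"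
      using cov[OF z(1)] y by (intro dim_Int_hyps_le[of U z]) (auto simp: subspace_inter mem_grass_verts)
    moreover have "dim (U \<inter> (y \<inter> z)) \<le> dim (y \<inter> U)" by (intro dim_subset) auto
    ultimately show ?thesis using z by linarith
  qed
  show "D - 1 - dim (y \<inter> U) \<in> (\<lambda>z. grass_dist scale D y z) ` covers U"
  proof -
    have "\<not> y \<subseteq> U" using y U dim_subset[of y U] by (auto simp: mem_grass_verts)
    then obtain v where v: "v \<in> y" "v \<notin> U" by blast
    obtain z where z: "z \<in> covers U" "v \<in> z" using ex_cover[OF U(1) v(2)] by blast
    have "y \<inter> U \<subset> y \<inter> z" using v z by (auto simp: covers_def)
    then have lt: "dim (y \<inter> U) < dim (y \<inter> z)"
      using y U cov[OF z(1)] by (intro dim_psubset_subspace) (auto simp: subspace_inter mem_grass_verts)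
    have "dim (y \<inter> z) \<le> Suc (dim (U \<inter> (y \<inter> z)))"
      using cov[OF z(1)] y by (intro dim_Int_hyps_le[of U z]) (auto simp: subspace_inter mem_grass_verts)
    moreover have "dim (U \<inter> (y \<inter> z)) \<le> dim (y \<inter> U)" by (intro dim_subset) auto
    ultimately have "dim (y \<inter> z) = Suc (dim (y \<inter> U))" using lt by linarith
    then have "grass_dist scale D y z = D - 1 - dim (y \<inter> U)"
      using grass_dist_eq[OF y cov(1)[OF z(1)] D] by simp
    then show ?thesis using z by force
  qed
qed simp

text \<open>The subspace y \<inter> U is smaller than U, so it lies in a hyperplane of U, and no
  other hyperplane of U can contain more of y.\<close>

lemma dist_clique_hyps:
  assumes U: "subspace U" "dim U = Suc D" and y: "y \<in> grass_verts scale D" and D: "D > 0"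
  shows "Min ((\<lambda>z. grass_dist scale D y z) ` hyps U) = D - dim (y \<inter> U)"
proof (rule Min_eqI)
  have hyp: "z \<in> grass_verts scale D" "z \<subseteq> U" if "z \<in> hyps U" for z
    using that U by (auto simp: mem_grass_verts hyps_def)
  show "D - dim (y \<inter> U) \<le> k" if k: "k \<in> (\<lambda>z. grass_dist scale D y z) ` hyps U" for k
  proof -
    obtain z where z: "z \<in> hyps U" "k = D - dim (y \<inter> z)"
      using k grass_dist_eq[OF y hyp(1) D] by auto
    have "dim (y \<inter> z) \<le> dim (y \<inter> U)" using hyp[OF z(1)] by (intro dim_subset) auto
    then show ?thesis using z by linarith
  qed
  show "D - dim (y \<inter> U) \<in> (\<lambda>z. grass_dist scale D y z) ` hyps U"
  proof -
    have "dim (y \<inter> U) \<le> dim y" by (intro dim_subset) auto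
    then have "dim (y \<inter> U) < dim U" using y U by (simp add: mem_grass_verts)
    then obtain z where z: "z \<in> hyps U" "y \<inter> U \<subseteq> z"
      using ex_hyp[of "y \<inter> U" U] y U by (auto simp: subspace_inter mem_grass_verts)
    then have "y \<inter> z = y \<inter> U" using hyp[OF z(1)] by auto
    then have "grass_dist scale D y z = D - dim (y \<inter> U)"
      using grass_dist_eq[OF y hyp(1)[OF z(1)] D] by simp
    then show ?thesis using z by force
  qed
qed simp

text \<open>For two members x, y, either every member contains U = x \<inter> y or every member lies
  in V = x + y. The size [N-D+1] then gives equality with all covers of U in the first case; in the
  second it is at most [D+1], which forces N = 2D and equality with all hyperplanes of V.\<close>

lemma delsarte_clique_cases:
  assumes C: "delsarte_clique scale q N D C" and dimN: "dim UNIV = N" and D: "D \<ge> 2" "2 * D \<le> N"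
  obtains (bottom) U where "subspace U" "Suc (dim U) = D" "C = covers U"
  | (top) U where "N = 2 * D" "subspace U" "dim U = Suc D" "C = hyps U"
proof -
  have CX: "C \<subseteq> grass_verts scale D"
    and adj: "\<And>y z. y \<in> C \<Longrightarrow> z \<in> C \<Longrightarrow> y \<noteq> z \<Longrightarrow> (y, z) \<in> grass_edges scale D"
    and card: "real (card C) = qnum q (N - D + 1)"
    using C by (auto simp: delsarte_clique_def)
  have mem: "subspace z" "dim z = D" if "z \<in> C" for z using CX that by (auto simp: mem_grass_verts)
  have adj': "dim (y \<inter> z) = D - 1" if "y \<in> C" "z \<in> C" "y \<noteq> z" for y z
    using adj[OF that] by (auto simp: grass_edges_def)
  have "real (card C) > 1"
    using qnum_le_iff[OF q_gt_1, of "N - D + 1" 1] D q_gt_1 unfolding card by (simp add: not_le [symmetric])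
  then have "card C > 1" by simp
  then obtain x y where xy: "x \<in> C" "y \<in> C" "x \<noteq> y"
    by (metis card_le_Suc0_iff_eq finite_sets not_le One_nat_def)
  define U where "U = x \<inter> y"
  have U: "subspace U" "Suc (dim U) = D"
    using xy mem adj' D by (auto simp: U_def subspace_inter)
  show ?thesis
  proof (cases "\<forall>z\<in>C. U \<subseteq> z")
    case True
    then have "C \<subseteq> covers U" using mem U by (auto simp: covers_def)
    moreover have "real (card (covers U)) = qnum q (N - D + 1)"
    proof -
      have "dim UNIV - dim U = N - D + 1" using dimN U D by auto
      then show ?thesis using card_covers_within[OF U(1) subspace_UNIV] by (simp add: covers_def)
    qed
    ultimately have "C = covers U" using card by (intro card_subset_eq) auto
    then show ?thesis using bottom U by blast
  next
    case False
    then obtain z where z: "z \<in> C" "\<not> U \<subseteq> z" by blast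
    define V where "V = span (x \<union> y)"
    have V: "subspace V" "x \<subseteq> V" "y \<subseteq> V"
      using span_superset[of "x \<union> y"] by (auto simp: V_def)
    have dV: "dim V = Suc D"
      using dim_Un_Int[of x y] xy mem U by (simp add: V_def U_def)
    \<comment> \<open>The intersections of z with x and with y are two distinct hyperplanes of z,
      since a common one would be U. They generate z.\<close>
    have A: "z \<subseteq> V" if z: "z \<in> C" "\<not> U \<subseteq> z" for z
    proof -
      have ne: "z \<noteq> x" "z \<noteq> y" using z by (auto simp: U_def)
      have sub: "subspace (z \<inter> x)" "subspace (z \<inter> y)" using mem xy z by (auto simp: subspace_inter)
      have dx: "dim (z \<inter> x) = D - 1" using adj' z xy ne by auto
      have "\<not> z \<inter> x \<subseteq> U"
      proof
        assume "z \<inter> x \<subseteq> U"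
        then have "z \<inter> x = U" using dx U sub by (intro subspace_eqI) auto
        then show False using z by auto
      qed
      then have n: "\<not> z \<inter> y \<subseteq> z \<inter> x"
        using subspace_eqI[OF sub(2,1)] adj' z xy ne dx by (auto simp: U_def)
      let ?W = "span ((z \<inter> x) \<union> (z \<inter> y))"
      have W: "?W \<subseteq> z" using mem z by (intro span_minimal) auto
      have "z \<inter> x \<subset> ?W" using n span_superset[of "(z \<inter> x) \<union> (z \<inter> y)"] by auto
      then have "dim (z \<inter> x) < dim ?W" using sub by (intro dim_psubset_subspace) auto
      moreover have "dim ?W \<le> dim z" using W by (rule dim_subset)
      ultimately have "dim ?W = dim z" using dx mem z U by (simp del: dim_span)
      then have "?W = z" using W mem z by (intro subspace_eqI) auto
      moreover have "?W \<subseteq> V" using V by (intro span_minimal) auto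
      ultimately show ?thesis by simp
    qed
    \<comment> \<open>If w left V, it would meet V exactly in U, so z \<inter> w would lie in U and
      equal it by dimension, against the choice of z.\<close>
    have B: "w \<subseteq> V" if w: "w \<in> C" "U \<subseteq> w" for w
    proof (rule ccontr)
      assume n: "\<not> w \<subseteq> V"
      have sub: "subspace (w \<inter> V)" using mem w V by (simp add: subspace_inter)
      have "w \<inter> V \<subset> w" using n by auto
      then have "dim (w \<inter> V) < D" using dim_psubset_subspace[OF sub, of w] mem w by auto
      moreover have UW: "U \<subseteq> w \<inter> V" using w V by (auto simp: U_def)
      then have "dim U \<le> dim (w \<inter> V)" by (rule dim_subset)
      ultimately have "U = w \<inter> V" using UW U sub by (intro subspace_eqI) auto
      then have zw: "z \<inter> w \<subseteq> U" using A z by auto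
      have "z \<noteq> w" using z w by auto
      then have "dim (z \<inter> w) = dim U" using adj' z w U by auto
      then have "z \<inter> w = U" using zw U mem z w by (intro subspace_eqI) (auto simp: subspace_inter)
      then show False using z by auto
    qed
    have "w \<subseteq> V" if "w \<in> C" for w using A B that by blast
    then have sub: "C \<subseteq> hyps V" unfolding hyps_def using mem dV by simp blast
    have cV: "real (card (hyps V)) = qnum q (D + 1)"
    proof -
      have "{s \<in> hyps V. {0} \<subseteq> s} = hyps V" by (auto simp: hyps_def subspace_0)
      then show ?thesis
        using card_hyps_containing[of "{0}" V] V dV by (simp add: subspace_0 subspace_single_0)
    qed
    have "real (card C) \<le> real (card (hyps V))" using card_mono[OF finite_sets sub] by simp
    then have "N = 2 * D" using D unfolding card cV by (simp add: qnum_le_iff[OF q_gt_1])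
    moreover from this have "C = hyps V" using card cV D sub by (intro card_subset_eq) auto
    ultimately show ?thesis using top V dV by blast
  qed
qed

end

proposition clique_cells:
  fixes sc :: "'k::{field,finite} \<Rightarrow> 'v::ab_group_add \<Rightarrow> 'v"
  assumes vs: "vector_space sc" and q: "CARD('k) = q"
    and N: "vector_space.dim sc (UNIV :: 'v set) = N"
    and D: "D \<ge> 3" "N \<ge> 2 * D"
    and C: "delsarte_clique sc q N D C" and x: "x \<in> C"
  obtains cls :: "'v set \<Rightarrow> pm \<times> nat" where
    "finite (grass_verts sc D)" "q > 1"
    "\<And>\<sigma> i. Cpm sc D C x \<sigma> i = {y \<in> grass_verts sc D. cls y = (\<sigma>, i)}"
    "\<And>y. y \<in> grass_verts sc D \<Longrightarrow> snd (cls y) < D"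
    "\<And>y. y \<in> grass_verts sc D \<Longrightarrow> cls y = (Minus, 0) \<longleftrightarrow> y = x"
    "x \<in> grass_verts sc D"
    "\<And>F y. y \<in> grass_verts sc D \<Longrightarrow>
       (\<Sum>z | z \<in> grass_verts sc D \<and> (y, z) \<in> grass_edges sc D. F (fst (cls z)) (snd (cls z)))
         = clique_quot q N D F (fst (cls y)) (snd (cls y))"
proof -
  interpret vector_space sc by fact
  \<comment> \<open>An infinite-dimensional space has \<open>dim\<close> 0, so N > 0 yields a finite
    basis.\<close>
  have "N \<noteq> 0" using D by auto
  then obtain b where b: "independent b \<and> span b = span (UNIV :: 'v set)"
    using N unfolding dim_def by (auto split: if_splits)
  then have "card b = N" using dim_eq_card[of b UNIV] N by auto
  then have "finite b" using \<open>N \<noteq> 0\<close> by (metis card.infinite)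
  interpret finite_vs sc b q
    by unfold_locales (use b \<open>finite b\<close> q in auto)
  let ?X = "grass_verts sc D"
  have D0: "D > 0" "D \<ge> 2" using D by auto
  have xX: "x \<in> ?X" using C x by (auto simp: delsarte_clique_def)
  have x': "subspace x" "dim x = D" using xX by (auto simp: mem_grass_verts)
  have cell0: "cls y = (Minus, 0) \<longleftrightarrow> y = x"
    if "\<And>\<sigma> i. Cpm sc D C x \<sigma> i = {y \<in> ?X. cls y = (\<sigma>, i)}" "y \<in> ?X" for cls y
  proof -
    have "Min ((\<lambda>z. grass_dist sc D x z) ` C) = 0"
      using x grass_dist_eq[OF xX xX D0(1)] x'
      by (intro Min_eqI) (auto intro!: image_eqI[of _ _ x])
    moreover have "grass_dist sc D x y = 0 \<longleftrightarrow> y = x"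
      using dim_Int_less[OF xX that(2)] grass_dist_eq[OF xX that(2) D0(1)] x' by (cases "y = x") auto
    ultimately have "y \<in> Cpm sc D C x Minus 0 \<longleftrightarrow> y = x"
      using that(2) by (auto simp: Cset_def)
    then show ?thesis unfolding that(1) using that(2) by blast
  qed
  from C N D0(2) D(2) show ?thesis
  proof (cases rule: delsarte_clique_cases)
    case (bottom U)
    have Ux: "U \<subseteq> x" using x bottom by (auto simp: covers_def)
    interpret flag_vs sc b q U x "D - 1" N
      by unfold_locales (use bottom Ux x' N D in auto)
    define cls where "cls = (\<lambda>y. (if top_gap y then Minus else Plus, D - 1 - lev y))"
    have lev: "lev y \<le> D - 1" for y
      using dim_subset[of "y \<inter> U" U] bottom by (auto simp: lev_def)
    have cell: "Cpm sc D C x \<sigma> i = {y \<in> ?X. cls y = (\<sigma>, i)}" for \<sigma> i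
    proof -
      have "y \<in> Cpm sc D C x \<sigma> i \<longleftrightarrow> cls y = (\<sigma>, i)" if y: "y \<in> ?X" for y
      proof -
        have "dim (x \<inter> y) = lev y + (if top_gap y then 1 else 0)"
          using dim_Int_T[of y] y by (simp add: Int_commute mem_grass_verts)
        then have "grass_dist sc D x y = D - (lev y + (if top_gap y then 1 else 0))"
          using grass_dist_eq[OF xX y D0(1)] by simp
        then show ?thesis
          using y lev[of y] D0 dist_clique_covers[OF bottom(1,2) y] bottom(3)
          by (cases \<sigma>) (auto simp: Cset_def cls_def lev_def)
      qed
      moreover have "Cpm sc D C x \<sigma> i \<subseteq> ?X" by (cases \<sigma>) (auto simp: Cset_def)
      ultimately show ?thesis by blast
    qed
    have quot: "(\<Sum>z | z \<in> ?X \<and> (y, z) \<in> grass_edges sc D. F (fst (cls z)) (snd (cls z)))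
         = clique_quot q N D F (fst (cls y)) (snd (cls y))" if y: "y \<in> ?X" for F y
      using adj_sum[OF y, where F = "\<lambda>j b. F (if b then Minus else Plus) (D - 1 - j)"]
        down_up_bottom_flag[of D "lev y" F "top_gap y"] D lev[of y]
      by (simp add: cls_def)
    show ?thesis
      using that[of cls] q_gt_1 cell cell0[OF cell] xX quot D0 by (simp add: cls_def)
  next
    case (top U)
    have xU: "x \<subseteq> U" using x top by (auto simp: hyps_def)
    interpret flag_vs sc b q x U D N
      by unfold_locales (use top xU x' N D in auto)
    define cls where "cls = (\<lambda>y. (if top_gap y then Plus else Minus,
        if top_gap y then D - 1 - lev y else D - lev y))"
    \<comment> \<open>The second bound holds because y and U have total dimension 2D + 1 > N and so
      cannot meet trivially.\<close>
    have lev: "lev y + (if top_gap y then 1 else 0) \<le> D" "top_gap y \<or> 0 < lev y" if y: "y \<in> ?X" for y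
    proof -
      have U: "dim (y \<inter> U) = lev y + (if top_gap y then 1 else 0)"
        using dim_Int_T[of y] y by (simp add: mem_grass_verts)
      have le: "dim (y \<inter> U) \<le> dim y" by (intro dim_subset) auto
      have sum: "dim (y \<union> U) + dim (y \<inter> U) = dim y + dim U"
        using y top by (intro dim_Un_Int) (auto simp: mem_grass_verts)
      have N': "dim (y \<union> U) \<le> N" using dim_subset[of "y \<union> U" UNIV] N by simp
      have dy: "dim y = D" using y by (simp add: mem_grass_verts)
      show "lev y + (if top_gap y then 1 else 0) \<le> D" using U le dy by linarith
      show "top_gap y \<or> 0 < lev y"
      proof (rule ccontr)
        assume "\<not> (top_gap y \<or> 0 < lev y)"
        then have "lev y + (if top_gap y then 1 else 0) = 0" by simp
        then show False using U sum N' dy top(1,3) by linarith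
      qed
    qed
    have cell: "Cpm sc D C x \<sigma> i = {y \<in> ?X. cls y = (\<sigma>, i)}" for \<sigma> i
    proof -
      have "y \<in> Cpm sc D C x \<sigma> i \<longleftrightarrow> cls y = (\<sigma>, i)" if y: "y \<in> ?X" for y
      proof -
        have "dim (y \<inter> U) = lev y + (if top_gap y then 1 else 0)"
          using dim_Int_T[of y] y by (simp add: mem_grass_verts)
        moreover have "grass_dist sc D x y = D - lev y"
          using grass_dist_eq[OF xX y D0(1)] by (simp add: lev_def Int_commute)
        ultimately show ?thesis
          using y lev[OF y] D0 dist_clique_hyps[OF top(2,3) y] top(4)
          by (cases \<sigma>) (auto simp: Cset_def cls_def)
      qed
      moreover have "Cpm sc D C x \<sigma> i \<subseteq> ?X" by (cases \<sigma>) (auto simp: Cset_def)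
      ultimately show ?thesis by blast
    qed
    have quot: "(\<Sum>z | z \<in> ?X \<and> (y, z) \<in> grass_edges sc D. F (fst (cls z)) (snd (cls z)))
         = clique_quot q N D F (fst (cls y)) (snd (cls y))" if y: "y \<in> ?X" for F y
      using adj_sum[OF y, where F = "\<lambda>j b. F (if b then Plus else Minus) (if b then D - 1 - j else D - j)"]
        down_up_top_flag[of D "top_gap y" "lev y" F] D top lev[OF y]
      by (auto simp add: cls_def)
    have "snd (cls y) < D" if "y \<in> ?X" for y using lev[OF that] D0 by (auto simp: cls_def)
    then show ?thesis
      using that[of cls] q_gt_1 cell cell0[OF cell] xX quot by simp
  qed
qed

section \<open>Sizes of the cells\<close>

declare Cpm.simps [simp del]

text \<open>The interface that hides the geometry: from here on a vertex enters through its label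
  \<open>cls\<close>, and both kinds of cliques are treated at once.\<close>

locale delsarte_cells =
  fixes sc :: "'k::{field,finite} \<Rightarrow> 'v::ab_group_add \<Rightarrow> 'v" and q N D :: nat
    and C :: "'v set set" and x :: "'v set" and cls :: "'v set \<Rightarrow> pm \<times> nat"
  assumes finX: "finite (grass_verts sc D)" and q1: "q > 1" and D3: "D \<ge> 3" and DN: "2 * D \<le> N"
    and cell: "\<And>\<sigma> i. Cpm sc D C x \<sigma> i = {y \<in> grass_verts sc D. cls y = (\<sigma>, i)}"
    and cls_less: "\<And>y. y \<in> grass_verts sc D \<Longrightarrow> snd (cls y) < D"
    and cls_base: "\<And>y. y \<in> grass_verts sc D \<Longrightarrow> cls y = (Minus, 0) \<longleftrightarrow> y = x"
    and xX: "x \<in> grass_verts sc D"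
    and quot: "\<And>F y. y \<in> grass_verts sc D \<Longrightarrow>
       (\<Sum>z | z \<in> grass_verts sc D \<and> (y, z) \<in> grass_edges sc D. F (fst (cls z)) (snd (cls z)))
         = clique_quot q N D F (fst (cls y)) (snd (cls y))"
begin

abbreviation X :: "'v set set" where "X \<equiv> grass_verts sc D"
abbreviation R :: "('v set \<times> 'v set) set" where "R \<equiv> grass_edges sc D"
abbreviation Q :: complex where "Q \<equiv> of_nat q"
abbreviation t :: complex where "t \<equiv> tau q N"
abbreviation cells :: "pm \<Rightarrow> nat \<Rightarrow> 'v set set" where "cells \<equiv> Cpm sc D C x"
abbreviation csize :: "pm \<Rightarrow> nat \<Rightarrow> real" where "csize \<sigma> i \<equiv> real (card (cells \<sigma> i))"

lemma R_sym: "(y, z) \<in> R \<longleftrightarrow> (z, y) \<in> R"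
  by (auto simp: grass_edges_def Int_commute)

definition Adj :: "('v set \<Rightarrow> complex) \<Rightarrow> 'v set \<Rightarrow> complex" where
  "Adj f y = (\<Sum>z\<in>X. adj_matrix R y z * f z)"

lemma Adj_eq: "Adj f y = (\<Sum>z | z \<in> X \<and> (y, z) \<in> R. f z)"
  unfolding Adj_def adj_matrix_def using finX
  by (subst sum.inter_filter) (auto intro: sum.cong)

definition cellfun :: "(pm \<Rightarrow> nat \<Rightarrow> complex) \<Rightarrow> 'v set \<Rightarrow> complex" where
  "cellfun F y = (if y \<in> X then F (fst (cls y)) (snd (cls y)) else 0)"

lemma Adj_cellfun:
  assumes "y \<in> X"
  shows "Adj (cellfun F) y = clique_quot q N D F (fst (cls y)) (snd (cls y))"
  unfolding Adj_eq quot[OF assms, symmetric] by (intro sum.cong) (auto simp: cellfun_def)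

lemma charvec_cell: "charvec (cells \<sigma> i) = cellfun (\<lambda>\<sigma>' j. if \<sigma>' = \<sigma> \<and> j = i then 1 else 0)"
  by (rule ext) (auto simp: charvec_def cellfun_def cell prod_eq_iff)

lemma Adj_sym: "(\<Sum>y\<in>X. g y * Adj f y) = (\<Sum>y\<in>X. f y * Adj g y)"
proof -
  have "(\<Sum>y\<in>X. g y * Adj f y) = (\<Sum>y\<in>X. \<Sum>z\<in>X. g y * adj_matrix R y z * f z)"
    by (simp add: Adj_def sum_distrib_left mult.assoc)
  also have "\<dots> = (\<Sum>z\<in>X. \<Sum>y\<in>X. g y * adj_matrix R y z * f z)" by (rule sum.swap)
  also have "\<dots> = (\<Sum>z\<in>X. f z * Adj g z)"
    unfolding Adj_def sum_distrib_left
    by (intro sum.cong refl) (simp add: adj_matrix_def R_sym)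
  finally show ?thesis .
qed

text \<open>The edges between two cells are counted from either side. The count is read off from
  symmetry of the adjacency operator applied to the two characteristic vectors.\<close>

lemma cell_balance:
  assumes "clique_quot q N D (\<lambda>\<sigma>' j. if \<sigma>' = \<nu> \<and> j = l then 1 else 0) \<sigma> i = of_real a"
    and "clique_quot q N D (\<lambda>\<sigma>' j. if \<sigma>' = \<sigma> \<and> j = i then 1 else 0) \<nu> l = of_real b"
  shows "csize \<sigma> i * a = csize \<nu> l * b"
proof -
  have half: "(\<Sum>y\<in>X. charvec (cells \<sigma> i) y * Adj (charvec (cells \<nu> l)) y)
      = of_nat (card (cells \<sigma> i)) * clique_quot q N D (\<lambda>\<sigma>' j. if \<sigma>' = \<nu> \<and> j = l then 1 else 0) \<sigma> i"
    for \<sigma> i \<nu> l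
  proof -
    have "(\<Sum>y\<in>X. charvec (cells \<sigma> i) y * Adj (charvec (cells \<nu> l)) y)
      = (\<Sum>y\<in>X. if cls y = (\<sigma>, i) then clique_quot q N D (\<lambda>\<sigma>' j. if \<sigma>' = \<nu> \<and> j = l then 1 else 0) \<sigma> i else 0)"
      by (intro sum.cong refl) (auto simp: charvec_cell Adj_cellfun cellfun_def[of _ "_ :: 'v set"] prod_eq_iff)
    then show ?thesis using finX by (simp add: sum.inter_filter [symmetric] cell)
  qed
  have "of_nat (card (cells \<sigma> i)) * complex_of_real a = of_nat (card (cells \<nu> l)) * complex_of_real b"
    using half[of \<sigma> i \<nu> l] half[of \<nu> l \<sigma> i] Adj_sym unfolding assms by metis
  then have "complex_of_real (csize \<sigma> i * a) = complex_of_real (csize \<nu> l * b)"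
    by simp
  then show ?thesis by (rule of_real_eq_iff [THEN iffD1])
qed

lemma qnum_pos: "n > 0 \<Longrightarrow> qnum q n > 0"
  using q1 one_less_power[of "real q" n] by (simp add: qnum_def)

text \<open>Consecutive members of the chain C_0^-, C_0^+, C_1^-, C_1^+, ... are joined by edges, so
  balancing these determines each size from the one before. This is the step from C_i^- to
  C_i^+.\<close>

lemma card_Plus:
  assumes "i < D"
  shows "csize Plus i * qnum q (i + 1)
    = csize Minus i * (real q ^ (i + 1) * qnum q (N - D - i))"
proof -
  have "csize Plus i * (real q ^ i * qnum q (i + 1))
    = csize Minus i * (real q ^ (2 * i + 1) * qnum q (N - D - i))"
    by (rule cell_balance) (cases i; auto simp: Let_def)+
  moreover have "real q ^ (2 * i + 1) = real q ^ i * real q ^ (i + 1)"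
    by (simp only: power_add [symmetric]) (simp add: mult_2)
  ultimately have "real q ^ i * (csize Plus i * qnum q (i + 1))
    = real q ^ i * (csize Minus i * (real q ^ (i + 1) * qnum q (N - D - i)))"
    by (simp only: mult_ac)
  then show ?thesis using q1 by simp
qed

lemma card_Minus_Suc:
  shows "csize Minus (Suc i) * qnum q (i + 1)
    = csize Plus i * (real q ^ (i + 1) * qnum q (D - 1 - i))"
proof -
  have "csize Minus (Suc i) * (real q ^ (i + 1) * qnum q (i + 1))
    = csize Plus i * (real q ^ (2 * i + 2) * qnum q (D - 1 - i))"
    by (rule cell_balance) (cases i; auto simp: Let_def)+
  moreover have "real q ^ (2 * i + 2) = real q ^ (i + 1) * real q ^ (i + 1)"
    by (simp only: power_add [symmetric]) (simp add: mult_2)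
  ultimately have "real q ^ (i + 1) * (csize Minus (Suc i) * qnum q (i + 1))
    = real q ^ (i + 1) * (csize Plus i * (real q ^ (i + 1) * qnum q (D - 1 - i)))"
    by (simp only: mult_ac)
  then show ?thesis using q1 by simp
qed

lemma card_Minus_0: "card (cells Minus 0) = 1"
proof -
  have "cells Minus 0 = {x}" using cls_base xX by (auto simp only: cell)
  then show ?thesis by simp
qed

lemma card_cells_rec:
  assumes "i < D"
  shows "csize Plus i
      = csize Minus i * (real q ^ (i + 1) * (real q ^ (N - D - i) - 1) / (real q ^ (i + 1) - 1))"
    and "csize Minus (Suc i)
      = csize Plus i * (real q ^ (i + 1) * (real q ^ (D - 1 - i) - 1) / (real q ^ (i + 1) - 1))"
proof -
  have nz: "real q ^ (i + 1) - 1 \<noteq> 0" "real q - 1 \<noteq> 0"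
    using q1 one_less_power[of "real q" "i + 1"] by auto
  have main: "b = c * (r * m / n)" if "b * qnum q (i + 1) = c * (r * (m / (real q - 1)))"
    "n = real q ^ (i + 1) - 1" for b c r m n :: real
  proof -
    have "b * n / (real q - 1) = c * (r * m) / (real q - 1)"
      using that by (simp add: qnum_def)
    then have "b * n = c * (r * m)" using nz by simp
    then show ?thesis using nz that(2) by (simp add: eq_divide_eq)
  qed
  show "csize Plus i
      = csize Minus i * (real q ^ (i + 1) * (real q ^ (N - D - i) - 1) / (real q ^ (i + 1) - 1))"
    by (rule main[OF _ refl]) (use card_Plus[OF assms] in \<open>simp add: qnum_def\<close>)
  show "csize Minus (Suc i)
      = csize Plus i * (real q ^ (i + 1) * (real q ^ (D - 1 - i) - 1) / (real q ^ (i + 1) - 1))"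
    by (rule main[OF _ refl]) (use card_Minus_Suc[of i] in \<open>simp add: qnum_def\<close>)
qed

lemma card_cell_Minus:
  "i < D \<Longrightarrow> csize Minus i = real q ^ (i * (i + 1))
     * (\<Prod>h = 1..i. (real q ^ (D - h) - 1) * (real q ^ (N - D + 1 - h) - 1) / (real q ^ h - 1)\<^sup>2)"
proof (induction i)
  case 0
  show ?case using card_Minus_0 by simp
next
  case (Suc i)
  then have i: "i < D" by simp
  have e: "N - D + 1 - Suc i = N - D - i" "D - 1 - i = D - Suc i" by simp_all
  have p: "real q ^ (Suc i * (Suc i + 1)) = real q ^ (i * (i + 1)) * (real q ^ Suc i * real q ^ Suc i)"
    by (simp only: power_add [symmetric]) (simp add: algebra_simps)
  have "csize Minus (Suc i) = csize Minus i
      * (real q ^ (i + 1) * (real q ^ (N - D - i) - 1) / (real q ^ (i + 1) - 1))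
      * (real q ^ (i + 1) * (real q ^ (D - Suc i) - 1) / (real q ^ (i + 1) - 1))"
    using card_cells_rec[OF i] by (simp only: e)
  also have "\<dots> = real q ^ (i * (i + 1)) * (real q ^ Suc i * real q ^ Suc i)
     * ((\<Prod>h = 1..i. (real q ^ (D - h) - 1) * (real q ^ (N - D + 1 - h) - 1) / (real q ^ h - 1)\<^sup>2)
       * ((real q ^ (D - Suc i) - 1) * (real q ^ (N - D - i) - 1) / (real q ^ Suc i - 1)\<^sup>2))"
    unfolding Suc.IH[OF i] by (simp add: power2_eq_square)
  finally show ?case unfolding p by (simp only: prod.nat_ivl_Suc' e)
     (simp add: mult_ac)
qed

lemma card_cell_Plus:
  "i < D \<Longrightarrow> csize Plus i = real q ^ ((i + 1)\<^sup>2) * (real q ^ (N - D) - 1) / (real q - 1)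
     * (\<Prod>h = 1..i. (real q ^ (D - h) - 1) * (real q ^ (N - D - h) - 1) / ((real q ^ h - 1) * (real q ^ (h + 1) - 1)))"
proof (induction i)
  case 0
  then show ?case using card_cells_rec(1)[of 0] card_Minus_0 by simp
next
  case (Suc i)
  then have i: "i < D" by simp
  have e: "D - 1 - i = D - Suc i" by simp
  have p: "real q ^ ((Suc i + 1)\<^sup>2) = real q ^ ((i + 1)\<^sup>2) * (real q ^ (i + 1) * real q ^ (Suc i + 1))"
    by (simp only: power_add [symmetric]) (simp add: algebra_simps power2_eq_square)
  have "csize Plus (Suc i) = csize Plus i
      * (real q ^ (i + 1) * (real q ^ (D - Suc i) - 1) / (real q ^ (i + 1) - 1))
      * (real q ^ (Suc i + 1) * (real q ^ (N - D - Suc i) - 1) / (real q ^ (Suc i + 1) - 1))"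
    using card_cells_rec(1)[OF Suc.prems] card_cells_rec(2)[OF i] by (simp only: e)
  also have "\<dots> = real q ^ ((i + 1)\<^sup>2) * (real q ^ (i + 1) * real q ^ (Suc i + 1)) * (real q ^ (N - D) - 1) / (real q - 1)
     * ((\<Prod>h = 1..i. (real q ^ (D - h) - 1) * (real q ^ (N - D - h) - 1) / ((real q ^ h - 1) * (real q ^ (h + 1) - 1)))
       * ((real q ^ (D - Suc i) - 1) * (real q ^ (N - D - Suc i) - 1) / ((real q ^ Suc i - 1) * (real q ^ (Suc i + 1) - 1))))"
    unfolding Suc.IH[OF i] by (simp add: mult_ac)
  finally show ?case unfolding p by (simp only: prod.nat_ivl_Suc') (simp add: mult_ac)
qed

text \<open>Needed to separate the ell: their inner products with themselves are these
  cardinalities.\<close>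

lemma card_cell_pos: "i < D \<Longrightarrow> card (cells \<sigma> i) > 0"
proof -
  have M: "card (cells Minus i) > 0 \<and> card (cells Plus i) > 0" if "i < D" for i
    using that
  proof (induction i)
    case 0
    have "csize Plus 0 * qnum q (0 + 1) > 0"
      unfolding card_Plus[OF 0] card_Minus_0 using q1 qnum_pos[of "N - D - 0"] 0 DN by simp
    then show ?case using card_Minus_0 by (cases "card (cells Plus 0) = 0") auto
  next
    case (Suc i)
    then have IH: "card (cells Plus i) > 0" by simp
    have "csize Minus (Suc i) * qnum q (i + 1) > 0"
      unfolding card_Minus_Suc using q1 qnum_pos[of "D - 1 - i"] Suc.prems IH by simp
    then have M: "card (cells Minus (Suc i)) > 0"
      by (cases "card (cells Minus (Suc i)) = 0") auto
    have "csize Plus (Suc i) * qnum q (Suc i + 1) > 0"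
      unfolding card_Plus[OF Suc.prems] using q1 qnum_pos[of "N - D - Suc i"] Suc.prems DN M by simp
    then show ?case using M by (cases "card (cells Plus (Suc i)) = 0") auto
  qed
  then show "i < D \<Longrightarrow> card (cells \<sigma> i) > 0" by (cases \<sigma>) auto
qed

end

section \<open>The adjacency operator on the cells\<close>

lemma tau_power2: "q > 0 \<Longrightarrow> (tau q N)\<^sup>2 * of_nat q ^ (N + 1) = 1"
proof -
  assume q: "q > 0"
  have "(real q powr ((- real N - 1) / 2))\<^sup>2 = real q powr (- real N - 1)"
    using q by (simp add: power2_eq_square powr_add [symmetric])
  also have "real q powr (- real N - 1) = 1 / real q ^ (N + 1)"
  proof -
    have n: "- real N - 1 = - real (N + 1)" by simp
    show ?thesis unfolding n powr_minus
      using q by (simp add: powr_realpow divide_inverse del: of_nat_Suc of_nat_add)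
  qed
  finally have e: "(real q powr ((- real N - 1) / 2))\<^sup>2 = 1 / real q ^ (N + 1)" .
  have "(real q powr ((- real N - 1) / 2))\<^sup>2 * real q ^ (N + 1) = 1" unfolding e using q by simp
  then have "complex_of_real ((real q powr ((- real N - 1) / 2))\<^sup>2 * real q ^ (N + 1)) = 1" by simp
  then show ?thesis by (simp add: tau_def)
qed

text \<open>The weights \<alpha> on C_m^- and \<beta> on C_{m-1}^+, the common shape of both
  families of vectors. \<open>Suc j = m\<close> is used so that m = 0 has no Plus part.\<close>

definition two_cells :: "nat \<Rightarrow> complex \<Rightarrow> complex \<Rightarrow> pm \<Rightarrow> nat \<Rightarrow> complex" where
  "two_cells m \<alpha> \<beta> \<sigma> j = (case \<sigma> of Minus \<Rightarrow> if j = m then \<alpha> else 0 | Plus \<Rightarrow> if Suc j = m then \<beta> else 0)"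

text \<open>
  For the cells with index \<open>j\<close>, all entries of the quotient matrix are polynomials in \<open>Q = q\<close>, \<open>P = q\<^sup>j\<close>,
  \<open>X = q\<^sup>D\<^sup>-\<^sup>1\<^sup>-\<^sup>j\<close> and \<open>Y = q\<^sup>N\<^sup>-\<^sup>D\<^sup>-\<^sup>1\<^sup>-\<^sup>j\<close>, after scaling with \<open>(q - 1)\<^sup>2\<close> and a shift which makes
  \<open>\<lambda>\<^sub>k + \<lambda>\<^sub>k\<^sup>-\<^sup>1\<close> the \<open>k\<close>-th eigenvalue up to the factor \<open>\<tau>\<close>.
\<close>

definition diag_Minus :: "complex \<Rightarrow> complex \<Rightarrow> complex \<Rightarrow> complex \<Rightarrow> complex" where
  "diag_Minus Q P X Y = Q ^ 3 * P\<^sup>2 * X * Y + 1 - ((P - 1)\<^sup>2 + (Q - 1) * P * (P - 1)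
     + (Q - 1) * Q * P\<^sup>2 * (Q * Y - 1) + Q\<^sup>2 * P\<^sup>2 * (X - 1) * (Q * Y - 1))"

definition diag_Plus :: "complex \<Rightarrow> complex \<Rightarrow> complex \<Rightarrow> complex \<Rightarrow> complex" where
  "diag_Plus Q P X Y = Q ^ 3 * P\<^sup>2 * X * Y + 1 - ((P - 1) * (Q * P - 1) + (Q - 1) * P * (Q * P - 1)
     + (Q - 1) * Q\<^sup>2 * P\<^sup>2 * (X - 1) + Q ^ 3 * P\<^sup>2 * (X - 1) * (Y - 1))"

definition scaled_quot :: "complex \<Rightarrow> complex \<Rightarrow> complex \<Rightarrow> complex \<Rightarrow> (pm \<Rightarrow> nat \<Rightarrow> complex)
    \<Rightarrow> pm \<Rightarrow> nat \<Rightarrow> complex" where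
  "scaled_quot Q P X Y F \<sigma> j = (case \<sigma> of
      Minus \<Rightarrow> (P - 1)\<^sup>2 * F Minus (j - 1) + (Q - 1) * P * (P - 1) * F Plus (j - 1)
        + (Q - 1) * Q * P\<^sup>2 * (Q * Y - 1) * F Plus j
        + Q\<^sup>2 * P\<^sup>2 * (X - 1) * (Q * Y - 1) * F Minus (j + 1) + diag_Minus Q P X Y * F Minus j
    | Plus \<Rightarrow> (P - 1) * (Q * P - 1) * F Plus (j - 1) + (Q - 1) * P * (Q * P - 1) * F Minus j
        + (Q - 1) * Q\<^sup>2 * P\<^sup>2 * (X - 1) * F Minus (j + 1)
        + Q ^ 3 * P\<^sup>2 * (X - 1) * (Y - 1) * F Plus (j + 1) + diag_Plus Q P X Y * F Plus j)"

text \<open>The assumption on P removes the terms with the truncated index j - 1 at j = 0, since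
  their coefficients contain P - 1.\<close>

lemma scaled_quot_two_cells:
  assumes "j = 0 \<longrightarrow> P = 1"
  shows "scaled_quot Q P X Y (\<lambda>\<sigma> j. s * two_cells m \<alpha> \<beta> \<sigma> j) Minus j
      = s * (if j = Suc m then (P - 1)\<^sup>2 * \<alpha>
         else if j = m then (Q - 1) * P * (P - 1) * \<beta> + diag_Minus Q P X Y * \<alpha>
         else if m = Suc j then (Q - 1) * Q * P\<^sup>2 * (Q * Y - 1) * \<beta> + Q\<^sup>2 * P\<^sup>2 * (X - 1) * (Q * Y - 1) * \<alpha>
         else 0)"
    and "scaled_quot Q P X Y (\<lambda>\<sigma> j. s * two_cells m \<alpha> \<beta> \<sigma> j) Plus j
      = s * (if j = m then (P - 1) * (Q * P - 1) * \<beta> + (Q - 1) * P * (Q * P - 1) * \<alpha>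
         else if m = Suc j then (Q - 1) * Q\<^sup>2 * P\<^sup>2 * (X - 1) * \<alpha> + diag_Plus Q P X Y * \<beta>
         else if m = Suc (Suc j) then Q ^ 3 * P\<^sup>2 * (X - 1) * (Y - 1) * \<beta>
         else 0)"
  using assms by (cases j; auto simp: scaled_quot_def two_cells_def algebra_simps)+

context delsarte_cells
begin

lemma Q_facts: "Q \<noteq> 0" "Q - 1 \<noteq> 0" "m > 0 \<Longrightarrow> Q ^ m \<noteq> 1"
proof -
  show "Q \<noteq> 0" "Q - 1 \<noteq> 0" using q1 by auto
  show "m > 0 \<Longrightarrow> Q ^ m \<noteq> 1"
    using q1 power_eq_1_iff[of Q m] by auto
qed

lemma t_facts: "t \<noteq> 0" "1 / t = t * Q ^ (N + 1)"
proof -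
  have *: "t\<^sup>2 * Q ^ (N + 1) = 1" using tau_power2[of q N] q1 by simp
  then show "t \<noteq> 0" by auto
  then show "1 / t = t * Q ^ (N + 1)" using * by (simp add: field_simps power2_eq_square)
qed

text \<open>The shift for which (q-1)^2 \<theta>_k + c0 = q^k + q^{N+1-k}. Multiplied by \<tau> this
  is \<lambda>_k + 1/\<lambda>_k, because 1/\<tau> = \<tau> q^{N+1}.\<close>

definition c0 :: complex where "c0 = Q ^ (D + 1) + Q ^ (N - D + 1) - Q + 1"

text \<open>The value 0 outside X matters: as no node is zero, eigenvectors of \<open>Bop\<close> at
  a node are supported on X, as \<open>cvecs\<close> demands.\<close>

definition Bop :: "('v set \<Rightarrow> complex) \<Rightarrow> 'v set \<Rightarrow> complex" where
  "Bop f y = (if y \<in> X then t * ((Q - 1)\<^sup>2 * Adj f y + c0 * f y) else 0)"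

lemma lin_op_Bop: "lin_op Bop"
  unfolding lin_op_def Bop_def Adj_def
  by (auto simp: fun_eq_iff sum.distrib sum_distrib_left algebra_simps)

lemma Bop_cellfun:
  assumes y: "y \<in> X" and j: "j = snd (cls y)"
  shows "Bop (cellfun F) y
     = t * scaled_quot Q (Q ^ j) (Q ^ (D - 1 - j)) (Q ^ (N - D - 1 - j)) F (fst (cls y)) j"
proof -
  define P XX YY where "P = Q ^ j" and "XX = Q ^ (D - 1 - j)" and "YY = Q ^ (N - D - 1 - j)"
  have jD: "j < D" using cls_less[OF y] j by simp
  have n: "complex_of_real (qnum q k) = (Q ^ k - 1) / (Q - 1)" for k by (simp add: qnum_def)
  have QD: "Q ^ D = Q * P * XX"
    using jD by (simp add: P_def XX_def mult.assoc flip: power_add power_Suc)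
  have QND: "Q ^ (N - D) = Q * P * YY" and QNDj: "Q ^ (N - D - j) = Q * YY"
    using jD DN by (simp_all add: P_def YY_def Suc_diff_Suc mult.assoc flip: power_add power_Suc)
  have c0: "c0 = Q\<^sup>2 * P * XX + Q\<^sup>2 * P * YY - Q + 1"
    by (simp add: c0_def QD QND power2_eq_square mult_ac)
  have P1: "Q ^ (j + 1) = Q * P" and P2: "Q ^ (2 * j + 1) = Q * P\<^sup>2" "Q ^ (2 * j + 2) = Q\<^sup>2 * P\<^sup>2"
    "Q ^ (2 * j + 3) = Q ^ 3 * P\<^sup>2"
    by (simp_all add: P_def power_add power_mult power2_eq_square power3_eq_cube mult_ac
        flip: power_mult_distrib)
  note facts = n P1 P2 QD QND QNDj P_def [symmetric] XX_def [symmetric] YY_def [symmetric]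
  have "(Q - 1)\<^sup>2 * clique_quot q N D F \<sigma> j + c0 * F \<sigma> j = scaled_quot Q P XX YY F \<sigma> j" for \<sigma>
    unfolding c0 scaled_quot_def diag_Minus_def diag_Plus_def
    using Q_facts(2)
    by (cases \<sigma>; simp only: clique_quot.simps Let_def facts pm.case;
        simp add: divide_simps power2_eq_square power3_eq_cube; simp add: algebra_simps)
  then show ?thesis
    using y by (simp add: Bop_def Adj_cellfun cellfun_def j P_def XX_def YY_def)
qed

section \<open>The two families of vectors and their recurrences\<close>

definition s_main :: "nat \<Rightarrow> complex" where "s_main n = t ^ n * (qpoch Q Q n)\<^sup>2"

text \<open>C_n^- and C_{n-1}^+ together form the sphere of radius n around x. The scale
  \<open>s_main\<close> gives \<open>u_main (Suc n)\<close> the coefficient 1 in the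
  recurrence.\<close>

definition u_main :: "nat \<Rightarrow> 'v set \<Rightarrow> complex" where
  "u_main n = cellfun (\<lambda>\<sigma> j. s_main n * two_cells n 1 1 \<sigma> j)"

definition s_perp :: "nat \<Rightarrow> complex" where
  "s_perp n = t ^ n * (qpoch Q Q (Suc n))\<^sup>2 / ((1 - Q ^ Suc n) * Q * (Q - 1))"

text \<open>With i = n + 1, the two weights make the vector orthogonal to the characteristic vector
  of the sphere of radius i, because (q^i - 1)|C_i^-| = (q^D - q^i)|C_{i-1}^+|. The scale makes the
  recurrence monic, and its initial value -1/q makes the sequence start with u_0^perp.\<close>

definition u_perp :: "nat \<Rightarrow> 'v set \<Rightarrow> complex" where
  "u_perp n = cellfun (\<lambda>\<sigma> j. s_perp n * two_cells (Suc n) (Q ^ Suc n - 1) (Q ^ Suc n - Q ^ D) \<sigma> j)"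

lemma s_main_Suc: "s_main (Suc n) = t * (1 - Q * Q ^ n)\<^sup>2 * s_main n"
  by (simp add: s_main_def qpoch_Suc power2_eq_square mult_ac)

lemma s_perp_Suc: "s_perp (Suc n) = t * (1 - Q * (Q * Q ^ n)) * (1 - Q * Q ^ n) * s_perp n"
proof -
  have "1 - Q * (Q * Q ^ n) \<noteq> 0" "1 - Q * Q ^ n \<noteq> 0"
    using Q_facts(3)[of "Suc (Suc n)"] Q_facts(3)[of "Suc n"] by auto
  then show ?thesis
    using Q_facts by (simp add: s_perp_def qpoch_Suc power2_eq_square divide_simps)
qed

abbreviation a_main :: complex where "a_main \<equiv> Q powi (int D - int N)"
abbreviation b_main :: complex where "b_main \<equiv> Q powi (- int D)"
abbreviation a_perp :: complex where "a_perp \<equiv> Q powi (int D - int N + 1)"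
abbreviation b_perp :: complex where "b_perp \<equiv> Q powi (2 - int D)"

lemma params:
  "a_main * Q ^ (N - D) = 1" "b_main * Q ^ D = 1"
  "a_perp = a_main * Q" "b_perp = b_main * Q\<^sup>2"
proof -
  have *: "int D - int N = - int (N - D)" using DN by simp
  show "a_main * Q ^ (N - D) = 1"
    unfolding * power_int_minus power_int_of_nat using Q_facts(1) by simp
  show "b_main * Q ^ D = 1" using Q_facts(1) by (simp add: power_int_minus)
  show "a_perp = a_main * Q" using Q_facts(1) by (simp add: power_int_add)
  have "b_perp = b_main * Q powi 2"
    using power_int_add[of Q "- int D" 2] Q_facts(1) by (simp only: simp_thms) (simp add: add.commute)
  then show "b_perp = b_main * Q\<^sup>2" by simp
qed

text \<open>The relation 1/t = t q^{N+1} removes all denominators: the quotient a b q^n / (q t^2)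
  becomes q^n, which turns C_n into a square. In the second family it becomes q^{n+1}.\<close>

lemma qhahn_params_main:
  "qhahn_A Q t a_main b_main n
     = t * (Q ^ (N + 1) - (Q ^ (D + 1) + Q ^ (N - D + 1)) * Q ^ n + Q * (Q ^ n)\<^sup>2)"
  "qhahn_C Q t a_main b_main n = t * (1 - Q ^ n)\<^sup>2"
proof -
  define d e where "d = Q ^ D" and "e = Q ^ (N - D)"
  have N: "Q ^ (N + 1) = Q * d * e"
    using DN by (simp add: d_def e_def flip: power_add mult.assoc)
  have nz: "d \<noteq> 0" "e \<noteq> 0" using Q_facts by (auto simp: d_def e_def)
  have ab: "a_main = 1 / e" "b_main = 1 / d"
    using params(1,2) nz by (auto simp: d_def e_def eq_divide_eq)
  have "1 / t = t * (Q * d * e)" using t_facts(2) N by simp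
  then have A: "qhahn_A Q t a_main b_main n = t * (Q * d * e) * ((1 - Q ^ n / e) * (1 - Q ^ n / d))"
    by (simp only: qhahn_A_def ab divide_inverse mult_ac mult_1)
  show "qhahn_A Q t a_main b_main n
     = t * (Q ^ (N + 1) - (Q ^ (D + 1) + Q ^ (N - D + 1)) * Q ^ n + Q * (Q ^ n)\<^sup>2)"
    unfolding A N unfolding power_add power_one_right d_def [symmetric] e_def [symmetric]
    using nz by (simp add: field_simps power2_eq_square)
  have "1 / (t * t) = Q * d * e"
    using t_facts N by (metis divide_divide_eq_left nonzero_mult_div_cancel_left)
  then have "a_main * b_main * Q ^ n / (Q * t\<^sup>2) = Q ^ n"
  proof -
    have "a_main * b_main * Q ^ n / (Q * t\<^sup>2) = 1 / e * (1 / d) * Q ^ n / Q * (1 / (t * t))"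
      by (simp add: ab power2_eq_square)
    also have "\<dots> = Q ^ n" unfolding \<open>1 / (t * t) = Q * d * e\<close> using nz Q_facts by simp
    finally show ?thesis .
  qed
  then show "qhahn_C Q t a_main b_main n = t * (1 - Q ^ n)\<^sup>2"
    by (simp add: qhahn_C_def power2_eq_square)
qed

lemma qhahn_params_perp:
  "qhahn_A Q (t * Q) a_perp b_perp n
     = t * (Q ^ N - (Q ^ (D + 1) + Q * Q ^ (N - D + 1)) * Q ^ n + Q ^ 3 * (Q ^ n)\<^sup>2)"
  "qhahn_C Q (t * Q) a_perp b_perp n = t * Q * (1 - Q ^ n) * (1 - Q * Q ^ n)"
proof -
  define d e where "d = Q ^ D" and "e = Q ^ (N - D)"
  have N: "Q ^ (N + 1) = Q * d * e" "Q ^ N = d * e"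
    using DN by (simp_all add: d_def e_def flip: power_add mult.assoc)
  have nz: "d \<noteq> 0" "e \<noteq> 0" using Q_facts by (auto simp: d_def e_def)
  have ab: "a_perp = Q / e" "b_perp = Q\<^sup>2 / d"
    unfolding params(3,4) using params(1,2) nz by (auto simp: d_def e_def divide_simps)
  have "1 / (t * Q) = t * (d * e)" using t_facts(2) N Q_facts t_facts(1) by (simp add: divide_simps mult_ac)
  then have A: "qhahn_A Q (t * Q) a_perp b_perp n = t * (d * e) * ((1 - Q / e * Q ^ n) * (1 - Q\<^sup>2 / d * Q ^ n))"
    by (simp only: qhahn_A_def ab divide_inverse mult_ac mult_1)
  show "qhahn_A Q (t * Q) a_perp b_perp n
     = t * (Q ^ N - (Q ^ (D + 1) + Q * Q ^ (N - D + 1)) * Q ^ n + Q ^ 3 * (Q ^ n)\<^sup>2)"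
    unfolding A N power_add power_one_right d_def [symmetric] e_def [symmetric]
    using nz by (simp add: field_simps power2_eq_square power3_eq_cube)
  have i: "1 / (t * t) = Q * d * e"
    using t_facts N by (metis divide_divide_eq_left nonzero_mult_div_cancel_left)
  have "a_perp * b_perp * Q ^ n / (Q * (t * Q)\<^sup>2) = Q * Q ^ n"
  proof -
    have "a_perp * b_perp * Q ^ n / (Q * (t * Q)\<^sup>2) = Q / e * (Q * Q / d) * Q ^ n / (Q * Q * Q) * (1 / (t * t))"
      by (simp add: ab power2_eq_square mult_ac)
    also have "\<dots> = Q * Q ^ n" unfolding i using nz Q_facts by simp
    finally show ?thesis .
  qed
  then show "qhahn_C Q (t * Q) a_perp b_perp n = t * Q * (1 - Q ^ n) * (1 - Q * Q ^ n)"
    by (simp add: qhahn_C_def)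
qed

lemma power_factors:
  assumes "j < D"
  defines "P \<equiv> Q ^ j" and "XX \<equiv> Q ^ (D - 1 - j)" and "YY \<equiv> Q ^ (N - D - 1 - j)"
  shows "Q ^ D = Q * P * XX" "Q ^ (D + 1) = Q\<^sup>2 * P * XX" "Q ^ (N - D + 1) = Q\<^sup>2 * P * YY"
    "Q ^ N = Q\<^sup>2 * P\<^sup>2 * XX * YY" "Q ^ (N + 1) = Q ^ 3 * P\<^sup>2 * XX * YY"
proof -
  have split: "Q ^ a = Q ^ b" if "a = b" for a b using that by simp
  have "Q ^ D = Q ^ (1 + j + (D - 1 - j))" using assms(1) by (intro split) linarith
  then show D: "Q ^ D = Q * P * XX" by (simp only: P_def XX_def power_add power_one_right)
  then show "Q ^ (D + 1) = Q\<^sup>2 * P * XX" by (simp add: power2_eq_square)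
  have "Q ^ (N - D + 1) = Q ^ (2 + j + (N - D - 1 - j))"
    using assms(1) DN by (intro split) linarith
  then show "Q ^ (N - D + 1) = Q\<^sup>2 * P * YY" by (simp only: P_def YY_def power_add)
  have "Q ^ N = Q ^ (2 + 2 * j + (D - 1 - j) + (N - D - 1 - j))"
    using assms(1) DN by (intro split) linarith
  then show "Q ^ N = Q\<^sup>2 * P\<^sup>2 * XX * YY" by (simp only: P_def XX_def YY_def power_add power_even_eq)
  then show "Q ^ (N + 1) = Q ^ 3 * P\<^sup>2 * XX * YY" by (simp add: power2_eq_square power3_eq_cube)
qed

text \<open>Both sides are compared on each cell. Only cells with index between n - 2 and n + 1
  contribute, and after q^n is expressed through P each case is a polynomial identity in Q, P, X,
  Y.\<close>

lemma u_main_rec: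
  assumes n: "n \<le> D"
  shows "Bop (u_main n) y = u_main (Suc n) y
      + (t + 1 / t - qhahn_A Q t a_main b_main n - qhahn_C Q t a_main b_main n) * u_main n y
      + (if n = 0 then 0 else qhahn_A Q t a_main b_main (n - 1) * qhahn_C Q t a_main b_main n * u_main (n - 1) y)"
proof (cases "y \<in> X")
  case False
  then show ?thesis by (simp add: Bop_def u_main_def cellfun_def)
next
  case True
  define j where "j = snd (cls y)"
  define P XX YY where "P = Q ^ j" and "XX = Q ^ (D - 1 - j)" and "YY = Q ^ (N - D - 1 - j)"
  have jD: "j < D" using cls_less[OF True] by (simp add: j_def)
  note QD = power_factors(2)[OF jD, folded P_def XX_def]
    and QND = power_factors(3)[OF jD, folded P_def YY_def]
    and QN = power_factors(5)[OF jD, folded P_def XX_def YY_def]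
  have P1: "j = 0 \<longrightarrow> P = 1" by (simp add: P_def)
  have B: "Bop (u_main n) y
      = t * scaled_quot Q P XX YY (\<lambda>\<sigma> j. s_main n * two_cells n 1 1 \<sigma> j) (fst (cls y)) j"
    unfolding u_main_def P_def XX_def YY_def by (rule Bop_cellfun[OF True j_def])
  have u: "u_main m y = s_main m * two_cells m 1 1 (fst (cls y)) j" for m
    using True by (simp add: u_main_def cellfun_def j_def)
  note params = qhahn_params_main t_facts(2) QD QND QN
  note expand = two_cells_def diag_Minus_def diag_Plus_def power2_eq_square power3_eq_cube
  show ?thesis
  proof (cases "fst (cls y)")
    case Minus
    consider "j = Suc n" | "j = n" | "n = Suc j" | "j \<noteq> Suc n" "j \<noteq> n" "n \<noteq> Suc j" by blast
    then show ?thesis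
    proof cases
      case 1
      have "P = Q * Q ^ n" by (simp add: P_def 1)
      then show ?thesis
        unfolding B Minus scaled_quot_two_cells(1)[OF P1] u
        by (simp add: 1 two_cells_def s_main_Suc power2_eq_square algebra_simps)
    next
      case 2
      have z: "(if n = 0 then 0 else c * (s * two_cells (n - 1) \<alpha> \<beta> Minus j)) = 0" for c s \<alpha> \<beta>
        using 2 by (auto simp: two_cells_def)
      have "Q ^ n = P" by (simp add: P_def 2)
      then show ?thesis
        unfolding B Minus scaled_quot_two_cells(1)[OF P1] u z params
        by (simp add: 2 expand) (simp add: algebra_simps)
    next
      case 3
      have "Q ^ n = Q * P" "Q ^ (n - 1) = P" by (simp_all add: P_def 3)
      then show ?thesis
        unfolding B Minus scaled_quot_two_cells(1)[OF P1] u params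
        by (simp add: 3 expand s_main_Suc P_def [symmetric]) (simp add: algebra_simps)
    next
      case 4
      then show ?thesis
        unfolding B Minus scaled_quot_two_cells(1)[OF P1] u by (simp add: two_cells_def)
    qed
  next
    case Plus
    consider "j = n" | "n = Suc j" | "n = Suc (Suc j)" | "j \<noteq> n" "n \<noteq> Suc j" "n \<noteq> Suc (Suc j)" by blast
    then show ?thesis
    proof cases
      case 1
      have "Q ^ n = P" by (simp add: P_def 1)
      then show ?thesis
        unfolding B Plus scaled_quot_two_cells(2)[OF P1] u
        by (simp add: 1 two_cells_def s_main_Suc power2_eq_square algebra_simps)
    next
      case 2
      have "Q ^ n = Q * P" by (simp add: P_def 2)
      then show ?thesis
        unfolding B Plus scaled_quot_two_cells(2)[OF P1] u params
        by (simp add: 2 expand P_def [symmetric]) (simp add: algebra_simps)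
    next
      case 3
      have "Q ^ n = Q * (Q * P)" "Q ^ (n - 1) = Q * P" by (simp_all add: P_def 3)
      then show ?thesis
        unfolding B Plus scaled_quot_two_cells(2)[OF P1] u params
        by (simp add: 3 expand s_main_Suc P_def [symmetric]) (simp add: algebra_simps)
    next
      case 4
      then show ?thesis
        unfolding B Plus scaled_quot_two_cells(2)[OF P1] u by (auto simp: two_cells_def)
    qed
  qed
qed

lemma u_perp_rec:
  assumes n: "n \<le> D - 2"
  shows "Bop (u_perp n) y = u_perp (Suc n) y
      + (t * Q + 1 / (t * Q) - qhahn_A Q (t * Q) a_perp b_perp n - qhahn_C Q (t * Q) a_perp b_perp n) * u_perp n y
      + (if n = 0 then 0 else qhahn_A Q (t * Q) a_perp b_perp (n - 1) * qhahn_C Q (t * Q) a_perp b_perp n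
           * u_perp (n - 1) y)"
proof (cases "y \<in> X")
  case False
  then show ?thesis by (simp add: Bop_def u_perp_def cellfun_def)
next
  case True
  define j where "j = snd (cls y)"
  define P XX YY where "P = Q ^ j" and "XX = Q ^ (D - 1 - j)" and "YY = Q ^ (N - D - 1 - j)"
  have jD: "j < D" using cls_less[OF True] by (simp add: j_def)
  note QD0 = power_factors(1)[OF jD, folded P_def XX_def]
    and QD = power_factors(2)[OF jD, folded P_def XX_def]
    and QND = power_factors(3)[OF jD, folded P_def YY_def]
    and QN = power_factors(4)[OF jD, folded P_def XX_def YY_def]
  have tQ: "1 / (t * Q) = t * Q ^ N"
  proof -
    have "1 / (t * Q) = 1 / t / Q" by simp
    then show ?thesis unfolding t_facts(2) using Q_facts(1) by simp
  qed
  have P1: "j = 0 \<longrightarrow> P = 1" by (simp add: P_def)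
  have B: "Bop (u_perp n) y = t * scaled_quot Q P XX YY
      (\<lambda>\<sigma> j. s_perp n * two_cells (Suc n) (Q ^ Suc n - 1) (Q ^ Suc n - Q ^ D) \<sigma> j) (fst (cls y)) j"
    unfolding u_perp_def P_def XX_def YY_def by (rule Bop_cellfun[OF True j_def])
  have u: "u_perp m y = s_perp m * two_cells (Suc m) (Q ^ Suc m - 1) (Q ^ Suc m - Q ^ D) (fst (cls y)) j" for m
    using True by (simp add: u_perp_def cellfun_def j_def)
  note params = qhahn_params_perp tQ QD QND QN
  note expand = two_cells_def diag_Minus_def diag_Plus_def power2_eq_square power3_eq_cube
  show ?thesis
  proof (cases "fst (cls y)")
    case Minus
    consider "j = Suc (Suc n)" | "j = Suc n" | "n = j"
      | "j \<noteq> Suc (Suc n)" "j \<noteq> Suc n" "n \<noteq> j" by blast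
    then show ?thesis
    proof cases
      case 1
      have "P = Q * (Q * Q ^ n)" by (simp add: P_def 1)
      then show ?thesis
        unfolding B Minus scaled_quot_two_cells(1)[OF P1] u
        by (simp add: 1 two_cells_def s_perp_Suc power2_eq_square algebra_simps)
    next
      case 2
      have z: "(if n = 0 then 0 else c * (s * two_cells (Suc (n - 1)) \<alpha> \<beta> Minus j)) = 0" for c s \<alpha> \<beta>
        using 2 by (auto simp: two_cells_def)
      have "P = Q * Q ^ n" by (simp add: P_def 2)
      then show ?thesis
        unfolding B Minus scaled_quot_two_cells(1)[OF P1] u z params QD0
        by (simp add: 2 expand) (simp add: algebra_simps)
    next
      case 3
      show ?thesis
      proof (cases n)
        \<comment> \<open>There is no earlier vector, so the contributions of C_1^- and C_0^+ at the
          vertex x must cancel; the choice of the two weights ensures this.\<close>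
        case 0
        then have "P = 1" using 3 by (simp add: P_def)
        then show ?thesis
          unfolding B Minus scaled_quot_two_cells(1)[OF P1] u params QD0
          by (simp add: 3 [symmetric] 0 expand) (simp add: algebra_simps)
      next
        case (Suc k)
        have "j = Suc k" using 3 Suc by simp
        then have "P = Q * Q ^ k" by (simp add: P_def)
        then show ?thesis
          unfolding B Minus scaled_quot_two_cells(1)[OF P1] u params QD0
          by (simp add: 3 [symmetric] Suc expand s_perp_Suc) (simp add: algebra_simps)
      qed
    next
      case 4
      then show ?thesis
        unfolding B Minus scaled_quot_two_cells(1)[OF P1] u by (auto simp: two_cells_def)
    qed
  next
    case Plus
    consider "j = Suc n" | "n = j" | "n = Suc j" | "j \<noteq> Suc n" "n \<noteq> j" "n \<noteq> Suc j" by blast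
    then show ?thesis
    proof cases
      case 1
      have "P = Q * Q ^ n" by (simp add: P_def 1)
      then show ?thesis
        unfolding B Plus scaled_quot_two_cells(2)[OF P1] u QD0
        by (simp add: 1 two_cells_def s_perp_Suc power2_eq_square algebra_simps)
    next
      case 2
      have z: "(if n = 0 then 0 else c * (s * two_cells (Suc (n - 1)) \<alpha> \<beta> Plus j)) = 0" for c s \<alpha> \<beta>
        using 2 by (auto simp: two_cells_def)
      have "Q ^ n = P" by (simp add: P_def 2)
      then show ?thesis
        unfolding B Plus scaled_quot_two_cells(2)[OF P1] u z params QD0
        by (simp add: 2 expand) (simp add: algebra_simps)
    next
      case 3
      have "Q ^ n = Q * P" "Q ^ (n - 1) = P" by (simp_all add: P_def 3)
      then show ?thesis
        unfolding B Plus scaled_quot_two_cells(2)[OF P1] u params QD0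
        by (simp add: 3 expand s_perp_Suc P_def [symmetric]) (simp add: algebra_simps)
    next
      case 4
      then show ?thesis
        unfolding B Plus scaled_quot_two_cells(2)[OF P1] u by (auto simp: two_cells_def)
    qed
  qed
qed

lemma u_main_top: "u_main (Suc D) = (\<lambda>y. 0)"
proof
  fix y
  show "u_main (Suc D) y = 0"
    using cls_less[of y] by (cases "fst (cls y)") (auto simp: u_main_def cellfun_def two_cells_def)
qed

text \<open>At index D the cell C_D^- is empty and the weight q^D - q^D on C_{D-1}^+ is zero, so
  this family ends earlier than \<open>u_main\<close>.\<close>

lemma u_perp_top: "u_perp (Suc (D - 2)) = (\<lambda>y. 0)"
proof
  fix y
  have "Suc (Suc (D - 2)) = D" using D3 by simp
  then show "u_perp (Suc (D - 2)) y = 0"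
    unfolding u_perp_def
    using cls_less[of y] by (cases "fst (cls y)") (auto simp: cellfun_def two_cells_def)
qed

end

section \<open>Spectral expansions\<close>

lemma cinner_sum_left: "cinner X (\<lambda>y. \<Sum>i\<in>I. f i y) v = (\<Sum>i\<in>I. cinner X (f i) v)"
  unfolding cinner_def sum_distrib_right by (rule sum.swap)

lemma cinner_diff_left: "cinner X (\<lambda>y. f y - g y) v = cinner X f v - cinner X g v"
  by (simp add: cinner_def left_diff_distrib sum_subtractf)

lemma cinner_self_eq_0:
  assumes "finite X" "cinner X d d = 0" "y \<in> X"
  shows "d y = 0"
proof -
  have "cinner X d d = of_real (\<Sum>y\<in>X. (norm (d y))\<^sup>2)"
    unfolding cinner_def of_real_sum complex_norm_square ..
  then have "(\<Sum>y\<in>X. (norm (d y))\<^sup>2) = 0" using assms(2) by (metis of_real_eq_0_iff)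
  then show ?thesis using assms(1,3) by (simp add: sum_nonneg_eq_0_iff)
qed

text \<open>The difference of two candidates lies in W and is orthogonal to W, hence to
  itself.\<close>

lemma orth_proj_eqI:
  assumes X: "finite X" and W: "W \<subseteq> cvecs X" "\<And>u v. u \<in> W \<Longrightarrow> v \<in> W \<Longrightarrow> (\<lambda>y. u y - v y) \<in> W"
    and w: "w \<in> W" "\<And>v. v \<in> W \<Longrightarrow> cinner X (\<lambda>y. u y - w y) v = 0"
  shows "orth_proj X W u = w"
  unfolding orth_proj_def
proof (rule the_equality)
  show "w \<in> W \<and> (\<forall>v\<in>W. cinner X (\<lambda>y. u y - w y) v = 0)" using w by blast
next
  fix w' assume w': "w' \<in> W \<and> (\<forall>v\<in>W. cinner X (\<lambda>y. u y - w' y) v = 0)"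
  define d where "d = (\<lambda>y. w y - w' y)"
  have dW: "d \<in> W" unfolding d_def using W(2) w w' by blast
  have "cinner X d d = cinner X (\<lambda>y. (u y - w' y) - (u y - w y)) d" by (simp add: d_def)
  also have "\<dots> = 0" unfolding cinner_diff_left[of X "\<lambda>y. u y - w' y"] using w(2) w' dW by simp
  finally have "d y = 0" if "y \<in> X" for y using cinner_self_eq_0[OF X] that by blast
  moreover have "d y = 0" if "y \<notin> X" for y using dW W(1) that by (auto simp: cvecs_def)
  ultimately have "d y = 0" for y by blast
  then show "w' = w" by (simp add: d_def fun_eq_iff)
qed

lemma eigenspace_diff:
  "u \<in> eigenspace X A \<theta> \<Longrightarrow> v \<in> eigenspace X A \<theta> \<Longrightarrow> (\<lambda>y. u y - v y) \<in> eigenspace X A \<theta>"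
  by (auto simp: eigenspace_def cvecs_def right_diff_distrib sum_subtractf)

lemma eigenspace_orthogonal:
  assumes A: "\<And>y z. A y z = A z y" "\<And>y z. cnj (A y z) = A y z"
    and u: "u \<in> eigenspace X A (of_real \<theta>)" and v: "v \<in> eigenspace X A (of_real \<theta>')" and ne: "\<theta> \<noteq> \<theta>'"
  shows "cinner X u v = 0"
proof -
  have "of_real \<theta> * cinner X u v = (\<Sum>y\<in>X. (\<Sum>z\<in>X. A y z * u z) * cnj (v y))"
    using u by (simp add: cinner_def eigenspace_def sum_distrib_left mult.assoc)
  also have "\<dots> = (\<Sum>y\<in>X. \<Sum>z\<in>X. A y z * u z * cnj (v y))" by (simp add: sum_distrib_right)
  also have "\<dots> = (\<Sum>z\<in>X. \<Sum>y\<in>X. A y z * u z * cnj (v y))" by (rule sum.swap)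
  also have "\<dots> = (\<Sum>z\<in>X. u z * cnj (\<Sum>y\<in>X. A z y * v y))"
    by (simp add: sum_distrib_left A(2) mult_ac) (simp add: A(1))
  also have "\<dots> = of_real \<theta>' * cinner X u v"
    using v by (simp add: cinner_def eigenspace_def sum_distrib_left mult_ac)
  finally show ?thesis using ne by simp
qed

context delsarte_cells
begin

definition eig :: "nat \<Rightarrow> ('v set \<Rightarrow> complex) set" where
  "eig k = eigenspace X (adj_matrix R) (complex_of_real (grass_eig q N D k))"

lemma adj_matrix_facts: "adj_matrix R y z = adj_matrix R z y" "cnj (adj_matrix R y z) = adj_matrix R y z"
  using R_sym by (auto simp: adj_matrix_def)

lemma node_eq:
  assumes "k \<le> D"
  shows "qhahn_node Q t k = t * (Q ^ k + Q ^ (N + 1 - k))"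
proof -
  have "Q ^ (N + 1) = Q ^ k * Q ^ (N + 1 - k)" using assms DN by (simp flip: power_add)
  moreover have "1 / (t * Q ^ k) = t * Q ^ (N + 1) / Q ^ k" using t_facts(2) by (simp flip: divide_divide_eq_left)
  ultimately show ?thesis using Q_facts(1) by (simp add: qhahn_node_def distrib_left)
qed

lemma node_nonzero: "k \<le> D \<Longrightarrow> qhahn_node Q t k \<noteq> 0"
proof -
  assume k: "k \<le> D"
  have "real q ^ k + real q ^ (N + 1 - k) > 0" using q1 by (simp add: add_pos_pos)
  then have "complex_of_real (real q ^ k + real q ^ (N + 1 - k)) \<noteq> 0" by (metis less_irrefl of_real_eq_0_iff)
  then show ?thesis using t_facts(1) by (simp add: node_eq[OF k])
qed

lemma Q_power_inj: "Q ^ k = Q ^ l \<longleftrightarrow> k = l"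
proof -
  have "Q ^ k = Q ^ l \<longleftrightarrow> q ^ k = q ^ l" by (metis of_nat_eq_iff of_nat_power)
  then show ?thesis using q1 by simp
qed

text \<open>A difference of two nodes is t (q^k - q^l)(1 - q^{N+1-k-l}), and k + l \<le> 2D \<le>
  N.\<close>

lemma node_inj: "inj_on (qhahn_node Q t) {..D}"
proof (rule inj_onI)
  fix k l assume kl: "k \<in> {..D}" "l \<in> {..D}" and eq: "qhahn_node Q t k = qhahn_node Q t l"
  show "k = l"
  proof (rule ccontr)
    assume ne: "k \<noteq> l"
    define M where "M = Q ^ (N + 1 - k - l)"
    have lt: "k + l < N + 1" using kl DN by auto
    have "Q ^ (N + 1 - k) = Q ^ l * M" "Q ^ (N + 1 - l) = Q ^ k * M"
      using lt by (simp_all add: M_def flip: power_add)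
    then have "Q ^ k + Q ^ l * M = Q ^ l + Q ^ k * M"
      using eq kl t_facts(1) by (simp add: node_eq)
    then have "(Q ^ k - Q ^ l) * (1 - M) = 0" by (simp add: algebra_simps)
    moreover have "M \<noteq> 1" unfolding M_def using lt by (intro Q_facts(3)) simp
    ultimately show False using ne Q_power_inj by auto
  qed
qed

lemma grass_eig_node:
  assumes "k \<le> D"
  shows "t * ((Q - 1)\<^sup>2 * complex_of_real (grass_eig q N D k) + c0) = qhahn_node Q t k"
proof -
  define P d e where "P = Q ^ k" and "d = Q ^ (D - k)" and "e = Q ^ (N - D - k)"
  have 1: "Q ^ (D + 1) = Q * P * d"
    using assms by (simp add: P_def d_def mult.assoc flip: power_add)
  have 2: "Q ^ (N - D + 1) = Q * P * e"
    using assms DN by (simp add: P_def e_def mult.assoc flip: power_add)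
  have 3: "Q ^ (N + 1 - k) = Q * P * d * e"
  proof -
    have "N + 1 - k = 1 + k + (D - k) + (N - D - k)" using assms DN by linarith
    then show ?thesis by (simp only: P_def d_def e_def power_add power_one_right)
  qed
  define u where "u = 1 / (Q - 1)"
  have u: "(Q - 1) * u = 1" using Q_facts(2) by (simp add: u_def)
  have n: "complex_of_real (qnum q m) = (Q ^ m - 1) * u" for m by (simp add: qnum_def u_def)
  have "(Q - 1)\<^sup>2 * complex_of_real (grass_eig q N D k)
      = (Q - 1)\<^sup>2 * (Q * P * ((d - 1) * u) * ((e - 1) * u) - (P - 1) * u)"
    by (simp add: grass_eig_def n P_def d_def e_def)
  also have "\<dots> = Q * P * (d - 1) * (e - 1) * (((Q - 1) * u) * ((Q - 1) * u)) - (Q - 1) * (P - 1) * ((Q - 1) * u)"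
    by (simp add: power2_eq_square algebra_simps)
  finally have "(Q - 1)\<^sup>2 * complex_of_real (grass_eig q N D k) = Q * P * (d - 1) * (e - 1) - (Q - 1) * (P - 1)"
    unfolding u by simp
  then show ?thesis
    unfolding node_eq[OF assms] c0_def 1 2 3 P_def [symmetric] by (simp add: algebra_simps)
qed

lemma grass_eig_inj: "k \<le> D \<Longrightarrow> l \<le> D \<Longrightarrow> grass_eig q N D k = grass_eig q N D l \<Longrightarrow> k = l"
  using grass_eig_node inj_onD[OF node_inj] by (metis atMost_iff)

lemma Bop_eig:
  assumes k: "k \<le> D" and B: "Bop e = (\<lambda>y. qhahn_node Q t k * e y)"
  shows "e \<in> eig k"
proof -
  have "e y = 0" if "y \<notin> X" for y
    using fun_cong[OF B, of y] node_nonzero[OF k] that by (simp add: Bop_def)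
  moreover have "Adj e y = complex_of_real (grass_eig q N D k) * e y" if y: "y \<in> X" for y
  proof -
    have "t * ((Q - 1)\<^sup>2 * Adj e y + c0 * e y) = t * ((Q - 1)\<^sup>2 * complex_of_real (grass_eig q N D k) + c0) * e y"
      using fun_cong[OF B, of y] y by (simp add: Bop_def grass_eig_node[OF k])
    then have "(Q - 1)\<^sup>2 * Adj e y = (Q - 1)\<^sup>2 * (complex_of_real (grass_eig q N D k) * e y)"
      using t_facts(1) by (simp add: distrib_left distrib_right mult.assoc)
    then show ?thesis using Q_facts(2) by simp
  qed
  ultimately show ?thesis by (simp add: eig_def eigenspace_def cvecs_def Adj_def)
qed

lemma eig_orthogonal: "u \<in> eig k \<Longrightarrow> v \<in> eig l \<Longrightarrow> k \<le> D \<Longrightarrow> l \<le> D \<Longrightarrow> k \<noteq> l \<Longrightarrow> cinner X u v = 0"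
  unfolding eig_def by (rule eigenspace_orthogonal[OF adj_matrix_facts]) (auto dest: grass_eig_inj)

text \<open>Any splitting of u into members of distinct eigenspaces consists of its projections,
  since the other components are orthogonal to the k-th eigenspace.\<close>

lemma grass_E_decomp:
  assumes K: "K \<subseteq> {..D}" and e: "\<And>k. k \<in> K \<Longrightarrow> e k \<in> eig k" and u: "\<And>y. u y = (\<Sum>k\<in>K. e k y)"
    and k: "k \<in> K"
  shows "grass_E sc q N D k u = e k"
  unfolding grass_E_def eig_def [symmetric]
proof (rule orth_proj_eqI[OF finX])
  have finK: "finite K" using K finite_subset by blast
  show "eig k \<subseteq> cvecs X" by (auto simp: eig_def eigenspace_def)
  show "(\<lambda>y. u y - v y) \<in> eig k" if "u \<in> eig k" "v \<in> eig k" for u v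
    using that unfolding eig_def by (rule eigenspace_diff)
  show "e k \<in> eig k" using e k .
  show "cinner X (\<lambda>y. u y - e k y) v = 0" if v: "v \<in> eig k" for v
  proof -
    have "(\<lambda>y. u y - e k y) = (\<lambda>y. \<Sum>l\<in>K - {k}. e l y)"
      using finK k by (simp add: u sum.remove fun_eq_iff)
    moreover have "cinner X (e l) v = 0" if "l \<in> K - {k}" for l
      using that e v k K by (intro eig_orthogonal[of _ l _ k]) auto
    ultimately show ?thesis by (simp add: cinner_sum_left)
  qed
qed

text \<open>The conjugated components split the same real vector and lie in the same eigenspaces, so
  they are the same projections.\<close>

lemma grass_E_decomp_real:
  assumes K: "K \<subseteq> {..D}" and e: "\<And>k. k \<in> K \<Longrightarrow> e k \<in> eig k" and u: "\<And>y. u y = (\<Sum>k\<in>K. e k y)"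
    and real: "\<And>y. cnj (u y) = u y" and k: "k \<in> K"
  shows "cnj (e k y) = e k y"
proof -
  have c: "(\<lambda>y. cnj (e k y)) \<in> eig k" if "k \<in> K" for k
  proof -
    have "(\<Sum>z\<in>X. adj_matrix R y z * cnj (e k z)) = complex_of_real (grass_eig q N D k) * cnj (e k y)"
      if y: "y \<in> X" for y
    proof -
      have "(\<Sum>z\<in>X. adj_matrix R y z * e k z) = complex_of_real (grass_eig q N D k) * e k y"
        using e[OF \<open>k \<in> K\<close>] y by (simp add: eig_def eigenspace_def)
      then have "cnj (\<Sum>z\<in>X. adj_matrix R y z * e k z) = cnj (complex_of_real (grass_eig q N D k) * e k y)"
        by simp
      then show ?thesis by (simp add: adj_matrix_facts)
    qed
    then show ?thesis using e[OF that] by (auto simp: eig_def eigenspace_def cvecs_def)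
  qed
  have "u y = (\<Sum>k\<in>K. cnj (e k y))" for y using real[of y] by (simp add: u)
  then have "grass_E sc q N D k u = (\<lambda>y. cnj (e k y))"
    using grass_E_decomp[OF K c _ k] by simp
  moreover have "grass_E sc q N D k u = e k" by (rule grass_E_decomp[OF K e u k])
  ultimately show ?thesis by metis
qed

abbreviation Ex :: "nat \<Rightarrow> 'v set \<Rightarrow> complex" where "Ex k \<equiv> grass_E sc q N D k (charvec {x})"
abbreviation Eu :: "nat \<Rightarrow> 'v set \<Rightarrow> complex" where "Eu k \<equiv> grass_E sc q N D k (u0perp sc q D C x)"

lemma qhahn_val_0: "qhahn_val Q' t' a b 0 z = 1"
  by (simp add: qhahn_val_def qhahn_coeff_def)

lemma u_main_0: "u_main 0 = charvec {x}"
proof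
  fix y
  have "fst (cls y) = Minus \<and> snd (cls y) = 0 \<longleftrightarrow> y = x" if "y \<in> X"
    using cls_base[OF that] by (simp add: prod_eq_iff)
  then show "u_main 0 y = charvec {x} y"
    using xX by (cases "fst (cls y)") (auto simp: u_main_def cellfun_def two_cells_def s_main_def charvec_def)
qed

lemma u_perp_0: "u_perp 0 = u0perp sc q D C x"
proof
  fix y
  have 1: "s_perp 0 * (Q - 1) = inverse Q - 1" "s_perp 0 * (Q - Q ^ D) = Q ^ (D - 1) - 1"
  proof -
    have "s_perp 0 = (1 - Q)\<^sup>2 / ((1 - Q) * (Q * (Q - 1)))"
      by (simp add: s_perp_def qpoch_Suc mult.assoc)
    also have "\<dots> = - 1 / Q" using Q_facts(1,2) by (simp add: divide_simps power2_eq_square)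
    finally have s: "s_perp 0 = - 1 / Q" .
    show "s_perp 0 * (Q - 1) = inverse Q - 1" unfolding s using Q_facts(1) by (simp add: field_simps)
    have "Q ^ D = Q * Q ^ (D - 1)" using D3 by (simp flip: power_Suc)
    then show "s_perp 0 * (Q - Q ^ D) = Q ^ (D - 1) - 1" unfolding s using Q_facts(1) by (simp add: field_simps)
  qed
  show "u_perp 0 y = u0perp sc q D C x y"
    unfolding u0perp_def charvec_cell u_perp_def cellfun_def two_cells_def using 1
    by (cases "fst (cls y)") auto
qed

lemma u_main_expansion:
  shows "k \<le> D \<Longrightarrow> Ex k \<in> eig k"
    and "k \<le> D \<Longrightarrow> cnj (Ex k y) = Ex k y"
    and "i \<le> D \<Longrightarrow> u_main i y = (\<Sum>k\<le>D. qhahn_val Q t a_main b_main i (qhahn_node Q t k) * Ex k y)"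
proof -
  obtain e where e: "\<And>k. k \<le> D \<Longrightarrow> Bop (e k) = (\<lambda>y. qhahn_node Q t k * e k y)"
    and u: "\<And>i y. i \<le> D \<Longrightarrow> u_main i y = (\<Sum>k\<le>D. qhahn_val Q t a_main b_main i (qhahn_node Q t k) * e k y)"
    using qhahn_spectral_expansion[OF Q_facts(1,3) t_facts(1) lin_op_Bop u_main_rec u_main_top params(2) node_inj]
    by blast
  have eig: "e k \<in> eig k" if "k \<in> {..D}" for k using that e by (intro Bop_eig) auto
  have x0: "charvec {x} y = (\<Sum>k\<le>D. e k y)" for y
    using u[of 0 y] by (simp add: u_main_0 qhahn_val_0)
  have Ex: "Ex k = e k" if "k \<in> {..D}" for k
    by (rule grass_E_decomp[OF subset_refl eig x0 that])
  show "k \<le> D \<Longrightarrow> Ex k \<in> eig k" using Ex eig by simp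
  show "k \<le> D \<Longrightarrow> cnj (Ex k y) = Ex k y"
    using grass_E_decomp_real[OF subset_refl eig x0] Ex by (simp add: charvec_def)
  show "i \<le> D \<Longrightarrow> u_main i y = (\<Sum>k\<le>D. qhahn_val Q t a_main b_main i (qhahn_node Q t k) * Ex k y)"
    using u Ex by simp
qed

lemma node_perp: "qhahn_node Q (t * Q) k = qhahn_node Q t (Suc k)"
  by (simp add: qhahn_node_def mult_ac)

lemma u_perp_expansion:
  shows "k \<in> {1..D - 1} \<Longrightarrow> Eu k \<in> eig k"
    and "k \<in> {1..D - 1} \<Longrightarrow> cnj (Eu k y) = Eu k y"
    and "i \<le> D - 2 \<Longrightarrow> u_perp i y
      = (\<Sum>k = 1..D - 1. qhahn_val Q (t * Q) a_perp b_perp i (qhahn_node Q t k) * Eu k y)"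
proof -
  have tQ: "t * Q \<noteq> 0" using t_facts(1) Q_facts(1) by simp
  have inj: "inj_on (qhahn_node Q (t * Q)) {..D - 2}"
  proof (rule inj_onI)
    fix k l assume "k \<in> {..D - 2}" "l \<in> {..D - 2}" "qhahn_node Q (t * Q) k = qhahn_node Q (t * Q) l"
    then show "k = l" using inj_onD[OF node_inj, of "Suc k" "Suc l"] D3 by (auto simp: node_perp)
  qed
  have b: "b_perp * Q ^ (D - 2) = 1"
  proof -
    have "D = 2 + (D - 2)" using D3 by simp
    then have "Q ^ D = Q ^ (2 + (D - 2))" by (rule arg_cong)
    then have "Q ^ D = Q\<^sup>2 * Q ^ (D - 2)" by (simp only: power_add)
    then show ?thesis using params(2,4) by (simp add: mult_ac)
  qed
  obtain e where e: "\<And>k. k \<le> D - 2 \<Longrightarrow> Bop (e k) = (\<lambda>y. qhahn_node Q (t * Q) k * e k y)"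
    and u: "\<And>i y. i \<le> D - 2 \<Longrightarrow> u_perp i y
      = (\<Sum>k\<le>D - 2. qhahn_val Q (t * Q) a_perp b_perp i (qhahn_node Q (t * Q) k) * e k y)"
    using qhahn_spectral_expansion[OF Q_facts(1,3) tQ lin_op_Bop u_perp_rec u_perp_top b inj] by blast
  \<comment> \<open>Node k of the family with parameter t q is node k + 1 of the graph.\<close>
  define f where "f k = e (k - 1)" for k
  have reindex: "(\<Sum>k\<le>D - 2. g k) = (\<Sum>k = 1..D - 1. g (k - 1))" for g :: "nat \<Rightarrow> complex"
    by (rule sum.reindex_bij_witness[of _ "\<lambda>k. k - 1" Suc]) (use D3 in auto)
  have node: "qhahn_node Q (t * Q) (k - 1) = qhahn_node Q t k" if "k \<in> {1..D - 1}" for k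
    using that by (simp add: node_perp)
  have eig: "f k \<in> eig k" if "k \<in> {1..D - 1}" for k
  proof (rule Bop_eig)
    show "k \<le> D" using that by auto
    have "k - 1 \<le> D - 2" using that by auto
    then show "Bop (f k) = (\<lambda>y. qhahn_node Q t k * f k y)"
      unfolding f_def node[OF that, symmetric] by (rule e)
  qed
  have x0: "u0perp sc q D C x y = (\<Sum>k = 1..D - 1. f k y)" for y
    using u[of 0 y] by (simp add: u_perp_0 qhahn_val_0 reindex f_def)
  have K: "{1..D - 1} \<subseteq> {..D}" by auto
  have Eu: "Eu k = f k" if "k \<in> {1..D - 1}" for k
    by (rule grass_E_decomp[OF K eig x0 that])
  show "k \<in> {1..D - 1} \<Longrightarrow> Eu k \<in> eig k" using Eu eig by simp
  have "cnj (u0perp sc q D C x y) = u0perp sc q D C x y" for y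
    by (simp add: u0perp_def charvec_def)
  then show "k \<in> {1..D - 1} \<Longrightarrow> cnj (Eu k y) = Eu k y"
    using grass_E_decomp_real[OF K eig x0] Eu by simp
  show "u_perp i y = (\<Sum>k = 1..D - 1. qhahn_val Q (t * Q) a_perp b_perp i (qhahn_node Q t k) * Eu k y)"
    if "i \<le> D - 2"
    unfolding u[OF that] reindex by (intro sum.cong refl) (simp only: node Eu f_def)
qed

end

section \<open>The cells as values of Laurent polynomials\<close>

text \<open>The indices pair up as k and -k, except 0 and -D, which stay alone.\<close>

lemma sum_int_split:
  fixes g :: "int \<Rightarrow> 'b::comm_monoid_add"
  assumes "D > 0"
  shows "(\<Sum>k = - int D..int D - 1. g k) = g 0 + g (- int D) + (\<Sum>k = 1..D - 1. g (int k) + g (- int k))"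
proof -
  have "{- int D..int D - 1} = {0, - int D} \<union> (int ` {1..D - 1} \<union> (\<lambda>k. - int k) ` {1..D - 1})"
  proof (intro equalityI subsetI)
    fix k assume k: "k \<in> {- int D..int D - 1}"
    show "k \<in> {0, - int D} \<union> (int ` {1..D - 1} \<union> (\<lambda>k. - int k) ` {1..D - 1})"
    proof (cases "k = 0 \<or> k = - int D")
      case False
      then have "k = int (nat \<bar>k\<bar>) \<or> k = - int (nat \<bar>k\<bar>)" "nat \<bar>k\<bar> \<in> {1..D - 1}"
        using k assms by auto
      then show ?thesis by (metis UnCI image_eqI)
    qed auto
  qed (use assms in auto)
  moreover have "sum g ({0, - int D} \<union> (int ` {1..D - 1} \<union> (\<lambda>k. - int k) ` {1..D - 1}))
      = sum g {0, - int D} + (sum g (int ` {1..D - 1}) + sum g ((\<lambda>k. - int k) ` {1..D - 1}))"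
    by (subst sum.union_disjoint, simp, simp, use assms in force)
      (subst sum.union_disjoint, auto)
  moreover have "sum g (int ` {1..D - 1}) = (\<Sum>k = 1..D - 1. g (int k))"
    by (rule sum.reindex_cong[of int]) auto
  moreover have "sum g ((\<lambda>k. - int k) ` {1..D - 1}) = (\<Sum>k = 1..D - 1. g (- int k))"
    by (rule sum.reindex_cong[of "\<lambda>k. - int k"]) (auto simp: inj_on_def)
  ultimately show ?thesis using assms by (simp add: sum.distrib)
qed

context delsarte_cells
begin

abbreviation yv :: "int \<Rightarrow> 'v set \<Rightarrow> complex" where "yv \<equiv> yvec sc q N D C x"
abbreviation la :: "int \<Rightarrow> complex" where "la \<equiv> lam q N"

lemma la_pos: "la (int k) = t * Q ^ k"
  by (simp add: lam_def)

lemma la_neg: "k > 0 \<Longrightarrow> la (- int k) = 1 / (t * Q ^ k)"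
  by (simp add: lam_def power_int_minus divide_inverse)

lemma la_nonzero: "la k \<noteq> 0"
  using t_facts(1) Q_facts(1) by (simp add: lam_def)

lemma la_node: "la k + 1 / la k = qhahn_node Q t (nat \<bar>k\<bar>)"
proof (cases "k \<ge> 0")
  case True
  then show ?thesis using la_pos[of "nat k"] by (simp add: qhahn_node_def)
next
  case False
  then show ?thesis using la_neg[of "nat (- k)"] by (simp add: qhahn_node_def add.commute)
qed

text \<open>With P = q^k, d = q^{D-k}, e = q^{N-D-k+1}, the weights of E_k x in y_k and y_{-k} are
  (d-1)(Pde-1)/w and d(P-1)(e-1)/w, and they add up to 1. The values of p^perp are -t(P-1)(e-1) and
  t(Pde-1)(d-1)/d, so E_k x drops out of the second combination.\<close>

lemma y_pair:
  assumes k: "k \<in> {1..D - 1}"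
  shows "yv (int k) y + yv (- int k) y = Ex k y"
    and "leval (pperp q N D) (la (int k)) * yv (int k) y + leval (pperp q N D) (la (- int k)) * yv (- int k) y
      = - (t * Q * (Q - 1)) * Eu k y"
proof -
  define P d e where "P = Q ^ k" and "d = Q ^ (D - k)" and "e = Q ^ (N - D - k + 1)"
  have le: "k \<le> D" "D + k \<le> N" "k > 0" "2 * k \<le> N" "k \<noteq> D" using k DN by auto
  have QD: "Q ^ D = P * d" using le by (simp add: P_def d_def flip: power_add)
  have m: "Q ^ (N - 2 * k + 1) = d * e"
  proof -
    have "N - 2 * k + 1 = (D - k) + (N - D - k + 1)" using le by linarith
    then have "Q ^ (N - 2 * k + 1) = Q ^ ((D - k) + (N - D - k + 1))" by (rule arg_cong)
    then show ?thesis by (simp only: d_def e_def power_add)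
  qed
  have Nk: "Q ^ (N - k + 1) = P * d * e"
  proof -
    have "N - k + 1 = k + (D - k) + (N - D - k + 1)" using le by linarith
    then have "Q ^ (N - k + 1) = Q ^ (k + (D - k) + (N - D - k + 1))" by (rule arg_cong)
    then show ?thesis by (simp only: P_def d_def e_def power_add)
  qed
  have N1: "Q ^ (N + 1) = P * P * d * e"
  proof -
    have "N + 1 = k + k + (D - k) + (N - D - k + 1)" using le by linarith
    then have "Q ^ (N + 1) = Q ^ (k + k + (D - k) + (N - D - k + 1))" by (rule arg_cong)
    then show ?thesis by (simp only: P_def d_def e_def power_add)
  qed
  have Dk: "Q ^ (D + 1 - k) = Q * d" "Q ^ (D - k + 1) = Q * d"
    using le by (simp_all add: d_def Suc_diff_le)
  have nz: "P \<noteq> 0" "d \<noteq> 0" "e \<noteq> 0" using Q_facts(1) by (simp_all add: P_def d_def e_def)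
  have "Q ^ D \<noteq> 1" using D3 by (intro Q_facts(3)) simp
  moreover have "Q ^ (N - 2 * k + 1) \<noteq> 1" by (intro Q_facts(3)) simp
  ultimately have nz1: "P * d - 1 \<noteq> 0" "d * e - 1 \<noteq> 0" unfolding QD m by simp_all
  define w where "w = (P * d - 1) * (d * e - 1)"
  have w: "w \<noteq> 0" using nz1 by (simp add: w_def)
  have yp: "yv (int k) y = (d - 1) * (P * d * e - 1) / w * Ex k y + Q * d * (Q - 1) / w * Eu k y"
    using le unfolding yvec_def yvec_pos_def Let_def
    by (simp only: nat_int Dk QD m Nk d_def [symmetric] w_def [symmetric]) simp
  have yn: "yv (- int k) y = d * (P - 1) * (e - 1) / w * Ex k y - Q * d * (Q - 1) / w * Eu k y"
    using k le unfolding yvec_def yvec_neg_def Let_def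
    by (simp only: nat_int Dk QD m e_def [symmetric] d_def [symmetric] P_def [symmetric] w_def [symmetric] minus_minus)
      simp
  have sum: "(d - 1) * (P * d * e - 1) + d * (P - 1) * (e - 1) = w"
    by (simp add: w_def algebra_simps)
  have "yv (int k) y + yv (- int k) y = ((d - 1) * (P * d * e - 1) + d * (P - 1) * (e - 1)) / w * Ex k y"
    unfolding yp yn by (simp add: add_divide_distrib distrib_right)
  then show "yv (int k) y + yv (- int k) y = Ex k y" unfolding sum using w by simp
  have ti: "inverse t = t * (P * P * d * e)" using t_facts(2) unfolding N1 by (simp add: divide_inverse)
  have tt: "t * t * (P * P * d * e) = 1" using ti t_facts(1) by (metis mult.assoc right_inverse)
  have pp: "leval (pperp q N D) z = 1 / z * (z - t) * (z - t * (P * e))" if "z \<noteq> 0" for z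
  proof -
    have r: "inverse t * inverse (P * d) = t * (P * e)" unfolding ti using nz by (simp add: field_simps)
    have "leval (pperp q N D) z = inverse z * (z - t) * (z - inverse t * inverse (Q ^ D))"
      by (simp add: pperp_def Let_def leval_mult[OF that] leval_diff power_int_minus)
    then show ?thesis unfolding QD r by (simp add: divide_inverse)
  qed
  have p1: "leval (pperp q N D) (la (int k)) = t * ((P - 1) * (1 - e))"
  proof -
    have "leval (pperp q N D) (la (int k)) = 1 / (t * P) * (t * P - t) * (t * P - t * (P * e))"
      using pp[OF la_nonzero[of "int k"]] by (simp add: la_pos P_def)
    also have "\<dots> = t * ((P - 1) * (1 - e))" using t_facts(1) nz by (simp add: field_simps)
    finally show ?thesis .
  qed
  \<comment> \<open>The factor d clears the only denominator, since \<lambda>_{-k} = 1/(t q^k)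
    equals t P d e.\<close>
  have p2: "d * leval (pperp q N D) (la (- int k)) = t * ((P * d * e - 1) * (d - 1))"
  proof -
    have l: "la (- int k) = t * (P * d * e)"
      using la_neg[OF le(3)] ti t_facts(1) nz by (simp add: P_def [symmetric] divide_inverse mult_ac)
    have "d * leval (pperp q N D) (la (- int k))
        = d * (1 / (t * (P * d * e)) * (t * (P * d * e) - t) * (t * (P * d * e) - t * (P * e)))"
      using pp[OF la_nonzero[of "- int k"]] by (simp add: l)
    also have "\<dots> = t * ((P * d * e - 1) * (d - 1))" using t_facts(1) nz by (simp add: field_simps)
    finally show ?thesis .
  qed
  have "leval (pperp q N D) (la (int k)) * yv (int k) y + leval (pperp q N D) (la (- int k)) * yv (- int k) y
    = (leval (pperp q N D) (la (int k)) * ((d - 1) * (P * d * e - 1))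
        + d * leval (pperp q N D) (la (- int k)) * ((P - 1) * (e - 1))) / w * Ex k y
      + (d * leval (pperp q N D) (la (int k)) - d * leval (pperp q N D) (la (- int k))) * (Q * (Q - 1)) / w * Eu k y"
    unfolding yp yn by (simp add: add_divide_distrib diff_divide_distrib algebra_simps)
  also have "\<dots> = 0 / w * Ex k y + (- t * w) * (Q * (Q - 1)) / w * Eu k y"
  proof -
    have "leval (pperp q N D) (la (int k)) * ((d - 1) * (P * d * e - 1))
        + d * leval (pperp q N D) (la (- int k)) * ((P - 1) * (e - 1)) = 0"
      unfolding p1 p2 by (simp add: algebra_simps)
    moreover have "d * leval (pperp q N D) (la (int k)) - d * leval (pperp q N D) (la (- int k)) = - t * w"
      unfolding p1 p2 w_def by (simp add: algebra_simps)
    ultimately show ?thesis by simp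
  qed
  also have "\<dots> = - (t * Q * (Q - 1)) * Eu k y" using w by simp
  finally show "leval (pperp q N D) (la (int k)) * yv (int k) y + leval (pperp q N D) (la (- int k)) * yv (- int k) y
      = - (t * Q * (Q - 1)) * Eu k y" .
qed

lemma main_params_ne: "j < D \<Longrightarrow> a_main * Q ^ j \<noteq> 1" "j < D \<Longrightarrow> b_main * Q ^ j \<noteq> 1"
  and perp_params_ne: "j < D - 2 \<Longrightarrow> a_perp * Q ^ j \<noteq> 1" "j < D - 2 \<Longrightarrow> b_perp * Q ^ j \<noteq> 1"
proof -
  have gen: "c * Q ^ j \<noteq> 1" if "c * Q ^ m = 1" "j < m" for c j m
  proof
    assume "c * Q ^ j = 1"
    then have "Q ^ j = Q ^ m" using that(1) by (metis mult_cancel_left mult_zero_left zero_neq_one)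
    then show False using that(2) Q_power_inj by simp
  qed
  show "j < D \<Longrightarrow> a_main * Q ^ j \<noteq> 1" using gen[OF params(1)] DN by simp
  show "j < D \<Longrightarrow> b_main * Q ^ j \<noteq> 1" using gen[OF params(2)] by simp
  have "N - D = Suc (N - D - 1)" using DN D3 by simp
  then have "Q ^ (N - D) = Q ^ Suc (N - D - 1)" by (rule arg_cong)
  then have "Q ^ (N - D) = Q * Q ^ (N - D - 1)" by (simp only: power_Suc)
  then have a: "a_perp * Q ^ (N - D - 1) = 1" using params(1,3) by (simp add: mult_ac)
  have "D = 2 + (D - 2)" using D3 by simp
  then have "Q ^ D = Q ^ (2 + (D - 2))" by (rule arg_cong)
  then have "Q ^ D = Q\<^sup>2 * Q ^ (D - 2)" by (simp only: power_add)
  then have b: "b_perp * Q ^ (D - 2) = 1" using params(2,4) by (simp add: mult_ac)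
  show "j < D - 2 \<Longrightarrow> a_perp * Q ^ j \<noteq> 1" using gen[OF a] DN by simp
  show "j < D - 2 \<Longrightarrow> b_perp * Q ^ j \<noteq> 1" using gen[OF b] by simp
qed

lemma hpoly_eq: "i \<le> D \<Longrightarrow> hpoly q N D i = (\<Sum>n\<le>i. lconst (qhahn_coeff Q t a_main b_main i n) * qfactor Q t n)"
  unfolding hpoly_def Let_def
  by (rule phi32_eq_qhahn_sum[OF Q_facts(1,3)]) (use main_params_ne in auto)

lemma hperp_eq: "i \<le> D - 2 \<Longrightarrow> hperp q N D i
    = (\<Sum>n\<le>i. lconst (qhahn_coeff Q (t * Q) a_perp b_perp i n) * qfactor Q (t * Q) n)"
proof -
  assume i: "i \<le> D - 2"
  then have "i \<noteq> D - 1" using D3 by auto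
  then show ?thesis
    unfolding hperp_def Let_def if_not_P[OF \<open>i \<noteq> D - 1\<close>]
    by (intro phi32_eq_qhahn_sum[OF Q_facts(1,3)]) (use perp_params_ne i in auto)
qed

lemma leval_hpoly: "i \<le> D \<Longrightarrow> leval (hpoly q N D i) (la k) = qhahn_val Q t a_main b_main i (qhahn_node Q t (nat \<bar>k\<bar>))"
  by (simp add: hpoly_eq leval_qhahn_sum[OF la_nonzero] la_node)

lemma leval_hperp: "i \<le> D - 2 \<Longrightarrow>
    leval (hperp q N D i) (la k) = qhahn_val Q (t * Q) a_perp b_perp i (qhahn_node Q t (nat \<bar>k\<bar>))"
  by (simp add: hperp_eq leval_qhahn_sum[OF la_nonzero] la_node)

lemma leval_hperp_top:
  assumes "nat \<bar>k\<bar> \<in> {1..D - 1}"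
  shows "leval (hperp q N D (D - 1)) (la k) = 0"
proof -
  have "leval (zet 1 + zet (- 1) - lconst (t * Q ^ j) - lconst (inverse t * Q powi (- int j))) (la k)
      = qhahn_node Q t (nat \<bar>k\<bar>) - qhahn_node Q t j" for j
    unfolding la_node [of k, symmetric]
    by (simp add: leval_add leval_diff power_int_minus qhahn_node_def divide_inverse diff_diff_eq)
  then have "leval (hperp q N D (D - 1)) (la k) = (\<Prod>j = 1..D - 1. qhahn_node Q t (nat \<bar>k\<bar>) - qhahn_node Q t j)"
    unfolding hperp_def Let_def if_P[OF refl] leval_prod[OF la_nonzero] by (intro prod.cong refl) simp
  also have "\<dots> = 0" using assms by (intro prod_zero) auto
  finally show ?thesis .
qed

lemma leval_pperp_zero: "leval (pperp q N D) (la 0) = 0" "leval (pperp q N D) (la (- int D)) = 0"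
proof -
  have "la 0 = t" using la_pos[of 0] by simp
  then show "leval (pperp q N D) (la 0) = 0"
    using la_nonzero[of 0] by (simp add: pperp_def Let_def leval_mult leval_diff)
  have "la (- int D) = inverse t * Q powi (- int D)"
    using D3 by (simp add: lam_def)
  then show "leval (pperp q N D) (la (- int D)) = 0"
    using la_nonzero[of "- int D"] by (simp add: pperp_def Let_def leval_mult leval_diff)
qed

definition y_sum :: "laurent \<Rightarrow> 'v set \<Rightarrow> complex" where
  "y_sum f y = (\<Sum>k = - int D..int D - 1. leval f (la k) * yv k y)"

lemma y_sum_diff: "y_sum (f - g) y = y_sum f y - y_sum g y"
  by (simp add: y_sum_def leval_diff left_diff_distrib sum_subtractf)

lemma y_sum_lconst: "y_sum (lconst c * f) y = c * y_sum f y"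
  by (simp add: y_sum_def leval_mult[OF la_nonzero] sum_distrib_left mult.assoc)

text \<open>h_i depends on \<zeta> + 1/\<zeta> only, so it has one value at \<lambda>_k and
  \<lambda>_{-k}, and this value multiplies y_k + y_{-k}.\<close>

lemma sum_hpoly_y:
  assumes "i \<le> D"
  shows "y_sum (hpoly q N D i) y = u_main i y"
proof -
  let ?h = "\<lambda>k. qhahn_val Q t a_main b_main i (qhahn_node Q t k)"
  have D0: "D > 0" using D3 by simp
  have "y_sum (hpoly q N D i) y = ?h 0 * Ex 0 y + ?h D * Ex D y + (\<Sum>k = 1..D - 1. ?h k * (yv (int k) y + yv (- int k) y))"
    using D0 by (simp add: y_sum_def sum_int_split leval_hpoly[OF assms] distrib_left yvec_def[of _ _ _ _ _ _ 0]
      yvec_def[of _ _ _ _ _ _ "- int D"])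
  also have "(\<Sum>k = 1..D - 1. ?h k * (yv (int k) y + yv (- int k) y)) = (\<Sum>k = 1..D - 1. ?h k * Ex k y)"
    by (intro sum.cong refl) (simp only: y_pair)
  also have "?h 0 * Ex 0 y + ?h D * Ex D y + (\<Sum>k = 1..D - 1. ?h k * Ex k y) = (\<Sum>k\<le>D. ?h k * Ex k y)"
  proof -
    have "{..D} = insert 0 (insert D {1..D - 1})" using D0 by auto
    then show ?thesis using D0 by (simp add: add.assoc)
  qed
  also have "\<dots> = u_main i y" using u_main_expansion(3)[OF assms] by simp
  finally show ?thesis .
qed

text \<open>The factor h^perp_i has equal values at \<lambda>_k and \<lambda>_{-k}, and p^perp
  removes the unpaired indices 0 and -D. The constant t q (q-1) cancels against the denominator of
  \<open>s_perp\<close>.\<close>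

lemma sum_perp_y:
  "y_sum (pperp q N D * hperp q N D i) y
     = (if i = D - 1 then 0 else - (t * Q * (Q - 1)) * u_perp i y)" if "i \<le> D - 1"
proof -
  have D0: "D > 0" using D3 by simp
  define h where "h k = leval (hperp q N D i) (la (int k))" for k
  have h': "leval (hperp q N D i) (la (- int k)) = h k" if "k \<in> {1..D - 1}" for k
  proof (cases "i = D - 1")
    case True
    then show ?thesis using leval_hperp_top[of "int k"] leval_hperp_top[of "- int k"] that by (simp add: h_def)
  next
    case False
    then have "i \<le> D - 2" using \<open>i \<le> D - 1\<close> by simp
    then show ?thesis by (simp add: h_def leval_hperp)
  qed
  have "y_sum (pperp q N D * hperp q N D i) y
    = (\<Sum>k = 1..D - 1. leval (pperp q N D) (la (int k)) * h k * yv (int k) y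
        + leval (pperp q N D) (la (- int k)) * leval (hperp q N D i) (la (- int k)) * yv (- int k) y)"
    using D0 by (simp add: y_sum_def sum_int_split leval_mult[OF la_nonzero] leval_pperp_zero h_def)
  also have "\<dots> = (\<Sum>k = 1..D - 1. h k * (leval (pperp q N D) (la (int k)) * yv (int k) y
        + leval (pperp q N D) (la (- int k)) * yv (- int k) y))"
    by (intro sum.cong refl) (simp add: h' algebra_simps)
  also have "\<dots> = (\<Sum>k = 1..D - 1. h k * (- (t * Q * (Q - 1)) * Eu k y))"
    by (intro sum.cong refl) (simp only: y_pair)
  also have "\<dots> = - (t * Q * (Q - 1)) * (\<Sum>k = 1..D - 1. h k * Eu k y)"
    unfolding sum_distrib_left by (intro sum.cong refl) (simp only: mult_ac)
  also have "\<dots> = (if i = D - 1 then 0 else - (t * Q * (Q - 1)) * u_perp i y)"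
  proof (cases "i = D - 1")
    case True
    then show ?thesis using leval_hperp_top by (simp add: h_def)
  next
    case False
    then have "i \<le> D - 2" using \<open>i \<le> D - 1\<close> by simp
    then show ?thesis using False u_perp_expansion(3)[of i y] by (simp add: h_def leval_hperp)
  qed
  finally show ?thesis .
qed

text \<open>The prefactors of ell solve a 2 by 2 system on the pair (C_m^-, C_{m-1}^+): (q^D -
  q^m)(1, 1) + (q^m - 1, q^m - q^D) = (q^D - 1, 0) isolates the Minus cell, and (q^m - 1)(1, 1) -
  (q^m - 1, q^m - q^D) = (0, q^D - 1) the Plus cell.\<close>

proposition charvec_cell_expansion:
  assumes i: "i < D"
  shows "y_sum (ell q N D \<sigma> i) y = charvec (cells \<sigma> i) y"
proof (cases \<sigma>)
  case Minus
  let ?c = "(Q ^ D - Q ^ i) / (t ^ i * (Q ^ D - 1) * (qpoch Q Q i)\<^sup>2)"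
  have nz: "Q ^ D - 1 \<noteq> 0" "Q ^ D - Q ^ i \<noteq> 0" "t ^ i \<noteq> 0" "qpoch Q Q i \<noteq> 0"
    using Q_facts(3)[of D] D3 Q_power_inj[of D i] i t_facts(1) Q_facts(3)[of "Suc _"]
    by (auto simp: qpoch_eq_0_iff)
  show ?thesis
  proof (cases "i = 0")
    case True
    have "y_sum (ell q N D \<sigma> i) y = ?c * u_main i y"
      unfolding Minus sum_hpoly_y[OF less_imp_le[OF i], symmetric] y_sum_lconst[symmetric]
      by (simp add: True Let_def)
    also have "\<dots> = u_main 0 y" using True nz by simp
    finally show ?thesis
      by (simp add: Minus True charvec_cell u_main_def s_main_def two_cells_def cellfun_def split: pm.split)
  next
    case False
    then obtain l where l: "i = Suc l" by (cases i) auto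
    let ?c' = "(1 - Q ^ i) / (Q ^ D - Q ^ i)"
    have "y_sum (ell q N D \<sigma> i) y
      = ?c * (y_sum (hpoly q N D i) y - ?c' * y_sum (pperp q N D * hperp q N D l) y)"
      unfolding Minus y_sum_lconst [symmetric] y_sum_diff [symmetric] by (simp add: Let_def l mult.assoc)
    also have "\<dots> = ?c * u_main i y - ?c * ?c' * (- (t * Q * (Q - 1)) * u_perp l y)"
    proof -
      have "l \<noteq> D - 1" "l \<le> D - 1" using i l by simp_all
      then show ?thesis
        unfolding sum_hpoly_y[OF less_imp_le[OF i]] sum_perp_y[OF \<open>l \<le> D - 1\<close>]
        by (simp only: if_False right_diff_distrib mult.assoc)
    qed
    also have "\<dots> = charvec (cells \<sigma> i) y"
    proof -
      have q1: "1 - Q ^ i \<noteq> 0" using Q_facts(3)[of i] False by simp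
      have m: "?c * s_main i = (Q ^ D - Q ^ i) / (Q ^ D - 1)"
        using nz by (simp add: s_main_def divide_simps)
      have p: "?c * ?c' * (t * Q * (Q - 1)) * s_perp l = 1 / (Q ^ D - 1)"
        using nz q1 t_facts(1) Q_facts(1,2) unfolding s_perp_def l by (simp add: divide_simps)
      have "?c * u_main i y - ?c * ?c' * (- (t * Q * (Q - 1)) * u_perp l y)
        = cellfun (\<lambda>\<sigma> j. ?c * s_main i * two_cells i 1 1 \<sigma> j
            + ?c * ?c' * (t * Q * (Q - 1)) * s_perp l * two_cells i (Q ^ i - 1) (Q ^ i - Q ^ D) \<sigma> j) y"
        by (simp add: u_main_def u_perp_def cellfun_def l mult.assoc)
      also have "\<dots> = charvec (cells \<sigma> i) y"
        unfolding m p charvec_cell Minus using nz(1)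
        by (auto simp: cellfun_def two_cells_def add_divide_distrib [symmetric] split: pm.split)
      finally show ?thesis .
    qed
    finally show ?thesis .
  qed
next
  case Plus
  let ?m = "Suc i"
  let ?c = "(Q ^ ?m - 1) / (t ^ ?m * (Q ^ D - 1) * (qpoch Q Q ?m)\<^sup>2)"
  have nz: "Q ^ D - 1 \<noteq> 0" "Q ^ ?m - 1 \<noteq> 0" "1 - Q ^ ?m \<noteq> 0" "t ^ ?m \<noteq> 0" "qpoch Q Q ?m \<noteq> 0"
    using Q_facts(3)[of D] D3 t_facts(1) Q_facts(3)[of "Suc _"]
    by (auto simp: qpoch_eq_0_iff simp del: power_Suc) (simp add: power_Suc [symmetric] del: power_Suc)
  have "y_sum (ell q N D \<sigma> i) y = ?c * (y_sum (hpoly q N D ?m) y - y_sum (pperp q N D * hperp q N D i) y)"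
    unfolding Plus y_sum_lconst [symmetric] y_sum_diff [symmetric] by (simp add: Let_def)
  also have "\<dots> = ?c * u_main ?m y - ?c * (if i = D - 1 then 0 else - (t * Q * (Q - 1)) * u_perp i y)"
    using sum_perp_y[of i y] sum_hpoly_y[of ?m y] i by (simp add: right_diff_distrib)
  also have "\<dots> = charvec (cells \<sigma> i) y"
  proof -
    have m: "?c * s_main ?m = (Q ^ ?m - 1) / (Q ^ D - 1)"
      using nz(1,4,5) by (simp add: s_main_def del: power_Suc)
    show ?thesis
    proof (cases "i = D - 1")
      \<comment> \<open>No second vector exists here, but C_D^- is empty, so \<open>u_main D\<close>
        is already a multiple of the characteristic vector of C_{D-1}^+.\<close>
      case True
      then have "?m = D" using i by simp
      have "?c * u_main ?m y = cellfun (\<lambda>\<sigma> j. ?c * s_main ?m * two_cells ?m 1 1 \<sigma> j) y"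
        by (simp add: u_main_def cellfun_def)
      also have "\<dots> = charvec (cells \<sigma> i) y"
        unfolding m charvec_cell Plus using nz(1) cls_less[of y] \<open>?m = D\<close>
        by (auto simp: cellfun_def two_cells_def split: pm.split simp del: power_Suc)
      finally show ?thesis using True by simp
    next
      case False
      have p: "?c * (t * Q * (Q - 1)) * s_perp i = - 1 / (Q ^ D - 1)"
      proof -
        have "(Q ^ ?m - 1) / (1 - Q ^ ?m) = - 1" using nz(3) by (simp add: divide_eq_eq)
        moreover have "?c * (t * Q * (Q - 1)) * s_perp i = (Q ^ ?m - 1) / (1 - Q ^ ?m) / (Q ^ D - 1)"
        proof -
          have gen: "a / (t * p * b * r) * (t * Q * w) * (p * r / (g * Q * w)) = a / g / b"
            if "p \<noteq> 0" "r \<noteq> 0" "w \<noteq> 0" "b \<noteq> 0" "g \<noteq> 0" for a b g p r w :: complex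
            using that t_facts(1) Q_facts(1) by (simp add: divide_simps)
          have "t ^ i \<noteq> 0" using t_facts(1) by simp
          then show ?thesis
            unfolding s_perp_def power_Suc [of t] using nz Q_facts(2) by (intro gen) (simp_all del: power_Suc)
        qed
        ultimately show ?thesis by simp
      qed
      have "?c * u_main ?m y - ?c * (- (t * Q * (Q - 1)) * u_perp i y)
        = cellfun (\<lambda>\<sigma> j. ?c * s_main ?m * two_cells ?m 1 1 \<sigma> j
            + ?c * (t * Q * (Q - 1)) * s_perp i * two_cells ?m (Q ^ ?m - 1) (Q ^ ?m - Q ^ D) \<sigma> j) y"
        by (simp add: u_main_def u_perp_def cellfun_def mult.assoc del: power_Suc)
      also have "\<dots> = charvec (cells \<sigma> i) y"
        unfolding m p charvec_cell Plus using nz(1)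
        by (auto simp: cellfun_def two_cells_def diff_divide_distrib [symmetric] split: pm.split simp del: power_Suc)
      finally show ?thesis using False by simp
    qed
  qed
  finally show ?thesis .
qed

end

section \<open>Orthogonality\<close>

lemma keys_lscale: "Poly_Mapping.keys (lscale c f) \<subseteq> Poly_Mapping.keys f"
  using keys_mult[of "lconst c" f] by (force simp: lscale_def lconst_def split: if_splits)

lemma Lspace_subspace: "laurent.subspace (Lspace D)"
  unfolding laurent.subspace_def Lspace_iff
proof (intro conjI ballI allI)
  show "Poly_Mapping.keys (f + g) \<subseteq> {- int D..int D - 1}"
    if "f \<in> Lspace D" "g \<in> Lspace D" for f g
    using that Poly_Mapping.keys_add[of f g] unfolding Lspace_iff by (meson Un_least order_trans)
  show "Poly_Mapping.keys (lscale c f) \<subseteq> {- int D..int D - 1}" if "f \<in> Lspace D" for c f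
    using that keys_lscale[of c f] unfolding Lspace_iff by (rule order_trans[rotated])
qed simp

lemma Lspace_subset_span: "Lspace D \<subseteq> laurent.span (zet ` {- int D..int D - 1})"
proof
  fix f assume "f \<in> Lspace D"
  then obtain c where "f = (\<Sum>k = - int D..int D - 1. lscale (c k) (zet k))"
    by (auto simp: Lspace_def)
  then show "f \<in> laurent.span (zet ` {- int D..int D - 1})"
    by (simp only:) (intro laurent.span_sum laurent.span_scale laurent.span_base imageI)
qed

text \<open>An element outside the span would give 2D + 1 independent elements in a space spanned by
  2D monomials.\<close>

lemma span_eq_Lspace:
  assumes "finite S" "card S = 2 * D" "laurent.independent S" "S \<subseteq> Lspace D"
  shows "laurent.span S = Lspace D"
proof
  show "laurent.span S \<subseteq> Lspace D"
    using assms(4) Lspace_subspace by (rule laurent.span_minimal)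
  let ?Z = "zet ` {- int D..int D - 1}"
  have S: "S \<subseteq> laurent.span ?Z" using assms(4) Lspace_subset_span by (rule order_trans)
  show "Lspace D \<subseteq> laurent.span S"
  proof
    fix f assume f: "f \<in> Lspace D"
    show "f \<in> laurent.span S"
    proof (rule ccontr)
      assume n: "f \<notin> laurent.span S"
      then have "laurent.independent (insert f S)" using assms(3) by (simp add: laurent.independent_insert)
      moreover have "insert f S \<subseteq> laurent.span ?Z" using S f Lspace_subset_span by blast
      ultimately have "card (insert f S) \<le> card ?Z"
        using laurent.independent_span_bound[of ?Z "insert f S"] by blast
      moreover have "card ?Z \<le> 2 * D" using card_image_le[of "{- int D..int D - 1}" zet] by simp
      moreover have "f \<notin> S" using n laurent.span_base by blast
      ultimately show False using assms(1,2) by simp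
    qed
  qed
qed

lemma UNIV_pm: "(UNIV :: pm set) = {Minus, Plus}"
  using pm.exhaust by blast

context delsarte_cells
begin

lemma eig_lincomb: "u \<in> eig k \<Longrightarrow> v \<in> eig k \<Longrightarrow> (\<lambda>y. a * u y + b * v y) \<in> eig k"
proof -
  assume uv: "u \<in> eig k" "v \<in> eig k"
  have "(\<Sum>z\<in>X. adj_matrix R y z * (a * u z + b * v z))
      = a * (\<Sum>z\<in>X. adj_matrix R y z * u z) + b * (\<Sum>z\<in>X. adj_matrix R y z * v z)" for y
    by (simp add: sum.distrib sum_distrib_left algebra_simps)
  then show ?thesis using uv by (auto simp: eig_def eigenspace_def cvecs_def algebra_simps)
qed

lemma yv_eig:
  assumes "k \<in> {- int D..int D - 1}"
  shows "yv k \<in> eig (nat \<bar>k\<bar>)" and "cnj (yv k y) = yv k y"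
proof -
  have "yv k \<in> eig (nat \<bar>k\<bar>) \<and> (\<forall>y. cnj (yv k y) = yv k y)"
  proof -
    consider "k = 0" | "k = - int D" | "k > 0" | "k < 0" "k \<noteq> - int D" "k \<noteq> 0" by linarith
    then show ?thesis
    proof cases
      case 1
      then show ?thesis using u_main_expansion(1,2)[of 0] by (simp add: yvec_def)
    next
      case 2
      then show ?thesis using u_main_expansion(1,2)[of D] D3 by (simp add: yvec_def)
    next
      case 3
      then have k: "nat k \<in> {1..D - 1}" "nat k \<le> D" "nat \<bar>k\<bar> = nat k" using assms by auto
      have y: "yv k = yvec_pos sc q N D C x (nat k)" using 3 D3 by (simp add: yvec_def)
      show ?thesis
        unfolding y k(3) yvec_pos_def Let_def
        by (intro conjI allI eig_lincomb u_main_expansion(1)[OF k(2)] u_perp_expansion(1)[OF k(1)])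
          (simp add: u_main_expansion(2)[OF k(2)] u_perp_expansion(2)[OF k(1)])
    next
      case 4
      then have k: "nat (- k) \<in> {1..D - 1}" "nat (- k) \<le> D" "nat \<bar>k\<bar> = nat (- k)" using assms by auto
      have y: "yv k = yvec_neg sc q N D C x (nat (- k))" using 4 by (simp add: yvec_def)
      have m: "a * Ex l z - b * Eu l z = a * Ex l z + (- b) * Eu l z" for a b l z by simp
      show ?thesis
        unfolding y k(3) yvec_neg_def Let_def m
        by (intro conjI allI eig_lincomb u_main_expansion(1)[OF k(2)] u_perp_expansion(1)[OF k(1)])
          (simp add: u_main_expansion(2)[OF k(2)] u_perp_expansion(2)[OF k(1)])
    qed
  qed
  then show "yv k \<in> eig (nat \<bar>k\<bar>)" "cnj (yv k y) = yv k y" by blast+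
qed

lemma yv_orthogonal:
  assumes "k \<in> {- int D..int D - 1}" "l \<in> {- int D..int D - 1}" "\<bar>k\<bar> \<noteq> \<bar>l\<bar>"
  shows "cinner X (yv k) (yv l) = 0"
  using assms by (intro eig_orthogonal[OF yv_eig(1) yv_eig(1)]) auto

lemma yv_inner_sym:
  assumes "k \<in> {- int D..int D - 1}" "l \<in> {- int D..int D - 1}"
  shows "cinner X (yv k) (yv l) = cinner X (yv l) (yv k)"
  unfolding cinner_def using yv_eig(2)[OF assms(1)] yv_eig(2)[OF assms(2)] by (simp add: mult.commute)

text \<open>In the double sum only the pairs l = k and l = -k survive orthogonality of eigenspaces.
  As the y_k are real, the inner product is symmetric, and the two mixed terms share one
  weight.\<close>

lemma Lform_eq_cinner:
  "Lform sc q N D C x f g = cinner X (y_sum f) (y_sum g)"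
proof -
  define I where "I = {- int D..int D - 1}"
  define a b where "a k = leval f (la k)" and "b k = leval g (la k)" for k
  define G where "G k l = cinner X (yv k) (yv l)" for k l
  \<comment> \<open>The mixed term of k; it is absent for k = 0, where both pairs coincide, and for
    k = -D, whose negative is out of range.\<close>
  define h where "h k = (if k \<noteq> 0 \<and> - k \<in> I then a k * cnj (b (- k)) * G k (- k) else 0)" for k
  have D0: "D > 0" using D3 by simp
  have inner: "(\<Sum>l\<in>I. a k * cnj (b l) * G k l) = a k * cnj (b k) * G k k + h k" if k: "k \<in> I" for k
  proof -
    have "(\<Sum>l\<in>I. a k * cnj (b l) * G k l) = (\<Sum>l\<in>{k, - k} \<inter> I. a k * cnj (b l) * G k l)"
    proof (rule sum.mono_neutral_right)
      show "\<forall>l\<in>I - {k, - k} \<inter> I. a k * cnj (b l) * G k l = 0"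
      proof
        fix l assume l: "l \<in> I - {k, - k} \<inter> I"
        then have "\<bar>k\<bar> \<noteq> \<bar>l\<bar>" by (auto simp: abs_eq_iff)
        then show "a k * cnj (b l) * G k l = 0" using yv_orthogonal[of k l] k l by (simp add: G_def I_def)
      qed
    qed (auto simp: I_def)
    also have "\<dots> = a k * cnj (b k) * G k k + h k"
    proof (cases "k \<noteq> 0 \<and> - k \<in> I")
      case True
      then have "{k, - k} \<inter> I = {k, - k}" "k \<noteq> - k" using k by auto
      then show ?thesis using True by (simp add: h_def)
    next
      case False
      then have "{k, - k} \<inter> I = {k}" using k by auto
      then show ?thesis using False by (auto simp: h_def)
    qed
    finally show ?thesis .
  qed
  have "cinner X (\<lambda>y. \<Sum>k\<in>I. a k * yv k y) (\<lambda>y. \<Sum>l\<in>I. b l * yv l y)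
      = (\<Sum>y\<in>X. \<Sum>k\<in>I. \<Sum>l\<in>I. a k * cnj (b l) * (yv k y * cnj (yv l y)))"
    by (simp add: cinner_def sum_product mult_ac)
  also have "\<dots> = (\<Sum>k\<in>I. \<Sum>y\<in>X. \<Sum>l\<in>I. a k * cnj (b l) * (yv k y * cnj (yv l y)))"
    by (rule sum.swap)
  also have "\<dots> = (\<Sum>k\<in>I. \<Sum>l\<in>I. \<Sum>y\<in>X. a k * cnj (b l) * (yv k y * cnj (yv l y)))"
    by (intro sum.cong refl sum.swap)
  also have "\<dots> = (\<Sum>k\<in>I. \<Sum>l\<in>I. a k * cnj (b l) * G k l)"
    by (simp add: G_def cinner_def sum_distrib_left)
  also have "\<dots> = (\<Sum>k\<in>I. a k * cnj (b k) * G k k) + (\<Sum>k\<in>I. h k)"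
    by (simp add: inner sum.distrib cong: sum.cong)
  also have "(\<Sum>k\<in>I. h k) = (\<Sum>k = 1..D - 1. h (int k) + h (- int k))"
    unfolding I_def sum_int_split[OF D0] by (simp add: h_def I_def)
  also have "\<dots> = (\<Sum>k = 1..D - 1. (a (int k) * cnj (b (- int k)) + a (- int k) * cnj (b (int k))) * G (int k) (- int k))"
  proof (intro sum.cong refl)
    fix k assume k: "k \<in> {1..D - 1}"
    then have "int k \<in> I" "- int k \<in> I" by (auto simp: I_def)
    then have "G (- int k) (int k) = G (int k) (- int k)"
      unfolding G_def I_def by (intro yv_inner_sym)
    then show "h (int k) + h (- int k)
        = (a (int k) * cnj (b (- int k)) + a (- int k) * cnj (b (int k))) * G (int k) (- int k)"
      using k \<open>int k \<in> I\<close> \<open>- int k \<in> I\<close> by (simp add: h_def distrib_right)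
  qed
  also have "\<dots> = (\<Sum>k = 1..int D - 1. (a k * cnj (b (- k)) + a (- k) * cnj (b k)) * G k (- k))"
    by (rule sum.reindex_bij_witness[of _ nat int]) auto
  finally show ?thesis
    by (simp add: Lform_def omega_def omega_check_def a_def b_def G_def I_def y_sum_def [abs_def])
qed

lemma Lform_ell:
  assumes "i < D" "j < D"
  shows "Lform sc q N D C x (ell q N D \<sigma> i) (ell q N D \<nu> j)
    = (if i = j \<and> \<sigma> = \<nu> then of_nat (card (cells \<sigma> i)) else 0)"
proof -
  have "Lform sc q N D C x (ell q N D \<sigma> i) (ell q N D \<nu> j)
    = cinner X (charvec (cells \<sigma> i)) (charvec (cells \<nu> j))"
    unfolding Lform_eq_cinner cinner_def charvec_cell_expansion[OF assms(1)] charvec_cell_expansion[OF assms(2)] ..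
  also have "\<dots> = (\<Sum>y\<in>X. if y \<in> cells \<sigma> i \<inter> cells \<nu> j then 1 else 0)"
    unfolding cinner_def by (intro sum.cong refl) (simp add: charvec_def)
  also have "\<dots> = of_nat (card (X \<inter> (cells \<sigma> i \<inter> cells \<nu> j)))"
    unfolding sum.inter_restrict[OF finX, symmetric] by simp
  also have "X \<inter> (cells \<sigma> i \<inter> cells \<nu> j) = (if i = j \<and> \<sigma> = \<nu> then cells \<sigma> i else {})"
    by (auto simp: cell)
  finally show ?thesis by (auto split: if_splits)
qed

text \<open>The only critical case is the last Plus polynomial, whose two constituents reach
  \<zeta>^D. Both are monic, so their difference has degree at most D - 1.\<close>

lemma ell_in_Lspace:
  assumes i: "i < D"
  shows "ell q N D \<sigma> i \<in> Lspace D"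
proof -
  have hp: "lbounded l l (hpoly q N D l)" "ltop (int l) 1 (hpoly q N D l)" if "l \<le> D" for l
    unfolding hpoly_eq[OF that]
    by (rule lbounded_qhahn_sum, rule ltop_qhahn_sum[OF Q_facts(1,3) t_facts(1)])
  have pp: "lbounded 1 1 (pperp q N D)" "ltop 1 1 (pperp q N D)"
  proof -
    have z: "lbounded 0 1 (zet 1 - lconst c)" "ltop 1 (1 - 0) (zet 1 - lconst c)" for c
      by (intro lbounded_diff lbounded_zet lbounded_lconst; simp)
        (intro ltop_diff ltop_zet ltop_lower, simp add: lconst_def)
    \<comment> \<open>The general bound for products would allow \<zeta>^1 here; multiplying out
      shows that no positive power occurs.\<close>
    have e: "zet (- 1) * (zet 1 - lconst c) = 1 - lconst c * zet (- 1)" for c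
      by (simp add: right_diff_distrib zet_def mult_single mult.commute)
    have "lbounded 1 0 (zet (- 1) * (zet 1 - lconst c))" for c
      unfolding e by (intro lbounded_diff lbounded_one lbounded_lconst_mult lbounded_zet) simp_all
    then have "lbounded (1 + 0) (0 + 1) (pperp q N D)"
      unfolding pperp_def Let_def by (intro lbounded_mult z)
    then show "lbounded 1 1 (pperp q N D)" by simp
    have "ltop (- 1 + 1 + 1) (1 * (1 - 0) * (1 - 0)) (pperp q N D)"
      unfolding pperp_def Let_def by (intro ltop_mult ltop_zet z)
    then show "ltop 1 1 (pperp q N D)" by simp
  qed
  have top: "lbounded (D - 1) (D - 1) (hperp q N D (D - 1))" "ltop (int (D - 1)) 1 (hperp q N D (D - 1))"
  proof -
    have f: "lbounded 1 1 (zet 1 + zet (- 1) - lconst c - lconst c')"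
      "ltop 1 (1 + 0 - 0 - 0) (zet 1 + zet (- 1) - lconst c - lconst c')" for c c'
      by (intro lbounded_diff lbounded_add lbounded_zet lbounded_lconst; simp)
        (intro ltop_diff ltop_add ltop_zet ltop_lower; simp add: lconst_def zet_def)
    have "lbounded (card {1..D - 1} * 1) (card {1..D - 1} * 1) (hperp q N D (D - 1))"
      unfolding hperp_def Let_def if_P[OF refl] by (intro lbounded_prod f) simp
    then show "lbounded (D - 1) (D - 1) (hperp q N D (D - 1))" by simp
    have "ltop (\<Sum>j = 1..D - 1. 1) (\<Prod>j = 1..D - 1. 1 + 0 - 0 - 0) (hperp q N D (D - 1))"
      unfolding hperp_def Let_def if_P[OF refl] by (intro ltop_prod f) simp
    then show "ltop (int (D - 1)) 1 (hperp q N D (D - 1))" by simp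
  qed
  have perp: "lbounded l l (hperp q N D l)" if "l \<le> D - 1" for l
  proof (cases "l = D - 1")
    case False
    then have l: "l \<le> D - 2" using that by simp
    show ?thesis unfolding hperp_eq[OF l] by (rule lbounded_qhahn_sum)
  qed (use top in simp)
  have prod: "lbounded (Suc l) (Suc l) (pperp q N D * hperp q N D l)" if "l \<le> D - 1" for l
    using lbounded_mult[OF pp(1) perp[OF that]] by simp
  have L: "f \<in> Lspace D" if "lbounded D (D - 1) f" for f
    using that D3 unfolding lbounded_def Lspace_iff by (simp add: of_nat_diff)
  show ?thesis
  proof (cases \<sigma>)
    case Minus
    have "lbounded i i (lconst c * (hpoly q N D i - (if i = 0 then 0 else lconst c' * pperp q N D * hperp q N D (i - 1))))"
      for c c'
    proof (cases i)
      case 0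
      then show ?thesis using hp(1)[of 0] by (simp add: lbounded_lconst_mult)
    next
      case (Suc l)
      have "lbounded i i (lconst c' * (pperp q N D * hperp q N D l))"
        using prod[of l] Suc i by (intro lbounded_lconst_mult) simp
      then show ?thesis
        using hp(1)[of i] i Suc by (intro lbounded_lconst_mult lbounded_diff) (simp_all add: mult.assoc)
    qed
    then have "lbounded i i (ell q N D Minus i)" by (simp only: ell.simps Let_def)
    then show ?thesis unfolding Minus using i by (intro L) (erule lbounded_mono; simp)
  next
    case Plus
    have b: "lbounded (Suc i) (Suc i) (hpoly q N D (Suc i) - pperp q N D * hperp q N D i)"
      using hp(1)[of "Suc i"] prod[of i] i by (intro lbounded_diff) simp_all
    have "lbounded D (D - 1) (hpoly q N D (Suc i) - pperp q N D * hperp q N D i)"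
    proof (cases "i = D - 1")
      case True
      then have Si: "Suc i = D" using i by simp
      have "ltop (1 + int (D - 1)) (1 * 1) (pperp q N D * hperp q N D i)"
        unfolding True by (rule ltop_mult[OF pp(2) top(2)])
      moreover have "1 + int (D - 1) = int (Suc i)" using Si by simp
      ultimately have "ltop (int (Suc i)) (1 - 1) (hpoly q N D (Suc i) - pperp q N D * hperp q N D i)"
        using hp(2)[of "Suc i"] Si by (intro ltop_diff) simp_all
      then have "ltop (int (Suc i)) 0 (hpoly q N D (Suc i) - pperp q N D * hperp q N D i)" by simp
      then have "lbounded (Suc i) i (hpoly q N D (Suc i) - pperp q N D * hperp q N D i)"
        by (rule lbounded_reduce[OF b])
      then show ?thesis by (rule lbounded_mono) (use Si in simp_all)
    next
      case False
      show ?thesis using b by (rule lbounded_mono) (use False i in simp_all)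
    qed
    then show ?thesis unfolding Plus by (intro L) (simp add: Let_def lbounded_lconst_mult)
  qed
qed

text \<open>A linear relation between the ell becomes, under \<open>y_sum\<close>, one between
  characteristic vectors of disjoint non-empty cells; evaluation at a vertex of one cell isolates
  its coefficient.\<close>

lemma ell_basis:
  defines "f \<equiv> \<lambda>(\<sigma>, i). ell q N D \<sigma> i"
  shows "inj_on f (UNIV \<times> {..<D})" and "laurent.independent (f ` (UNIV \<times> {..<D}))"
    and "laurent.span (f ` (UNIV \<times> {..<D})) = Lspace D"
proof -
  let ?P = "(UNIV :: pm set) \<times> {..<D}"
  have finP: "finite ?P" by (simp add: UNIV_pm)
  show inj: "inj_on f ?P"
  proof (rule inj_onI)
    fix p p' assume p: "p \<in> ?P" "p' \<in> ?P" and eq: "f p = f p'"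
    obtain \<sigma> i \<nu> j where pp: "p = (\<sigma>, i)" "p' = (\<nu>, j)" by (meson surj_pair)
    have ij: "i < D" "j < D" using p by (auto simp: pp)
    have e: "ell q N D \<sigma> i = ell q N D \<nu> j" using eq by (simp add: f_def pp)
    have "Lform sc q N D C x (ell q N D \<sigma> i) (ell q N D \<nu> j) = of_nat (card (cells \<sigma> i))"
      unfolding e [symmetric] using Lform_ell[OF ij(1,1)] by simp
    then have "Lform sc q N D C x (ell q N D \<sigma> i) (ell q N D \<nu> j) \<noteq> 0"
      using card_cell_pos[OF ij(1), of \<sigma>] by simp
    then show "p = p'" unfolding Lform_ell[OF ij] pp by (simp split: if_splits)
  qed
  show ind: "laurent.independent (f ` ?P)"
  proof
    assume "laurent.dependent (f ` ?P)"
    then obtain u p where p: "p \<in> ?P" "u (f p) \<noteq> 0" and z: "(\<Sum>v\<in>f ` ?P. lscale (u v) v) = 0"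
      unfolding laurent.dependent_finite[OF finite_imageI[OF finP]] by blast
    obtain \<sigma> i where "p = (\<sigma>, i)" by (meson surj_pair)
    then have i: "i \<in> {..<D}" and u: "u (f (\<sigma>, i)) \<noteq> 0" using p by auto
    obtain y where y: "y \<in> cells \<sigma> i" using card_cell_pos[of i \<sigma>] i by fastforce
    have z': "(\<Sum>p\<in>?P. lscale (u (f p)) (f p)) = 0" using z by (simp add: sum.reindex[OF inj])
    have "0 = y_sum (\<Sum>p\<in>?P. lscale (u (f p)) (f p)) y"
      unfolding z' by (simp add: y_sum_def)
    also have "\<dots> = (\<Sum>p\<in>?P. u (f p) * y_sum (f p) y)"
      unfolding y_sum_def sum_distrib_left leval_sum sum_distrib_right
      by (subst sum.swap) (simp only: leval_lscale[OF la_nonzero] mult.assoc)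
    also have "\<dots> = (\<Sum>p\<in>?P. if p = (\<sigma>, i) then u (f (\<sigma>, i)) else 0)"
    proof (intro sum.cong refl)
      fix p assume p: "p \<in> ?P"
      obtain \<nu> j where pj: "p = (\<nu>, j)" by (meson surj_pair)
      have "y_sum (f p) y = charvec (cells \<nu> j) y"
        using charvec_cell_expansion[of j \<nu> y] p by (simp add: f_def pj)
      moreover have "charvec (cells \<nu> j) y = (if p = (\<sigma>, i) then 1 else 0)"
        using y by (auto simp: charvec_def cell pj)
      ultimately show "u (f p) * y_sum (f p) y = (if p = (\<sigma>, i) then u (f (\<sigma>, i)) else 0)" by simp
    qed
    also have "\<dots> = u (f (\<sigma>, i))" using finP i by simp
    finally show False using u by simp
  qed
  show "laurent.span (f ` ?P) = Lspace D"
  proof (rule span_eq_Lspace[OF finite_imageI[OF finP] _ ind])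
    show "card (f ` ?P) = 2 * D" unfolding card_image[OF inj] card_cartesian_product by (simp add: UNIV_pm)
    show "f ` ?P \<subseteq> Lspace D" using ell_in_Lspace by (auto simp: f_def)
  qed
qed

end

theorem theorem9p9:
  fixes sc :: "'k::{field,finite} \<Rightarrow> 'v::ab_group_add \<Rightarrow> 'v"
    and q N D :: nat
    and C :: "'v set set" and x :: "'v set"
  assumes "vector_space sc"
    and "CARD('k) = q"
    and "vector_space.dim sc (UNIV :: 'v set) = N"
    and "D \<ge> 3" and "N \<ge> 2 * D"
    and "delsarte_clique sc q N D C" and "x \<in> C"
  shows "(inj_on (\<lambda>(\<sigma>, i). ell q N D \<sigma> i) (UNIV \<times> {..<D})
      \<and> \<not> module.dependent lscale ((\<lambda>(\<sigma>, i). ell q N D \<sigma> i) ` (UNIV \<times> {..<D}))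
      \<and> module.span lscale ((\<lambda>(\<sigma>, i). ell q N D \<sigma> i) ` (UNIV \<times> {..<D})) = Lspace D)
    \<and> (\<forall>i<D. \<forall>j<D. \<forall>\<sigma> \<nu>.
        Lform sc q N D C x (ell q N D \<sigma> i) (ell q N D \<nu> j)
          = (if i = j \<and> \<sigma> = \<nu> then of_nat (card (Cpm sc D C x \<sigma> i)) else 0)
      \<and> (if i = j \<and> \<sigma> = \<nu> then of_nat (card (Cpm sc D C x \<sigma> i)) else (0::real))
          = (if i = j \<and> \<sigma> = \<nu>
             then (case \<sigma> of
                Minus \<Rightarrow> real q ^ (i * (i + 1))
                  * (\<Prod>h = 1..i. (real q ^ (D - h) - 1) * (real q ^ (N - D + 1 - h) - 1)
                                 / (real q ^ h - 1)\<^sup>2)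
              | Plus \<Rightarrow> real q ^ ((i + 1)\<^sup>2) * (real q ^ (N - D) - 1) / (real q - 1)
                  * (\<Prod>h = 1..i. (real q ^ (D - h) - 1) * (real q ^ (N - D - h) - 1)
                                 / ((real q ^ h - 1) * (real q ^ (h + 1) - 1))))
             else 0))"
proof -
  obtain cls where "delsarte_cells sc q N D C x cls"
  proof (rule clique_cells[OF assms], goal_cases)
    case (1 cls)
    show ?case by (rule 1(1)) (unfold_locales; fact 1(2-) assms)
  qed
  then interpret delsarte_cells sc q N D C x cls .
  show ?thesis
    using ell_basis Lform_ell card_cell_Minus card_cell_Plus by (auto split: pm.split)
qed

end
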